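(* For all positive integers $n,t,d$ with $n>t$ and every real $0\le\epsilon<1/2$, there exist efficient probabilistically conditionally successful General Entanglement Purification Protocols with each of the following parameters $\langle N,K,M,\epsilon,\delta,p,q\rangle$: 1. $\Big\langle 2^n,\ (2^n-1)2^{2t},\ 2^{n-t}(2^n-1),\ \epsilon,\ \frac{\epsilon}{2^{t-3}},\ 2\epsilon+\sqrt{\frac{2\epsilon}{2^t}},\ \frac1{2^t}\Big\rangle$; 2. $\Big\langle 2^{2n},\ (2^n+1)2^{2t},\ 2^{n}(2^n+1),\ \epsilon,\ \frac{\epsilon}{2^{t-3}},\ 2\epsilon+\sqrt{\frac{2\epsilon}{2^t}},\ \frac1{2^t}\Big\rangle$; 3. $\Big\langle 2^{dn},\ \frac{2^{dn}-1}{2^n-1}\cdot 2^{2t},\ 2^{(d-1)n}\cdot\frac{2^{dn}-1}{2^n-1},\ \epsilon,\ \frac{\epsilon}{2^{t-3}},\ 2\epsilon+\sqrt{\frac{2\epsilon}{2^t}},\ \frac1{2^t}\Big\rangle$.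
   Context: Let $\mathcal H_T$ be a $T$-dimensional complex Hilbert space with computational basis $|0\rangle,\dots,|T-1\rangle$. In a bipartite system $\mathcal H_T^A\otimes\mathcal H_T^B$ (first factor held by Alice, second by Bob) put $\Psi_T=\frac1{\sqrt T}\sum_{i=0}^{T-1}|i\rangle^A|i\rangle^B$. The fidelity of a (mixed) state $\rho$ on $\mathcal H_T^A\otimes\mathcal H_T^B$ is $F(\rho)=\langle\Psi_T|\rho|\Psi_T\rangle$. A General Entanglement Purification Protocol (GEPP) $\mathcal P$ with dimensions $N,K,M$ receives an unknown state $\rho$ on $\mathcal H_N^A\otimes\mathcal H_N^B$ together with the auxiliary state $\Psi_K$ on $\mathcal H_K^A\otimes\mathcal H_K^B$. Alice and Bob apply only local operations (local unitaries, local ancillas, local measurements, discarding of local subsystems, classical randomness) and classical communication (LOCC). At the end they either output the symbol FAIL (written $\mathcal P(\rho)=\mathrm{FAIL}$) or output a (possibly mixed) state $\mathcal P(\rho)$ on $\mathcal H_M^A\otimes\mathcal H_M^B$. The result $\mathcal P(\rho)$ is random, depending on the classical random choices and measurement outcomes that are retained; when such classical information is discarded, the output is the corresponding averaged mixed state. The protocol does not depend on $\rho$. $\mathcal P$ is probabilistically conditionally successful with parameter $\langle N,K,M,\epsilon,\delta,p,q\rangle$ if for all input states $\rho$ with $F(\rho)=1-\epsilon$: $\Pr[\mathcal P(\rho)=\mathrm{FAIL}]\le p$ and $\Pr[F(\mathcal P(\rho))\ge 1-\delta\mid \mathcal P(\rho)\ne\mathrm{FAIL}]\ge 1-q$. A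 GEPP (family, as the parameters vary) is efficient if there is a constant $c$ such that it can be implemented by quantum circuits of size $O((\log N+\log K)^c)$. *)

theory Defs
  imports
    "Jordan_Normal_Form.Schur_Decomposition"
    "HOL-Library.Log_Nat"
begin

section \<open>States and fidelity\<close>

text \<open>
  A system of dimension \<open>d\<close> has basis \<open>|0>, ..., |d - 1>\<close>. In a bipartite system where Alice
  has dimension \<open>a\<close> and Bob has dimension \<open>b\<close>, the basis vector \<open>|i>|j>\<close> has index \<open>i * b + j\<close>,
  in agreement with the Kronecker product below.
\<close>

definition kron :: "complex mat \<Rightarrow> complex mat \<Rightarrow> complex mat" where
  "kron A B = mat (dim_row A * dim_row B) (dim_col A * dim_col B)
     (\<lambda>(i, j). A $$ (i div dim_row B, j div dim_col B) * B $$ (i mod dim_row B, j mod dim_col B))"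

definition mat_trace :: "complex mat \<Rightarrow> complex" where
  "mat_trace A = (\<Sum>i<dim_row A. A $$ (i, i))"

definition mat_sum :: "nat \<Rightarrow> complex mat list \<Rightarrow> complex mat" where
  "mat_sum d As = foldr (+) As (0\<^sub>m d d)"

definition density_operator :: "nat \<Rightarrow> complex mat \<Rightarrow> bool" where
  "density_operator d \<rho> \<longleftrightarrow> \<rho> \<in> carrier_mat d d \<and>
     (\<forall>v \<in> carrier_vec d. 0 \<le> (\<rho> *\<^sub>v v) \<bullet>c v) \<and> mat_trace \<rho> = 1"

definition max_ent :: "nat \<Rightarrow> complex vec" where
  "max_ent T = vec (T * T) (\<lambda>x. if x div T = x mod T then 1 / complex_of_real (sqrt (real T)) else 0)"

definition fidelity :: "nat \<Rightarrow> complex mat \<Rightarrow> real" where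
  "fidelity T \<rho> = Re ((\<rho> *\<^sub>v max_ent T) \<bullet>c max_ent T)"

section \<open>General entanglement purification protocols\<close>

datatype party = Alice | Bob

text \<open>
  A finite LOCC protocol as a tree. \<open>Local p Es cont\<close> means that party \<open>p\<close> applies the local
  quantum operation with Kraus operators \<open>Es\<close>, where outcome \<open>k\<close> (operator \<open>Es ! k\<close>) is announced
  and the protocol goes on with \<open>cont k\<close>. Local unitaries (one Kraus operator), local ancillas (one
  isometry), local measurements, discarding of local subsystems and classical randomness (Kraus
  operators \<open>\<surd>p\<^sub>k 1\<close>) are all of this form, and an operator may change the local dimension.

  \<open>Halt None\<close> outputs FAIL, and \<open>Halt (Some r)\<close> outputs the current state, where \<open>r\<close> is the
  classical information that is retained. All other classical information is discarded.
\<close>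

datatype locc =
    Halt "nat option"
  | Local party "complex mat list" "nat \<Rightarrow> locc"

definition local_op :: "party \<Rightarrow> nat \<Rightarrow> nat \<Rightarrow> complex mat \<Rightarrow> complex mat" where
  "local_op p a b E = (case p of Alice \<Rightarrow> kron E (1\<^sub>m b) | Bob \<Rightarrow> kron (1\<^sub>m a) E)"

definition sandwich :: "complex mat \<Rightarrow> complex mat \<Rightarrow> complex mat" where
  "sandwich E \<rho> = E * \<rho> * mat_adjoint E"

definition complete_kraus :: "nat \<Rightarrow> complex mat list \<Rightarrow> bool" where
  "complete_kraus d Es \<longleftrightarrow> (\<forall>E \<in> set Es. dim_col E = d) \<and>
     mat_sum d (map (\<lambda>E. mat_adjoint E * E) Es) = 1\<^sub>m d"

primrec locc_protocol :: "locc \<Rightarrow> nat \<Rightarrow> nat \<Rightarrow> nat \<Rightarrow> bool" where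
  "locc_protocol (Halt r) a b M \<longleftrightarrow> (r \<noteq> None \<longrightarrow> a = M \<and> b = M)"
| "locc_protocol (Local p Es cont) a b M \<longleftrightarrow>
     complete_kraus (case p of Alice \<Rightarrow> a | Bob \<Rightarrow> b) Es \<and>
     (\<forall>k < length Es. locc_protocol (cont k)
        (case p of Alice \<Rightarrow> dim_row (Es ! k) | Bob \<Rightarrow> a)
        (case p of Alice \<Rightarrow> b | Bob \<Rightarrow> dim_row (Es ! k)) M)"

text \<open>The final, unnormalised states of all branches; the trace is the probability of the branch.\<close>

primrec branches :: "locc \<Rightarrow> nat \<Rightarrow> nat \<Rightarrow> complex mat \<Rightarrow> (nat option \<times> complex mat) list" where
  "branches (Halt r) a b \<rho> = [(r, \<rho>)]"
| "branches (Local p Es cont) a b \<rho> = concat (map (\<lambda>k.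
     branches (cont k)
       (case p of Alice \<Rightarrow> dim_row (Es ! k) | Bob \<Rightarrow> a)
       (case p of Alice \<Rightarrow> b | Bob \<Rightarrow> dim_row (Es ! k))
       (sandwich (local_op p a b (Es ! k)) \<rho>)) [0..<length Es])"

text \<open>
  The initial state \<open>\<rho> \<otimes> \<Psi>\<^sub>K\<close>, regrouped such that Alice holds \<open>H\<^sub>N\<^sup>A \<otimes> H\<^sub>K\<^sup>A\<close> and Bob holds
  \<open>H\<^sub>N\<^sup>B \<otimes> H\<^sub>K\<^sup>B\<close>: the basis vector with index \<open>(i * K + k) * (N * K) + (j * K + l)\<close> has
  index \<open>i * N + j\<close> in the system of \<open>\<rho>\<close> and index \<open>k * K + l\<close> in the system of \<open>\<Psi>\<^sub>K\<close>.
\<close>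

definition data_index :: "nat \<Rightarrow> nat \<Rightarrow> nat \<Rightarrow> nat" where
  "data_index N K x = (x div (N * K) div K) * N + x mod (N * K) div K"

definition aux_index :: "nat \<Rightarrow> nat \<Rightarrow> nat \<Rightarrow> nat" where
  "aux_index N K x = (x div (N * K) mod K) * K + x mod (N * K) mod K"

definition gepp_input :: "nat \<Rightarrow> nat \<Rightarrow> complex mat \<Rightarrow> complex mat" where
  "gepp_input N K \<rho> = mat ((N * K) * (N * K)) ((N * K) * (N * K)) (\<lambda>(x, y).
     \<rho> $$ (data_index N K x, data_index N K y) *
     (max_ent K $ aux_index N K x * cnj (max_ent K $ aux_index N K y)))"

definition gepp :: "nat \<Rightarrow> nat \<Rightarrow> nat \<Rightarrow> locc \<Rightarrow> bool" where
  "gepp N K M P \<longleftrightarrow> locc_protocol P (N * K) (N * K) M"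

text \<open>
  The random result of a protocol: the probability of FAIL, and for every value \<open>r\<close> of the retained
  classical information an unnormalised state \<open>\<sigma> r\<close> on \<open>H\<^sub>M\<^sup>A \<otimes> H\<^sub>M\<^sup>B\<close>. The value \<open>r\<close> occurs with
  probability \<open>tr (\<sigma> r)\<close>, and the output is then \<open>\<sigma> r / tr (\<sigma> r)\<close>.
\<close>

type_synonym result = "real \<times> (nat \<Rightarrow> complex mat)"

definition gepp_result :: "nat \<Rightarrow> nat \<Rightarrow> nat \<Rightarrow> locc \<Rightarrow> complex mat \<Rightarrow> result" where
  "gepp_result N K M P \<rho> =
     (let bs = branches P (N * K) (N * K) (gepp_input N K \<rho>)
      in (\<Sum>(s, \<omega>) \<leftarrow> filter (\<lambda>(s, \<omega>). s = None) bs. Re (mat_trace \<omega>),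
          \<lambda>r. mat_sum (M * M) (map snd (filter (\<lambda>(s, \<omega>). s = Some r) bs))))"

definition prob_fidelity_ge :: "nat \<Rightarrow> real \<Rightarrow> (nat \<Rightarrow> complex mat) \<Rightarrow> real" where
  "prob_fidelity_ge M f \<sigma> =
     (\<Sum>r | mat_trace (\<sigma> r) \<noteq> 0 \<and> fidelity M (inverse (mat_trace (\<sigma> r)) \<cdot>\<^sub>m \<sigma> r) \<ge> f.
        Re (mat_trace (\<sigma> r)))"

type_synonym gepp_params = "nat \<times> nat \<times> nat \<times> real \<times> real \<times> real \<times> real"

text \<open>The condition on the conditional probability is void if the protocol fails with certainty.\<close>

fun prob_cond_successful :: "gepp_params \<Rightarrow> locc \<Rightarrow> bool" where
  "prob_cond_successful (N, K, M, \<epsilon>, \<delta>, p, q) P \<longleftrightarrow>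
     (\<forall>\<rho>. density_operator (N * N) \<rho> \<and> fidelity N \<rho> = 1 - \<epsilon> \<longrightarrow>
        (case gepp_result N K M P \<rho> of (fail, \<sigma>) \<Rightarrow>
           fail \<le> p \<and>
           (fail < 1 \<longrightarrow> prob_fidelity_ge M (1 - \<delta>) \<sigma> / (1 - fail) \<ge> 1 - q)))"

section \<open>Quantum circuits for such protocols\<close>

text \<open>
  Each party holds a register of qubits; bit \<open>w\<close> of the index of a basis vector of the register is
  the value of wire \<open>w\<close>. The list \<open>ws\<close> of wires has the value \<open>wires_val ws x\<close>, with \<open>ws ! 0\<close> the
  least significant bit.
\<close>

definition wires_val :: "nat list \<Rightarrow> nat \<Rightarrow> nat" where
  "wires_val ws x = horner_sum of_bool 2 (map (bit x) ws)"

definition lift_gate :: "nat \<Rightarrow> nat list \<Rightarrow> complex mat \<Rightarrow> complex mat" where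
  "lift_gate n ws U = mat (2 ^ n) (2 ^ n) (\<lambda>(x, y).
     if \<forall>w<n. w \<notin> set ws \<longrightarrow> bit x w = bit y w then U $$ (wires_val ws x, wires_val ws y) else 0)"

definition wire_proj :: "nat \<Rightarrow> nat \<Rightarrow> bool \<Rightarrow> complex mat" where
  "wire_proj n w v = mat (2 ^ n) (2 ^ n) (\<lambda>(x, y). of_bool (x = y \<and> bit x w = v))"

definition pauli_X :: "complex mat" where
  "pauli_X = mat 2 2 (\<lambda>(i, j). of_bool (i \<noteq> j))"

text \<open>
  \<open>Send p w w'\<close>: party \<open>p\<close> measures her wire \<open>w\<close> in the computational basis and communicates the
  outcome to the other party, who adds it modulo 2 to her wire \<open>w'\<close>. Fair random bits are obtained by
  measuring a Hadamard transformed ancilla, and classical computations are reversible computations on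
  wires. Gates on three wires are allowed so that a Toffoli gate is elementary. A unitary on three
  qubits is a product of boundedly many gates on at most two qubits, so this affects sizes
  by a constant factor only.
\<close>

datatype instruction =
    Gate party "nat list" "complex mat"
  | Measure party nat
  | Send party nat nat

text \<open>
  In the end \<open>fail_wire\<close> and \<open>record_wires\<close> (of Alice) are measured; the former decides on FAIL, and
  the outcome of the latter is the retained classical information. The wires in \<open>alice_out\<close> and
  \<open>bob_out\<close> carry the output, and all others are discarded.
\<close>

record locc_circuit =
  alice_wires :: nat
  bob_wires :: nat
  instructions :: "instruction list"
  fail_wire :: nat
  record_wires :: "nat list"
  alice_out :: "nat list"
  bob_out :: "nat list"

definition circuit_size :: "locc_circuit \<Rightarrow> nat" where
  "circuit_size C = alice_wires C + bob_wires C + length (instructions C)"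

fun valid_instruction :: "nat \<Rightarrow> nat \<Rightarrow> instruction \<Rightarrow> bool" where
  "valid_instruction a b (Gate p ws U) \<longleftrightarrow>
     distinct ws \<and> set ws \<subseteq> {..<(case p of Alice \<Rightarrow> a | Bob \<Rightarrow> b)} \<and> length ws \<le> 3 \<and>
     U \<in> carrier_mat (2 ^ length ws) (2 ^ length ws) \<and> mat_adjoint U * U = 1\<^sub>m (2 ^ length ws)"
| "valid_instruction a b (Measure p w) \<longleftrightarrow> w < (case p of Alice \<Rightarrow> a | Bob \<Rightarrow> b)"
| "valid_instruction a b (Send p w w') \<longleftrightarrow>
     w < (case p of Alice \<Rightarrow> a | Bob \<Rightarrow> b) \<and> w' < (case p of Alice \<Rightarrow> b | Bob \<Rightarrow> a)"

definition valid_circuit :: "nat \<Rightarrow> nat \<Rightarrow> nat \<Rightarrow> locc_circuit \<Rightarrow> bool" where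
  "valid_circuit N K M C \<longleftrightarrow>
     ceillog2 N + ceillog2 K \<le> alice_wires C \<and>
     ceillog2 N + ceillog2 K \<le> bob_wires C \<and>
     (\<forall>s \<in> set (instructions C). valid_instruction (alice_wires C) (bob_wires C) s) \<and>
     distinct (alice_out C) \<and> distinct (record_wires C) \<and> distinct (bob_out C) \<and>
     insert (fail_wire C) (set (record_wires C)) \<inter> set (alice_out C) = {} \<and>
     insert (fail_wire C) (set (record_wires C) \<union> set (alice_out C)) \<subseteq> {..<alice_wires C} \<and>
     set (bob_out C) \<subseteq> {..<bob_wires C} \<and>
     length (alice_out C) = ceillog2 M \<and> length (bob_out C) = ceillog2 M"

text \<open>
  The input \<open>|i>|k>\<close> of \<open>H\<^sub>N \<otimes> H\<^sub>K\<close> is written in binary to the first \<open>\<lceil>log N\<rceil>\<close> and the following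
  \<open>\<lceil>log K\<rceil>\<close> wires. All remaining wires are ancillas in state \<open>|0>\<close>.
\<close>

definition encode :: "nat \<Rightarrow> nat \<Rightarrow> nat \<Rightarrow> complex mat" where
  "encode n N K = mat (2 ^ n) (N * K)
     (\<lambda>(x, y). of_bool (x = y div K + 2 ^ ceillog2 N * (y mod K)))"

text \<open>Kraus operators of an instruction, for \<open>a\<close> wires of Alice and \<open>b\<close> wires of Bob.\<close>

fun instruction_kraus :: "nat \<Rightarrow> nat \<Rightarrow> instruction \<Rightarrow> complex mat list" where
  "instruction_kraus a b (Gate p ws U) =
     [local_op p (2 ^ a) (2 ^ b) (lift_gate (case p of Alice \<Rightarrow> a | Bob \<Rightarrow> b) ws U)]"
| "instruction_kraus a b (Measure p w) =
     map (\<lambda>v. local_op p (2 ^ a) (2 ^ b) (wire_proj (case p of Alice \<Rightarrow> a | Bob \<Rightarrow> b) w v)) [False, True]"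
| "instruction_kraus a b (Send Alice w w') =
     [kron (wire_proj a w False) (1\<^sub>m (2 ^ b)), kron (wire_proj a w True) (lift_gate b [w'] pauli_X)]"
| "instruction_kraus a b (Send Bob w w') =
     [kron (1\<^sub>m (2 ^ a)) (wire_proj b w False), kron (lift_gate a [w'] pauli_X) (wire_proj b w True)]"

definition apply_kraus :: "nat \<Rightarrow> complex mat list \<Rightarrow> complex mat \<Rightarrow> complex mat" where
  "apply_kraus d Es \<rho> = mat_sum d (map (\<lambda>E. sandwich E \<rho>) Es)"

definition final_state :: "nat \<Rightarrow> nat \<Rightarrow> locc_circuit \<Rightarrow> complex mat \<Rightarrow> complex mat" where
  "final_state N K C \<rho> = (let a = alice_wires C; b = bob_wires C in
     fold (\<lambda>s. apply_kraus (2 ^ a * 2 ^ b) (instruction_kraus a b s)) (instructions C)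
       (sandwich (kron (encode a N K) (encode b N K)) (gepp_input N K \<rho>)))"

text \<open>
  The partial map that reads the output in \<open>H\<^sub>M\<close> from the wires \<open>ws\<close> if the other wires are as in
  the basis state \<open>e\<close>; \<open>env_states n ws\<close> has one representative \<open>e\<close> for each state of the other wires.
\<close>

definition readout :: "nat \<Rightarrow> nat list \<Rightarrow> nat \<Rightarrow> nat \<Rightarrow> complex mat" where
  "readout n ws M e = mat M (2 ^ n) (\<lambda>(i, x).
     of_bool (wires_val ws x = i \<and> (\<forall>w<n. w \<notin> set ws \<longrightarrow> bit x w = bit e w)))"

definition env_states :: "nat \<Rightarrow> nat list \<Rightarrow> nat list" where
  "env_states n ws = filter (\<lambda>e. \<forall>w \<in> set ws. \<not> bit e w) [0..<2 ^ n]"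

definition circuit_result :: "nat \<Rightarrow> nat \<Rightarrow> nat \<Rightarrow> locc_circuit \<Rightarrow> complex mat \<Rightarrow> result" where
  "circuit_result N K M C \<rho> =
     (let a = alice_wires C; b = bob_wires C; \<omega> = final_state N K C \<rho>
      in (Re (mat_trace (sandwich (local_op Alice (2 ^ a) (2 ^ b) (wire_proj a (fail_wire C) True)) \<omega>)),
          \<lambda>r. apply_kraus (M * M)
            [kron (readout a (alice_out C) M e) (readout b (bob_out C) M f).
               e \<leftarrow> filter (\<lambda>e. \<not> bit e (fail_wire C) \<and> wires_val (record_wires C) e = r)
                      (env_states a (alice_out C)),
               f \<leftarrow> env_states b (bob_out C)] \<omega>))"

text \<open>
  If \<open>P\<close> is a protocol, its result has total probability 1. Hence equality of the results implies
  that the output wires of the circuit never hold a value outside of \<open>{..<M}\<close>.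
\<close>

definition implements :: "nat \<Rightarrow> nat \<Rightarrow> nat \<Rightarrow> locc_circuit \<Rightarrow> locc \<Rightarrow> bool" where
  "implements N K M C P \<longleftrightarrow> valid_circuit N K M C \<and>
     (\<forall>\<rho>. density_operator (N * N) \<rho> \<longrightarrow> circuit_result N K M C \<rho> = gepp_result N K M P \<rho>)"

section \<open>Efficient families\<close>

definition efficient_family :: "'i set \<Rightarrow> ('i \<Rightarrow> gepp_params) \<Rightarrow> ('i \<Rightarrow> locc) \<Rightarrow> bool" where
  "efficient_family I par P \<longleftrightarrow> (\<exists>(c :: nat) (B :: real). \<forall>i \<in> I. case par i of (N, K, M, _) \<Rightarrow>
     \<exists>C. implements N K M C (P i) \<and>
         real (circuit_size C) \<le> B * (log 2 (real N) + log 2 (real K)) ^ c)"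

definition efficient_pcs_gepps_exist :: "'i set \<Rightarrow> ('i \<Rightarrow> gepp_params) \<Rightarrow> bool" where
  "efficient_pcs_gepps_exist I par \<longleftrightarrow> (\<exists>P.
     (\<forall>i \<in> I. (case par i of (N, K, M, _) \<Rightarrow> gepp N K M (P i)) \<and> prob_cond_successful (par i) (P i)) \<and>
     efficient_family I par P)"

end

theory Submission
  imports Defs "HOL-Library.Nat_Bijection"
begin

text \<open>
  Only two properties of the auxiliary state are needed: a factor \<open>\<Psi>\<close> of dimension \<open>k\<close> (\<open>2\<^sup>n - 1\<close>,
  \<open>2\<^sup>n + 1\<close> and \<open>(2\<^sup>d\<^sup>n - 1) / (2\<^sup>n - 1)\<close>, respectively) is passed on untouched to the output, and the
  remaining \<open>2t\<close> perfect EPR pairs pay for random hashing. Of the noisy state, some qubits are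
  discarded, which cannot decrease the fidelity, and \<open>m\<close> qubits are kept. Alice draws random
  strings and announces them. For each of the first \<open>t\<close> strings both parties add the corresponding
  parity of their kept bits to their half of an EPR pair; comparing the two halves reveals the parity
  of the bit errors and nothing else. After a Hadamard transform of the kept qubits the same is done
  with \<open>t\<close> parities of the phase errors, and the protocol fails if any parity is odd.

  Let \<open>F\<close> be the fidelity of the kept part. The maximally entangled component always passes, and any
  orthogonal Bell state fails one of the tests except with probability \<open>2\<^sup>-\<^sup>t\<close>. Hence the protocol
  succeeds with a probability \<open>T\<close> such that \<open>F \<le> T \<le> F + 2 (1 - F) / 2\<^sup>t\<close>, and the fidelity of the
  (unnormalised) output is exactly \<open>F\<close>, so that no classical information has to be retained.
\<close>

text \<open>The protocol is needed twice, as an LOCC tree and as a small circuit. Only the circuit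
  is designed; the tree is compiled from it. The final state is never computed. Three linear
  functionals of it suffice: its trace, the trace of its passing part and the overlap of that part
  with \<open>max_ent M\<close>. Each is a kernel on pairs of basis states that is pulled back
  through the circuit, as in the Heisenberg picture. Classical gates then substitute, measurements
  dephase, and only Hadamard gates create sums; the resulting path sums are evaluated by
  orthogonality of characters. Comparing halves of an EPR pair reveals only the parity of the errors
  because the common random bit of the pair masks the parity of each party. The overlap is exactly F
  because pairs with equal bits pass every test, both before and after the Hadamard gates, and the
  maximally entangled state is fixed by them. By \<epsilon> < 1/2 the success probability exceeds
  1/2, so normalising at most doubles the loss 2 \<epsilon> / 2^t, which stays below the permitted 8
  \<epsilon> / 2^t.\<close>

lemma dim_mat_adjoint [simp]:
  "dim_row (mat_adjoint A) = dim_col A" "dim_col (mat_adjoint A) = dim_row A"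
  by (auto simp: mat_adjoint_def)

lemma mat_adjoint_carrier [simp]: "A \<in> carrier_mat r c \<Longrightarrow> mat_adjoint A \<in> carrier_mat c r"
  by (auto intro!: carrier_matI)

lemma mat_adjoint_index [simp]:
  fixes A :: "complex mat"
  assumes "i < dim_col A" "j < dim_row A"
  shows "mat_adjoint A $$ (i, j) = cnj (A $$ (j, i))"
  using assms by (simp add: mat_adjoint_def mat_of_rows_def)

lemma mult_mat_index:
  assumes "i < dim_row A" "j < dim_col B" "dim_col A = dim_row B"
  shows "(A * B) $$ (i, j) = (\<Sum>k<dim_row B. A $$ (i, k) * B $$ (k, j))"
  using assms by (auto simp: scalar_prod_def atLeast0LessThan intro!: sum.cong)

lemma mat_adjoint_mult:
  fixes A B :: "complex mat"
  assumes "A \<in> carrier_mat r c" "B \<in> carrier_mat c d"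
  shows "mat_adjoint (A * B) = mat_adjoint B * mat_adjoint A"
  using assms by (intro eq_matI) (auto simp: mult_mat_index simp del: index_mult_mat(1) intro!: sum.cong)

lemma sandwich_carrier [simp]:
  "E \<in> carrier_mat r c \<Longrightarrow> sandwich E \<rho> \<in> carrier_mat r r"
  by (auto simp: sandwich_def)

lemma dim_sandwich [simp]: "dim_row (sandwich E \<rho>) = dim_row E" "dim_col (sandwich E \<rho>) = dim_row E"
  by (auto simp: sandwich_def)

lemma sandwich_index:
  assumes "E \<in> carrier_mat r c" "\<rho> \<in> carrier_mat c c" "i < r" "j < r"
  shows "sandwich E \<rho> $$ (i, j) = (\<Sum>k<c. \<Sum>l<c. E $$ (i, k) * \<rho> $$ (k, l) * cnj (E $$ (j, l)))"
proof -
  have "sandwich E \<rho> $$ (i, j) = (\<Sum>l<c. (\<Sum>k<c. E $$ (i, k) * \<rho> $$ (k, l)) * cnj (E $$ (j, l)))"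
    unfolding sandwich_def using assms
    by (auto simp: mult_mat_index simp del: index_mult_mat(1) intro!: sum.cong)
  also have "\<dots> = (\<Sum>k<c. \<Sum>l<c. E $$ (i, k) * \<rho> $$ (k, l) * cnj (E $$ (j, l)))"
    unfolding sum_distrib_right by (rule sum.swap)
  finally show ?thesis .
qed

lemma sandwich_mult:
  assumes "A \<in> carrier_mat r c" "B \<in> carrier_mat c d" "\<rho> \<in> carrier_mat d d"
  shows "sandwich (A * B) \<rho> = sandwich A (sandwich B \<rho>)"
proof -
  note B' = mat_adjoint_carrier[OF assms(2)] and A' = mat_adjoint_carrier[OF assms(1)]
  have "A * B * \<rho> * (mat_adjoint B * mat_adjoint A) = A * B * \<rho> * mat_adjoint B * mat_adjoint A"
    using assms A' B' by (subst assoc_mult_mat[of _ r d _ c _ r]) auto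
  also have "A * B * \<rho> * mat_adjoint B = A * (B * \<rho> * mat_adjoint B)"
    using assms B' by (simp add: assoc_mult_mat[of _ r c _ d _ d] assoc_mult_mat[of _ r c _ d _ c])
  finally show ?thesis by (simp add: sandwich_def mat_adjoint_mult[OF assms(1,2)])
qed

lemma sandwich_add:
  assumes "E \<in> carrier_mat r c" "\<rho> \<in> carrier_mat c c" "\<sigma> \<in> carrier_mat c c"
  shows "sandwich E (\<rho> + \<sigma>) = sandwich E \<rho> + sandwich E \<sigma>"
  using assms by (intro eq_matI) (auto simp: sandwich_index[OF assms(1)] algebra_simps sum.distrib)

lemma mat_sum_Nil [simp]: "mat_sum d [] = 0\<^sub>m d d"
  and mat_sum_Cons [simp]: "mat_sum d (A # As) = A + mat_sum d As"
  by (auto simp: mat_sum_def)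

lemma mat_sum_carrier [simp]: "(\<And>A. A \<in> set As \<Longrightarrow> A \<in> carrier_mat d d) \<Longrightarrow> mat_sum d As \<in> carrier_mat d d"
  by (induction As) auto

lemma mat_sum_index:
  assumes "\<And>A. A \<in> set As \<Longrightarrow> A \<in> carrier_mat d d" "i < d" "j < d"
  shows "mat_sum d As $$ (i, j) = (\<Sum>A\<leftarrow>As. A $$ (i, j))"
  using assms
proof (induction As)
  case (Cons A As)
  have "mat_sum d As \<in> carrier_mat d d" using Cons.prems by auto
  then have "dim_row (mat_sum d As) = d" "dim_col (mat_sum d As) = d" by (rule carrier_matD)+
  then show ?case using Cons by simp
qed auto

lemma apply_kraus_carrier [simp]:
  "(\<And>E. E \<in> set Es \<Longrightarrow> E \<in> carrier_mat d c) \<Longrightarrow> apply_kraus d Es \<rho> \<in> carrier_mat d d"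
  by (auto simp: apply_kraus_def intro!: mat_sum_carrier sandwich_carrier[of _ d c])

lemma apply_kraus_index:
  assumes "\<And>E. E \<in> set Es \<Longrightarrow> E \<in> carrier_mat d c" "i < d" "j < d"
  shows "apply_kraus d Es \<rho> $$ (i, j) = (\<Sum>E\<leftarrow>Es. sandwich E \<rho> $$ (i, j))"
  unfolding apply_kraus_def using assms by (subst mat_sum_index) (auto simp: comp_def intro!: sandwich_carrier[of _ d c])

lemma apply_kraus_add:
  assumes "\<And>E. E \<in> set Es \<Longrightarrow> E \<in> carrier_mat d c" "\<rho> \<in> carrier_mat c c" "\<sigma> \<in> carrier_mat c c"
  shows "apply_kraus d Es (\<rho> + \<sigma>) = apply_kraus d Es \<rho> + apply_kraus d Es \<sigma>"
proof (rule eq_matI)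
  note car = apply_kraus_carrier[of Es d c, OF assms(1)]
  fix i j assume "i < dim_row (apply_kraus d Es \<rho> + apply_kraus d Es \<sigma>)"
    "j < dim_col (apply_kraus d Es \<rho> + apply_kraus d Es \<sigma>)"
  then have ij: "i < d" "j < d" using car[of \<sigma>] by auto
  have "sandwich E (\<rho> + \<sigma>) $$ (i, j) = sandwich E \<rho> $$ (i, j) + sandwich E \<sigma> $$ (i, j)" if "E \<in> set Es" for E
    using sandwich_add[OF assms(1)[OF that] assms(2,3)] ij
      sandwich_carrier[OF assms(1)[OF that], of \<sigma>] by auto
  then have "(\<Sum>E\<leftarrow>Es. sandwich E (\<rho> + \<sigma>) $$ (i, j)) = (\<Sum>E\<leftarrow>Es. sandwich E \<rho> $$ (i, j) + sandwich E \<sigma> $$ (i, j))"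
    by (intro arg_cong[where f = sum_list] map_cong) auto
  then show "apply_kraus d Es (\<rho> + \<sigma>) $$ (i, j) = (apply_kraus d Es \<rho> + apply_kraus d Es \<sigma>) $$ (i, j)"
    using ij car[of \<rho>] car[of \<sigma>] by (simp add: apply_kraus_index[OF assms(1)] sum_list_addf)
next
  note car = apply_kraus_carrier[of Es d c, OF assms(1)]
  show "dim_row (apply_kraus d Es (\<rho> + \<sigma>)) = dim_row (apply_kraus d Es \<rho> + apply_kraus d Es \<sigma>)"
   "dim_col (apply_kraus d Es (\<rho> + \<sigma>)) = dim_col (apply_kraus d Es \<rho> + apply_kraus d Es \<sigma>)"
    using car[of "\<rho> + \<sigma>"] car[of \<sigma>] by auto
qed

section \<open>Kronecker products and local operations\<close>

lemma sum_lessThan_prod: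
  fixes f :: "nat \<Rightarrow> 'a::comm_monoid_add"
  shows "(\<Sum>k<m * n. f k) = (\<Sum>x<m. \<Sum>y<n. f (x * n + y))"
proof (induction m)
  case (Suc m)
  have "(\<Sum>k<Suc m * n. f k) = (\<Sum>k<m * n + n. f k)" by (simp add: add.commute)
  also have "\<dots> = (\<Sum>k<m * n. f k) + (\<Sum>y<n. f (m * n + y))"
    unfolding atLeast0LessThan[symmetric]
    by (subst sum.atLeastLessThan_concat[of 0 "m * n" "m * n + n", symmetric])
      (auto simp: sum.shift_bounds_nat_ivl[of f 0 "m * n" n, simplified] add.commute)
  finally show ?case using Suc by simp
qed simp

lemma dim_kron [simp]:
  "dim_row (kron A B) = dim_row A * dim_row B" "dim_col (kron A B) = dim_col A * dim_col B"
  by (auto simp: kron_def)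

lemma kron_carrier [simp]:
  "A \<in> carrier_mat r c \<Longrightarrow> B \<in> carrier_mat r' c' \<Longrightarrow> kron A B \<in> carrier_mat (r * r') (c * c')"
  by (auto simp: kron_def)

lemma kron_index [simp]:
  assumes "i < dim_row A * dim_row B" "j < dim_col A * dim_col B"
  shows "kron A B $$ (i, j) =
    A $$ (i div dim_row B, j div dim_col B) * B $$ (i mod dim_row B, j mod dim_col B)"
  using assms by (simp add: kron_def)

lemma div_mod_less:
  fixes i :: nat
  assumes "i < m * n"
  shows "i div n < m" "i mod n < n"
  using assms by (auto simp: less_mult_imp_div_less intro!: mod_less_divisor gr0I)

lemma kron_mult:
  assumes "A \<in> carrier_mat r c" "B \<in> carrier_mat r' c'" "C \<in> carrier_mat c d" "D \<in> carrier_mat c' d'"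
  shows "kron A B * kron C D = kron (A * C) (B * D)"
proof (rule eq_matI)
  fix i j assume "i < dim_row (kron (A * C) (B * D))" "j < dim_col (kron (A * C) (B * D))"
  then have ij: "i < r * r'" "j < d * d'" using assms by auto
  note less = div_mod_less[OF ij(1)] div_mod_less[OF ij(2)]
  have "(kron A B * kron C D) $$ (i, j) = (\<Sum>k<c * c'. A $$ (i div r', k div c') * B $$ (i mod r', k mod c') *
      (C $$ (k div c', j div d') * D $$ (k mod c', j mod d')))"
    using assms ij by (subst mult_mat_index) (auto intro!: sum.cong)
  also have "\<dots> = (\<Sum>x<c. \<Sum>y<c'. A $$ (i div r', x) * B $$ (i mod r', y) *
      (C $$ (x, j div d') * D $$ (y, j mod d')))"
    by (simp add: sum_lessThan_prod)
  also have "\<dots> = (\<Sum>x<c. A $$ (i div r', x) * C $$ (x, j div d')) *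
      (\<Sum>y<c'. B $$ (i mod r', y) * D $$ (y, j mod d'))"
    by (simp add: sum_product mult_ac)
  also have "\<dots> = kron (A * C) (B * D) $$ (i, j)"
    using assms ij less by (simp add: mult_mat_index del: index_mult_mat(1))
  finally show "(kron A B * kron C D) $$ (i, j) = kron (A * C) (B * D) $$ (i, j)" .
qed (use assms in auto)

lemma mat_adjoint_kron: "mat_adjoint (kron A B) = kron (mat_adjoint A) (mat_adjoint B)"
  by (rule eq_matI) (auto simp: div_mod_less)

lemma kron_effect:
  "mat_adjoint (kron A B) * kron A B = kron (mat_adjoint A * A) (mat_adjoint B * B)"
  unfolding mat_adjoint_kron
  by (rule kron_mult[of _ "dim_col A" "dim_row A" _ "dim_col B" "dim_row B"]) (auto intro!: carrier_matI)

text \<open>A product operator is a move of Alice followed by a move of Bob. This splits a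
  \<open>Send\<close> of Alice, the encoding and the joint readout, which are single Kraus operators
  in the circuit model, into steps of a tree.\<close>

lemma sandwich_kron_Alice_Bob:
  assumes "A \<in> carrier_mat r c" "B \<in> carrier_mat r' c'" "\<rho> \<in> carrier_mat (c * c') (c * c')"
  shows "sandwich (kron (1\<^sub>m r) B) (sandwich (kron A (1\<^sub>m c')) \<rho>) = sandwich (kron A B) \<rho>"
proof -
  have "kron A B = kron (1\<^sub>m r) B * kron A (1\<^sub>m c')"
    using assms by (subst kron_mult[of _ r r _ r' c']) auto
  then show ?thesis
    using assms by (simp add: sandwich_mult[of _ "r * r'" "r * c'" _ "c * c'"])
qed

lemma sandwich_kron_Bob_Alice:
  assumes "A \<in> carrier_mat r c" "B \<in> carrier_mat r' c'" "\<rho> \<in> carrier_mat (c * c') (c * c')"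
  shows "sandwich (kron A (1\<^sub>m r')) (sandwich (kron (1\<^sub>m c) B) \<rho>) = sandwich (kron A B) \<rho>"
proof -
  have "kron A B = kron A (1\<^sub>m r') * kron (1\<^sub>m c) B"
    using assms by (subst kron_mult[of _ r c _ r' r']) auto
  then show ?thesis
    using assms by (simp add: sandwich_mult[of _ "r * r'" "c * r'" _ "c * c'"])
qed

subsection \<open>Bits\<close>

lemma bit_less_exp:
  fixes x :: nat
  assumes "x < 2 ^ n" "bit x w"
  shows "w < n"
  by (metis assms bit_take_bit_iff take_bit_nat_eq_self)

lemma bits_eqI:
  fixes x y :: nat
  assumes "x < 2 ^ n" "y < 2 ^ n" "\<And>w. w < n \<Longrightarrow> bit x w = bit y w"
  shows "x = y"
proof (rule bit_eqI)
  fix w show "bit x w = bit y w"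
    using assms bit_less_exp[of x n w] bit_less_exp[of y n w] by (cases "w < n") auto
qed

lemma bit_set_encode: "finite A \<Longrightarrow> bit (set_encode A) w \<longleftrightarrow> w \<in> A"
  using set_encode_inverse[of A] by (auto simp: set_decode_def bit_iff_odd)

lemma set_encode_less: "A \<subseteq> {..<n} \<Longrightarrow> set_encode A < 2 ^ n"
proof -
  assume A: "A \<subseteq> {..<n}"
  then have "finite A" using finite_subset by blast
  then have "take_bit n (set_encode A) = set_encode A"
    using A by (intro bit_eqI) (auto simp: bit_take_bit_iff bit_set_encode)
  then show ?thesis by (metis take_bit_nat_less_exp)
qed

lemma bit_wires_val: "bit (wires_val ws x) q \<longleftrightarrow> q < length ws \<and> bit x (ws ! q)"
  by (auto simp: wires_val_def bit_horner_sum_bit_iff)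

lemma wires_val_less: "wires_val ws x < 2 ^ length ws"
proof -
  have "take_bit (length ws) (wires_val ws x) = wires_val ws x"
    by (rule bit_eqI) (auto simp: bit_take_bit_iff bit_wires_val)
  then show ?thesis by (metis take_bit_nat_less_exp)
qed

lemma wires_val_eq_iff: "wires_val ws x = wires_val ws y \<longleftrightarrow> (\<forall>w\<in>set ws. bit x w = bit y w)"
proof
  assume eq: "wires_val ws x = wires_val ws y"
  show "\<forall>w\<in>set ws. bit x w = bit y w"
  proof
    fix w assume "w \<in> set ws"
    then obtain q where "q < length ws" "w = ws ! q" by (metis in_set_conv_nth)
    then show "bit x w = bit y w" using bit_wires_val[of ws x q] bit_wires_val[of ws y q] eq by simp
  qed
next
  assume "\<forall>w\<in>set ws. bit x w = bit y w"
  then show "wires_val ws x = wires_val ws y" by (intro bit_eqI) (auto simp: bit_wires_val)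
qed

lemma bit_div_exp: "bit ((z::nat) div 2 ^ b) w = bit z (b + w)"
  by (metis add.commute bit_drop_bit_eq comp_apply drop_bit_eq_div)

lemma bit_mod_exp: "bit ((z::nat) mod 2 ^ b) w = (w < b \<and> bit z w)"
  by (metis bit_take_bit_iff take_bit_eq_mod)

text \<open>Identities, wire projections and the effects of readouts all have this form, and
  \<open>kron_pmat\<close> and \<open>pmat_effect\<close> preserve it. Probabilities thereby become
  sums of diagonal entries.\<close>

definition pmat :: "nat \<Rightarrow> (nat \<Rightarrow> bool) \<Rightarrow> complex mat" where
  "pmat n P = mat (2 ^ n) (2 ^ n) (\<lambda>(x, y). of_bool (x = y \<and> P x))"

lemma pmat_carrier [simp]: "pmat n P \<in> carrier_mat (2 ^ n) (2 ^ n)"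
  by (simp add: pmat_def)

lemma dim_pmat [simp]: "dim_row (pmat n P) = 2 ^ n" "dim_col (pmat n P) = 2 ^ n"
  by (simp_all add: pmat_def)

lemma pmat_index [simp]: "x < 2 ^ n \<Longrightarrow> y < 2 ^ n \<Longrightarrow> pmat n P $$ (x, y) = of_bool (x = y \<and> P x)"
  by (simp add: pmat_def)

lemma pmat_True: "pmat n (\<lambda>_. True) = 1\<^sub>m (2 ^ n)"
  by (rule eq_matI) auto

lemma wire_proj_eq_pmat: "wire_proj n w v = pmat n (\<lambda>x. bit x w = v)"
  by (simp add: wire_proj_def pmat_def)

lemma pmat_effect: "mat_adjoint (pmat n P) * pmat n P = pmat n P"
proof (rule eq_matI)
  fix i j assume "i < dim_row (pmat n P)" "j < dim_col (pmat n P)"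
  then have ij: "i < 2 ^ n" "j < 2 ^ n" by auto
  then have "(mat_adjoint (pmat n P) * pmat n P) $$ (i, j)
      = (\<Sum>k<2 ^ n. if k = i then of_bool (i = j \<and> P i) else 0)"
    by (subst mult_mat_index) (simp, simp, simp, rule sum.cong, auto)
  also have "\<dots> = pmat n P $$ (i, j)" using ij by (subst sum.delta) auto
  finally show "(mat_adjoint (pmat n P) * pmat n P) $$ (i, j) = pmat n P $$ (i, j)" .
qed auto

lemma kron_pmat: "kron (pmat a P) (pmat b Q) = pmat (a + b) (\<lambda>z. P (z div 2 ^ b) \<and> Q (z mod 2 ^ b))"
proof (rule eq_matI)
  fix i j assume "i < dim_row (pmat (a + b) (\<lambda>z. P (z div 2 ^ b) \<and> Q (z mod 2 ^ b)))"
    "j < dim_col (pmat (a + b) (\<lambda>z. P (z div 2 ^ b) \<and> Q (z mod 2 ^ b)))"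
  then have ij: "i < 2 ^ a * 2 ^ b" "j < 2 ^ a * 2 ^ b" by (auto simp: power_add)
  note less = div_mod_less[OF ij(1)] div_mod_less[OF ij(2)]
  have "i = j \<longleftrightarrow> i div 2 ^ b = j div 2 ^ b \<and> i mod 2 ^ b = j mod 2 ^ b"
    by (metis div_mult_mod_eq)
  then show "kron (pmat a P) (pmat b Q) $$ (i, j) = pmat (a + b) (\<lambda>z. P (z div 2 ^ b) \<and> Q (z mod 2 ^ b)) $$ (i, j)"
    using ij less by (auto simp: power_add)
qed (auto simp: power_add)

text \<open>Cyclicity of the trace: the probability of an outcome depends on its Kraus operator only
  through the effect.\<close>

lemma trace_sandwich:
  assumes "E \<in> carrier_mat r c" "\<rho> \<in> carrier_mat c c"
  shows "mat_trace (sandwich E \<rho>) = (\<Sum>k<c. \<Sum>l<c. (mat_adjoint E * E) $$ (l, k) * \<rho> $$ (k, l))"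
proof -
  have "mat_trace (sandwich E \<rho>) = (\<Sum>i<r. \<Sum>k<c. \<Sum>l<c. E $$ (i, k) * \<rho> $$ (k, l) * cnj (E $$ (i, l)))"
    unfolding mat_trace_def using assms by (auto simp: sandwich_index)
  also have "\<dots> = (\<Sum>k<c. \<Sum>i<r. \<Sum>l<c. E $$ (i, k) * \<rho> $$ (k, l) * cnj (E $$ (i, l)))"
    by (rule sum.swap)
  also have "\<dots> = (\<Sum>k<c. \<Sum>l<c. \<Sum>i<r. E $$ (i, k) * \<rho> $$ (k, l) * cnj (E $$ (i, l)))"
    by (intro sum.cong refl sum.swap)
  also have "\<dots> = (\<Sum>k<c. \<Sum>l<c. (mat_adjoint E * E) $$ (l, k) * \<rho> $$ (k, l))"
    using assms by (intro sum.cong refl)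
      (auto simp: mult_mat_index sum_distrib_left mult_ac simp del: index_mult_mat(1))
  finally show ?thesis .
qed

lemma trace_sandwich_pmat:
  assumes "E \<in> carrier_mat r (2 ^ n)" "\<rho> \<in> carrier_mat (2 ^ n) (2 ^ n)" "mat_adjoint E * E = pmat n P"
  shows "mat_trace (sandwich E \<rho>) = (\<Sum>z<2 ^ n. of_bool (P z) * \<rho> $$ (z, z))"
proof -
  have "mat_trace (sandwich E \<rho>) = (\<Sum>k<2 ^ n. \<Sum>l<2 ^ n. if k = l then of_bool (P k) * \<rho> $$ (k, k) else 0)"
    unfolding trace_sandwich[OF assms(1,2)] assms(3) by (intro sum.cong refl) auto
  also have "\<dots> = (\<Sum>z<2 ^ n. of_bool (P z) * \<rho> $$ (z, z))" by (intro sum.cong refl, subst sum.delta') auto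
  finally show ?thesis .
qed

lemma effect_index:
  assumes "E \<in> carrier_mat r c" "i < c" "j < c"
  shows "(mat_adjoint E * E) $$ (i, j) = (\<Sum>k<r. cnj (E $$ (k, i)) * E $$ (k, j))"
  using assms by (subst mult_mat_index) auto

section \<open>Completeness of the Kraus operators of a circuit\<close>

lemma lift_gate_carrier [simp]: "lift_gate n ws U \<in> carrier_mat (2 ^ n) (2 ^ n)"
  by (simp add: lift_gate_def)

lemma dim_lift_gate [simp]: "dim_row (lift_gate n ws U) = 2 ^ n" "dim_col (lift_gate n ws U) = 2 ^ n"
  by (simp_all add: lift_gate_def)

lemma dim_wire_proj [simp]: "dim_row (wire_proj n w v) = 2 ^ n" "dim_col (wire_proj n w v) = 2 ^ n"
  by (simp_all add: wire_proj_def)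

lemma wire_proj_carrier [simp]: "wire_proj n w v \<in> carrier_mat (2 ^ n) (2 ^ n)"
  by (simp add: wire_proj_def)

lemma dim_readout [simp]: "dim_row (readout n ws M e) = M" "dim_col (readout n ws M e) = 2 ^ n"
  by (simp_all add: readout_def)

lemma readout_carrier [simp]: "readout n ws M e \<in> carrier_mat M (2 ^ n)"
  by (simp add: readout_def)

lemma dim_encode [simp]: "dim_row (encode n N K) = 2 ^ n" "dim_col (encode n N K) = N * K"
  by (simp_all add: encode_def)

lemma encode_carrier [simp]: "encode n N K \<in> carrier_mat (2 ^ n) (N * K)"
  by (simp add: encode_def)

text \<open>The basis states that share the values of all wires outside \<open>ws\<close> form a
  copy of the computational basis of the wires \<open>ws\<close>.\<close>

lemma wires_val_bij:
  fixes i :: nat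
  assumes "distinct ws" "set ws \<subseteq> {..<n}"
  shows "bij_betw (wires_val ws) {x. x < 2 ^ n \<and> (\<forall>w<n. w \<notin> set ws \<longrightarrow> bit x w = bit i w)} {..<2 ^ length ws}"
    (is "bij_betw _ ?F _")
proof (rule bij_betw_imageI)
  show "inj_on (wires_val ws) ?F"
  proof (rule inj_onI)
    fix x y assume "x \<in> ?F" "y \<in> ?F" "wires_val ws x = wires_val ws y"
    then show "x = y" by (intro bits_eqI[of x n y]) (auto simp: wires_val_eq_iff)
  qed
  have "v \<in> wires_val ws ` ?F" if v: "v < 2 ^ length ws" for v
  proof -
    define A where "A = {w. w < n \<and> w \<notin> set ws \<and> bit i w} \<union> {ws ! q | q. q < length ws \<and> bit v q}"
    have A: "A \<subseteq> {..<n}" using assms(2) by (auto simp: A_def dest!: nth_mem)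
    then have fin: "finite A" using finite_subset by blast
    have "wires_val ws (set_encode A) = v"
    proof (rule bits_eqI[OF wires_val_less v])
      fix q assume "q < length ws"
      then show "bit (wires_val ws (set_encode A)) q = bit v q"
        using assms(1) unfolding bit_wires_val bit_set_encode[OF fin]
        by (auto simp: A_def nth_eq_iff_index_eq)
    qed
    moreover have "\<forall>w<n. w \<notin> set ws \<longrightarrow> bit (set_encode A) w = bit i w"
      unfolding bit_set_encode[OF fin] by (auto simp: A_def)
    ultimately show ?thesis using set_encode_less[OF A] by force
  qed
  then show "wires_val ws ` ?F = {..<2 ^ length ws}" by (auto simp: wires_val_less)
qed

text \<open>\<open>lift_gate\<close> is block diagonal with one copy of \<open>U\<close> for every
  assignment of the other wires. Columns of different blocks have disjoint support, and inside a
  block \<open>wires_val_bij\<close> turns the inner product into an entry of the effect of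
  \<open>U\<close>.\<close>

lemma lift_gate_isometry:
  assumes "distinct ws" "set ws \<subseteq> {..<n}" "U \<in> carrier_mat (2 ^ length ws) (2 ^ length ws)"
    "mat_adjoint U * U = 1\<^sub>m (2 ^ length ws)"
  shows "mat_adjoint (lift_gate n ws U) * lift_gate n ws U = 1\<^sub>m (2 ^ n)"
proof (rule eq_matI)
  fix i j assume "i < dim_row (1\<^sub>m (2 ^ n) :: complex mat)" "j < dim_col (1\<^sub>m (2 ^ n) :: complex mat)"
  then have ij: "i < 2 ^ n" "j < 2 ^ n" by auto
  define ag where "ag = (\<lambda>x y. \<forall>w<n. w \<notin> set ws \<longrightarrow> bit (x :: nat) w = bit (y :: nat) w)"
  let ?v = "wires_val ws"
  have L: "lift_gate n ws U $$ (x, y) = (if ag x y then U $$ (?v x, ?v y) else 0)"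
    if "x < 2 ^ n" "y < 2 ^ n" for x y
    using that by (simp add: lift_gate_def ag_def)
  have "(mat_adjoint (lift_gate n ws U) * lift_gate n ws U) $$ (i, j) =
    (\<Sum>x<2 ^ n. if ag x i \<and> ag x j then cnj (U $$ (?v x, ?v i)) * U $$ (?v x, ?v j) else 0)"
    unfolding effect_index[OF lift_gate_carrier ij] using ij L by (intro sum.cong refl) simp
  also have "\<dots> = of_bool (i = j)"
  proof (cases "ag i j")
    case False
    then show ?thesis by (intro trans[OF sum.neutral]) (auto simp: ag_def)
  next
    case True
    then have "(\<Sum>x<2 ^ n. if ag x i \<and> ag x j then cnj (U $$ (?v x, ?v i)) * U $$ (?v x, ?v j) else 0) =
      (\<Sum>x \<in> {x. x < 2 ^ n \<and> ag x i}. cnj (U $$ (?v x, ?v i)) * U $$ (?v x, ?v j))"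
      by (intro sum.mono_neutral_cong_right) (auto simp: ag_def)
    also have "\<dots> = (\<Sum>u<2 ^ length ws. cnj (U $$ (u, ?v i)) * U $$ (u, ?v j))"
      unfolding ag_def by (rule sum.reindex_bij_betw[OF wires_val_bij[OF assms(1,2)]])
    also have "\<dots> = (mat_adjoint U * U) $$ (?v i, ?v j)"
      using assms(3) by (subst mult_mat_index) (auto simp: wires_val_less)
    also have "\<dots> = of_bool (?v i = ?v j)" unfolding assms(4) by (simp add: wires_val_less)
    also have "?v i = ?v j \<longleftrightarrow> i = j"
      using True bits_eqI[OF ij] by (auto simp: wires_val_eq_iff ag_def)
    finally show ?thesis .
  qed
  finally show "(mat_adjoint (lift_gate n ws U) * lift_gate n ws U) $$ (i, j) = 1\<^sub>m (2 ^ n) $$ (i, j)"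
    using ij by auto
qed auto

lemma pauli_X_unitary: "pauli_X \<in> carrier_mat 2 2" "mat_adjoint pauli_X * pauli_X = 1\<^sub>m 2"
proof -
  show "pauli_X \<in> carrier_mat 2 2" by (simp add: pauli_X_def)
  show "mat_adjoint pauli_X * pauli_X = 1\<^sub>m 2"
    by (rule eq_matI) (auto simp: mult_mat_index pauli_X_def less_2_cases_iff lessThan_Suc numeral_2_eq_2
        simp del: index_mult_mat(1))
qed

lemma complete_kraus_single:
  "E \<in> carrier_mat r d \<Longrightarrow> mat_adjoint E * E = 1\<^sub>m d \<Longrightarrow> complete_kraus d [E]"
  by (auto simp: complete_kraus_def)

lemma complete_kraus_wire_proj: "complete_kraus (2 ^ n) (map (wire_proj n w) [False, True])"
proof -
  have "pmat n (\<lambda>x. \<not> bit x w) + (pmat n (\<lambda>x. bit x w) + 0\<^sub>m (2 ^ n) (2 ^ n)) = 1\<^sub>m (2 ^ n)"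
    by (rule eq_matI) auto
  then show ?thesis by (auto simp: complete_kraus_def wire_proj_eq_pmat pmat_effect)
qed

text \<open>The encoding sends basis vectors to basis vectors injectively: the data part stays below
  \<open>2 ^ ceillog2 N\<close>, so it can be recovered by division with remainder.\<close>

lemma complete_kraus_encode:
  assumes "0 < N" "0 < K" "ceillog2 N + ceillog2 K \<le> n"
  shows "complete_kraus (N * K) [encode n N K]"
proof (rule complete_kraus_single[of _ "2 ^ n"])
  define en where "en = (\<lambda>y. y div K + 2 ^ ceillog2 N * (y mod K))"
  have le: "N \<le> 2 ^ ceillog2 N" "K \<le> 2 ^ ceillog2 K"
    using assms by (auto simp: ceillog2_le_iff[symmetric])
  have d: "y div K < 2 ^ ceillog2 N" "y mod K < 2 ^ ceillog2 K" if "y < N * K" for y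
    using div_mod_less[OF that] le by auto
  have less: "en y < 2 ^ n" if "y < N * K" for y
  proof -
    have "en y < 2 ^ ceillog2 N + 2 ^ ceillog2 N * (y mod K)" using d[OF that] by (simp add: en_def)
    also have "\<dots> = 2 ^ ceillog2 N * (y mod K + 1)" by simp
    also have "\<dots> \<le> 2 ^ ceillog2 N * 2 ^ ceillog2 K" using d[OF that] by (intro mult_le_mono) auto
    also have "\<dots> \<le> 2 ^ n" using assms(3) by (simp flip: power_add)
    finally show ?thesis .
  qed
  have inj: "y = y'" if "en y = en y'" "y < N * K" "y' < N * K" for y y'
  proof -
    have "en y mod 2 ^ ceillog2 N = y div K" "en y' mod 2 ^ ceillog2 N = y' div K"
      "en y div 2 ^ ceillog2 N = y mod K" "en y' div 2 ^ ceillog2 N = y' mod K"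
      using d[OF that(2)] d[OF that(3)] by (auto simp: en_def)
    then show ?thesis using that(1) by (metis div_mult_mod_eq)
  qed
  show "mat_adjoint (encode n N K) * encode n N K = 1\<^sub>m (N * K)"
  proof (rule eq_matI)
    fix i j assume "i < dim_row (1\<^sub>m (N * K) :: complex mat)" "j < dim_col (1\<^sub>m (N * K) :: complex mat)"
    then have ij: "i < N * K" "j < N * K" by auto
    have "(mat_adjoint (encode n N K) * encode n N K) $$ (i, j) =
      (\<Sum>x<2 ^ n. if x = en i then of_bool (en i = en j) else 0)"
      unfolding effect_index[OF encode_carrier ij] using ij
      by (intro sum.cong refl) (auto simp: encode_def en_def)
    also have "\<dots> = of_bool (i = j)"
      using less[OF ij(1)] inj[OF _ ij] by (subst sum.delta) auto
    finally show "(mat_adjoint (encode n N K) * encode n N K) $$ (i, j) = 1\<^sub>m (N * K) $$ (i, j)"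
      using ij by auto
  qed auto
qed auto

text \<open>The representative in \<open>env_states\<close> of the environment of
  \<open>x\<close>.\<close>

definition clear_wires :: "nat list \<Rightarrow> nat \<Rightarrow> nat" where
  "clear_wires ws x = set_encode ({w. bit x w} - set ws)"

lemma finite_bits: "finite {w. bit (x :: nat) w}"
  using finite_set_decode[of x] by (simp add: set_decode_def bit_iff_odd)

lemma bit_clear_wires: "bit (clear_wires ws x) w \<longleftrightarrow> bit x w \<and> w \<notin> set ws"
  unfolding clear_wires_def using finite_bits[of x] by (subst bit_set_encode) auto

lemma clear_wires_less: "x < 2 ^ n \<Longrightarrow> clear_wires ws x < 2 ^ n"
  unfolding clear_wires_def by (rule set_encode_less) (auto dest: bit_less_exp)

text \<open>Exactly one environment representative agrees with \<open>x\<close> off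
  \<open>ws\<close>, so the sum collapses to one term. All sums over readout operators are reduced
  to this.\<close>

lemma sum_env_states:
  fixes g :: "nat \<Rightarrow> complex"
  assumes "x < 2 ^ n"
  shows "(\<Sum>e\<leftarrow>env_states n ws. of_bool (\<forall>w<n. w \<notin> set ws \<longrightarrow> bit x w = bit e w) * g e) = g (clear_wires ws x)"
proof -
  have d: "distinct (env_states n ws)" by (simp add: env_states_def)
  have s: "set (env_states n ws) = {e. e < 2 ^ n \<and> (\<forall>w\<in>set ws. \<not> bit e w)}"
    by (auto simp: env_states_def)
  have u: "(\<forall>w<n. w \<notin> set ws \<longrightarrow> bit x w = bit e w) \<longleftrightarrow> e = clear_wires ws x" if "e \<in> set (env_states n ws)" for e
  proof
    assume "\<forall>w<n. w \<notin> set ws \<longrightarrow> bit x w = bit e w"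
    then show "e = clear_wires ws x"
      using that clear_wires_less[OF assms] by (intro bits_eqI[of e n]) (auto simp: s bit_clear_wires)
  qed (auto simp: bit_clear_wires)
  have "(\<Sum>e\<leftarrow>env_states n ws. of_bool (\<forall>w<n. w \<notin> set ws \<longrightarrow> bit x w = bit e w) * g e) =
    (\<Sum>e\<in>set (env_states n ws). if e = clear_wires ws x then g e else 0)"
    unfolding sum_list_distinct_conv_sum_set[OF d] using u by (intro sum.cong) auto
  also have "\<dots> = g (clear_wires ws x)"
    using clear_wires_less[OF assms] by (subst sum.delta) (auto simp: s bit_clear_wires)
  finally show ?thesis .
qed

text \<open>The effect is diagonal because two basis states with the same output value and the same
  environment coincide.\<close>

lemma readout_effect:
  "mat_adjoint (readout n ws M e) * readout n ws M e =
    pmat n (\<lambda>x. wires_val ws x < M \<and> (\<forall>w<n. w \<notin> set ws \<longrightarrow> bit x w = bit e w))"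
proof -
  define P where "P = (\<lambda>x :: nat. \<forall>w<n. w \<notin> set ws \<longrightarrow> bit x w = bit e w)"
  have "mat_adjoint (readout n ws M e) * readout n ws M e = pmat n (\<lambda>x. wires_val ws x < M \<and> P x)"
  proof (rule eq_matI)
    fix i j assume "i < dim_row (pmat n (\<lambda>x. wires_val ws x < M \<and> P x))"
      "j < dim_col (pmat n (\<lambda>x. wires_val ws x < M \<and> P x))"
    then have ij: "i < 2 ^ n" "j < 2 ^ n" by auto
    have eq: "i = j" if "wires_val ws i = wires_val ws j" "P i" "P j"
      using that by (intro bits_eqI[OF ij]) (auto simp: wires_val_eq_iff P_def)
    have R: "readout n ws M e $$ (k, x) = of_bool (wires_val ws x = k \<and> P x)"
      if "k < M" "x < 2 ^ n" for k x
      using that by (simp add: readout_def P_def)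
    have "(mat_adjoint (readout n ws M e) * readout n ws M e) $$ (i, j) =
        (\<Sum>k<M. if k = wires_val ws i then of_bool (wires_val ws j = wires_val ws i \<and> P i \<and> P j) else 0)"
      unfolding effect_index[OF readout_carrier ij] using ij R by (intro sum.cong refl) auto
    also have "\<dots> = of_bool (i = j \<and> wires_val ws i < M \<and> P i)"
      using eq by (subst sum.delta) auto
    finally show "(mat_adjoint (readout n ws M e) * readout n ws M e) $$ (i, j) =
        pmat n (\<lambda>x. wires_val ws x < M \<and> P x) $$ (i, j)"
      using ij by simp
  qed auto
  then show ?thesis by (simp add: P_def)
qed

text \<open>The readouts miss exactly the states whose output value is at least \<open>M\<close>;
  the additional projection accounts for them.\<close>

lemma complete_kraus_readout:
  "complete_kraus (2 ^ n) (map (readout n ws M) (env_states n ws) @ [pmat n (\<lambda>x. M \<le> wires_val ws x)])"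
proof -
  let ?Es = "map (readout n ws M) (env_states n ws) @ [pmat n (\<lambda>x. M \<le> wires_val ws x)]"
  let ?eff = "map (\<lambda>E. mat_adjoint E * E) ?Es"
  have car: "A \<in> carrier_mat (2 ^ n) (2 ^ n)" if "A \<in> set ?eff" for A
    using that by (auto simp: readout_effect pmat_effect)
  have "mat_sum (2 ^ n) ?eff = 1\<^sub>m (2 ^ n)"
  proof (rule eq_matI)
    fix i j assume "i < dim_row (1\<^sub>m (2 ^ n) :: complex mat)" "j < dim_col (1\<^sub>m (2 ^ n) :: complex mat)"
    then have ij: "i < 2 ^ n" "j < 2 ^ n" by auto
    have "mat_sum (2 ^ n) ?eff $$ (i, j) = (\<Sum>A\<leftarrow>?eff. A $$ (i, j))"
      by (rule mat_sum_index[OF car ij])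
    also have "\<dots> = (\<Sum>e\<leftarrow>env_states n ws. of_bool (\<forall>w<n. w \<notin> set ws \<longrightarrow> bit i w = bit e w) *
        of_bool (i = j \<and> wires_val ws i < M)) + of_bool (i = j \<and> M \<le> wires_val ws i)"
      using ij by (simp add: readout_effect pmat_effect comp_def mult.commute of_bool_conj[symmetric] conj_commute conj_left_commute
          del: index_mult_mat(1) of_bool_conj)
    also have "\<dots> = 1\<^sub>m (2 ^ n) $$ (i, j)"
      unfolding sum_env_states[OF ij(1)] using ij by auto
    finally show "mat_sum (2 ^ n) ?eff $$ (i, j) = 1\<^sub>m (2 ^ n) $$ (i, j)" .
  next
    have "mat_sum (2 ^ n) ?eff \<in> carrier_mat (2 ^ n) (2 ^ n)" using car by (rule mat_sum_carrier)
    then show "dim_row (mat_sum (2 ^ n) ?eff) = dim_row (1\<^sub>m (2 ^ n) :: complex mat)"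
      "dim_col (mat_sum (2 ^ n) ?eff) = dim_col (1\<^sub>m (2 ^ n) :: complex mat)" by auto
  qed
  then show ?thesis by (auto simp: complete_kraus_def)
qed

lemma instruction_kraus_carrier:
  "E \<in> set (instruction_kraus a b s) \<Longrightarrow> E \<in> carrier_mat (2 ^ a * 2 ^ b) (2 ^ a * 2 ^ b)"
  by (cases "(a, b, s)" rule: instruction_kraus.cases)
    (auto simp: local_op_def intro!: kron_carrier split: party.splits)

lemma fold_kraus_carrier:
  "\<omega> \<in> carrier_mat (2 ^ a * 2 ^ b) (2 ^ a * 2 ^ b) \<Longrightarrow>
    fold (\<lambda>s. apply_kraus (2 ^ a * 2 ^ b) (instruction_kraus a b s)) is \<omega> \<in> carrier_mat (2 ^ a * 2 ^ b) (2 ^ a * 2 ^ b)"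
proof (induction "is" arbitrary: \<omega>)
  case (Cons s "is")
  then show ?case using Cons.IH[OF apply_kraus_carrier[OF instruction_kraus_carrier]] by simp
qed simp

text \<open>Linearity allows the branches of a measurement to be recombined after the remaining
  instructions.\<close>

lemma fold_kraus_add:
  assumes "\<omega>\<^sub>1 \<in> carrier_mat (2 ^ a * 2 ^ b) (2 ^ a * 2 ^ b)" "\<omega>\<^sub>2 \<in> carrier_mat (2 ^ a * 2 ^ b) (2 ^ a * 2 ^ b)"
  shows "fold (\<lambda>s. apply_kraus (2 ^ a * 2 ^ b) (instruction_kraus a b s)) is (\<omega>\<^sub>1 + \<omega>\<^sub>2) =
    fold (\<lambda>s. apply_kraus (2 ^ a * 2 ^ b) (instruction_kraus a b s)) is \<omega>\<^sub>1 +
    fold (\<lambda>s. apply_kraus (2 ^ a * 2 ^ b) (instruction_kraus a b s)) is \<omega>\<^sub>2"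
  using assms
proof (induction "is" arbitrary: \<omega>\<^sub>1 \<omega>\<^sub>2)
  case (Cons s "is")
  note car = apply_kraus_carrier[OF instruction_kraus_carrier]
  show ?case
    using Cons.prems
    by (simp add: apply_kraus_add[OF instruction_kraus_carrier] Cons.IH[OF car car])
qed simp

subsection \<open>Compiling circuits to protocol trees\<close>

text \<open>Every measurement duplicates the rest of the program, so the tree is exponentially
  large; efficiency is charged to the circuit only. An outcome influences the continuation only in a
  \<open>Send\<close>, where outcome 1 makes the receiver flip a bit.\<close>

fun compile :: "nat \<Rightarrow> nat \<Rightarrow> instruction list \<Rightarrow> locc \<Rightarrow> locc" where
  "compile a b [] P = P"
| "compile a b (Gate p ws U # is) P =
     Local p [lift_gate (case p of Alice \<Rightarrow> a | Bob \<Rightarrow> b) ws U] (\<lambda>_. compile a b is P)"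
| "compile a b (Measure p w # is) P =
     Local p (map (wire_proj (case p of Alice \<Rightarrow> a | Bob \<Rightarrow> b) w) [False, True]) (\<lambda>_. compile a b is P)"
| "compile a b (Send Alice w w' # is) P =
     Local Alice (map (wire_proj a w) [False, True])
       (\<lambda>k. if k = 0 then compile a b is P else Local Bob [lift_gate b [w'] pauli_X] (\<lambda>_. compile a b is P))"
| "compile a b (Send Bob w w' # is) P =
     Local Bob (map (wire_proj b w) [False, True])
       (\<lambda>k. if k = 0 then compile a b is P else Local Alice [lift_gate a [w'] pauli_X] (\<lambda>_. compile a b is P))"

lemma complete_kraus_lift_gate:
  assumes "distinct ws" "set ws \<subseteq> {..<n}" "U \<in> carrier_mat (2 ^ length ws) (2 ^ length ws)"
    "mat_adjoint U * U = 1\<^sub>m (2 ^ length ws)"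
  shows "complete_kraus (2 ^ n) [lift_gate n ws U]"
  by (rule complete_kraus_single[OF lift_gate_carrier lift_gate_isometry[OF assms]])

lemma complete_kraus_lift_X: "w < n \<Longrightarrow> complete_kraus (2 ^ n) [lift_gate n [w] pauli_X]"
  by (rule complete_kraus_lift_gate) (use pauli_X_unitary in auto)

lemma locc_protocol_compile:
  assumes "\<forall>s \<in> set is. valid_instruction a b s" "locc_protocol P (2 ^ a) (2 ^ b) M"
  shows "locc_protocol (compile a b is P) (2 ^ a) (2 ^ b) M"
  using assms
proof (induction a b "is" P rule: compile.induct)
  case (2 a b p ws U "is" P)
  then show ?case by (cases p) (auto intro: complete_kraus_lift_gate)
next
  case (3 a b p w "is" P)
  then show ?case
    using complete_kraus_wire_proj[of a w] complete_kraus_wire_proj[of b w] by (cases p) (auto simp: less_2_cases_iff nth_Cons')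
next
  case (4 a b w w' "is" P)
  then show ?case
    using complete_kraus_wire_proj[of a w] by (auto simp: nth_Cons' complete_kraus_lift_X)
next
  case (5 a b w w' "is" P)
  then show ?case
    using complete_kraus_wire_proj[of b w] by (auto simp: nth_Cons' complete_kraus_lift_X)
qed auto

text \<open>The list of branches of the tree is unrelated in shape to the single mixed state of the
  circuit. They become comparable under any scalar functional \<Phi> that is additive on lists and,
  on the branches of the tail, linear in the state: the sum over the branches of a measurement then
  equals the value at their mixture. It is applied to the failure trace and to each matrix entry of
  the output.\<close>

lemma branches_compile:
  fixes \<Phi> :: "(nat option \<times> complex mat) list \<Rightarrow> complex"
  defines "D a b \<equiv> carrier_mat (2 ^ a * 2 ^ b) (2 ^ a * 2 ^ b)"
  assumes Nil: "\<Phi> [] = 0" and append: "\<And>xs ys. \<Phi> (xs @ ys) = \<Phi> xs + \<Phi> ys"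
    and add: "\<And>\<omega>\<^sub>1 \<omega>\<^sub>2. \<omega>\<^sub>1 \<in> D a b \<Longrightarrow> \<omega>\<^sub>2 \<in> D a b \<Longrightarrow>
      \<Phi> (branches P (2 ^ a) (2 ^ b) (\<omega>\<^sub>1 + \<omega>\<^sub>2)) = \<Phi> (branches P (2 ^ a) (2 ^ b) \<omega>\<^sub>1) + \<Phi> (branches P (2 ^ a) (2 ^ b) \<omega>\<^sub>2)"
    and \<omega>: "\<omega> \<in> D a b"
  shows "\<Phi> (branches (compile a b is P) (2 ^ a) (2 ^ b) \<omega>) =
    \<Phi> (branches P (2 ^ a) (2 ^ b) (fold (\<lambda>s. apply_kraus (2 ^ a * 2 ^ b) (instruction_kraus a b s)) is \<omega>))"
  using add \<omega>
proof (induction a b "is" P arbitrary: \<omega> rule: compile.induct)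
  case (1 a b P)
  then show ?case by simp
next
  case (2 a b p ws U "is" P)
  let ?E = "local_op p (2 ^ a) (2 ^ b) (lift_gate (case p of Alice \<Rightarrow> a | Bob \<Rightarrow> b) ws U)"
  have car: "?E \<in> carrier_mat (2 ^ a * 2 ^ b) (2 ^ a * 2 ^ b)"
    using instruction_kraus_carrier[of ?E a b "Gate p ws U"] by simp
  have "apply_kraus (2 ^ a * 2 ^ b) [?E] \<omega> = sandwich ?E \<omega>"
    using sandwich_carrier[OF car, of \<omega>] by (simp add: apply_kraus_def)
  moreover have "sandwich ?E \<omega> \<in> D a b" using car by (simp add: D_def)
  ultimately show ?case using 2 by (cases p) auto
next
  case (3 a b p w "is" P)
  let ?f = "fold (\<lambda>s. apply_kraus (2 ^ a * 2 ^ b) (instruction_kraus a b s)) is"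
  let ?E = "\<lambda>v. local_op p (2 ^ a) (2 ^ b) (wire_proj (case p of Alice \<Rightarrow> a | Bob \<Rightarrow> b) w v)"
  have car: "?E v \<in> carrier_mat (2 ^ a * 2 ^ b) (2 ^ a * 2 ^ b)" for v
    using instruction_kraus_carrier[of "?E v" a b "Measure p w"] by (cases v) auto
  have sc: "sandwich (?E v) \<omega> \<in> D a b" for v unfolding D_def by (rule sandwich_carrier[OF car])
  have "apply_kraus (2 ^ a * 2 ^ b) [?E False, ?E True] \<omega> = sandwich (?E False) \<omega> + sandwich (?E True) \<omega>"
    using sc by (simp add: apply_kraus_def D_def)
  moreover have "?f (sandwich (?E v) \<omega>) \<in> D a b" for v
    using sc by (auto simp: D_def intro: fold_kraus_carrier)
  ultimately have "\<Phi> (branches P (2 ^ a) (2 ^ b) (?f (apply_kraus (2 ^ a * 2 ^ b) [?E False, ?E True] \<omega>))) =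
    \<Phi> (branches P (2 ^ a) (2 ^ b) (?f (sandwich (?E False) \<omega>))) +
    \<Phi> (branches P (2 ^ a) (2 ^ b) (?f (sandwich (?E True) \<omega>)))"
    using sc by (simp add: fold_kraus_add D_def 3(2))
  then show ?case
    using 3(1)[OF 3(2) sc[of False]] 3(1)[OF 3(2) sc[of True]] by (cases p) (simp_all add: append Nil)
next
  case (4 a b w w' "is" P)
  let ?f = "fold (\<lambda>s. apply_kraus (2 ^ a * 2 ^ b) (instruction_kraus a b s)) is"
  let ?E = "kron (wire_proj a w False) (1\<^sub>m (2 ^ b))"
  let ?F = "kron (wire_proj a w True) (lift_gate b [w'] pauli_X)"
  have sc: "sandwich ?E \<omega> \<in> D a b" "sandwich ?F \<omega> \<in> D a b"
    by (auto simp: D_def intro!: sandwich_carrier kron_carrier)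
  have "apply_kraus (2 ^ a * 2 ^ b) [?E, ?F] \<omega> = sandwich ?E \<omega> + sandwich ?F \<omega>"
    using sc by (simp add: apply_kraus_def D_def)
  moreover have "?f (sandwich ?E \<omega>) \<in> D a b" "?f (sandwich ?F \<omega>) \<in> D a b"
    using sc by (auto simp: D_def intro: fold_kraus_carrier)
  ultimately have "\<Phi> (branches P (2 ^ a) (2 ^ b) (?f (apply_kraus (2 ^ a * 2 ^ b) [?E, ?F] \<omega>))) =
    \<Phi> (branches P (2 ^ a) (2 ^ b) (?f (sandwich ?E \<omega>))) + \<Phi> (branches P (2 ^ a) (2 ^ b) (?f (sandwich ?F \<omega>)))"
    using sc by (simp add: fold_kraus_add D_def 4(3))
  moreover have "sandwich (kron (1\<^sub>m (2 ^ a)) (lift_gate b [w'] pauli_X))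
      (sandwich (kron (wire_proj a w True) (1\<^sub>m (2 ^ b))) \<omega>) = sandwich ?F \<omega>"
    using 4(4) by (intro sandwich_kron_Alice_Bob) (auto simp: D_def)
  ultimately show ?case
    using 4(1)[OF refl 4(3) sc(1)] 4(2)[OF zero_neq_one[symmetric] 4(3) sc(2)] by (simp add: append Nil local_op_def)
next
  case (5 a b w w' "is" P)
  let ?f = "fold (\<lambda>s. apply_kraus (2 ^ a * 2 ^ b) (instruction_kraus a b s)) is"
  let ?E = "kron (1\<^sub>m (2 ^ a)) (wire_proj b w False)"
  let ?F = "kron (lift_gate a [w'] pauli_X) (wire_proj b w True)"
  have sc: "sandwich ?E \<omega> \<in> D a b" "sandwich ?F \<omega> \<in> D a b"
    by (auto simp: D_def intro!: sandwich_carrier kron_carrier)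
  have "apply_kraus (2 ^ a * 2 ^ b) [?E, ?F] \<omega> = sandwich ?E \<omega> + sandwich ?F \<omega>"
    using sc by (simp add: apply_kraus_def D_def)
  moreover have "?f (sandwich ?E \<omega>) \<in> D a b" "?f (sandwich ?F \<omega>) \<in> D a b"
    using sc by (auto simp: D_def intro: fold_kraus_carrier)
  ultimately have "\<Phi> (branches P (2 ^ a) (2 ^ b) (?f (apply_kraus (2 ^ a * 2 ^ b) [?E, ?F] \<omega>))) =
    \<Phi> (branches P (2 ^ a) (2 ^ b) (?f (sandwich ?E \<omega>))) + \<Phi> (branches P (2 ^ a) (2 ^ b) (?f (sandwich ?F \<omega>)))"
    using sc by (simp add: fold_kraus_add D_def 5(3))
  moreover have "sandwich (kron (lift_gate a [w'] pauli_X) (1\<^sub>m (2 ^ b)))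
      (sandwich (kron (1\<^sub>m (2 ^ a)) (wire_proj b w True)) \<omega>) = sandwich ?F \<omega>"
    using 5(4) by (intro sandwich_kron_Bob_Alice) (auto simp: D_def)
  ultimately show ?case
    using 5(1)[OF refl 5(3) sc(1)] 5(2)[OF zero_neq_one[symmetric] 5(3) sc(2)] by (simp add: append Nil local_op_def)
qed

lemma branches_carrier:
  assumes "locc_protocol P a b M" "\<omega> \<in> carrier_mat (a * b) (a * b)" "(Some r, \<sigma>) \<in> set (branches P a b \<omega>)"
  shows "\<sigma> \<in> carrier_mat (M * M) (M * M)"
  using assms
proof (induction P arbitrary: a b \<omega>)
  case (Halt x)
  then show ?case by auto
next
  case (Local p Es cont)
  then obtain k where k: "k < length Es" and "(Some r, \<sigma>) \<in> set (branches (cont k)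
       (case p of Alice \<Rightarrow> dim_row (Es ! k) | Bob \<Rightarrow> a)
       (case p of Alice \<Rightarrow> b | Bob \<Rightarrow> dim_row (Es ! k))
       (sandwich (local_op p a b (Es ! k)) \<omega>))"
    by auto
  moreover have "sandwich (local_op p a b (Es ! k)) \<omega> \<in>
    carrier_mat ((case p of Alice \<Rightarrow> dim_row (Es ! k) | Bob \<Rightarrow> a) * (case p of Alice \<Rightarrow> b | Bob \<Rightarrow> dim_row (Es ! k)))
      ((case p of Alice \<Rightarrow> dim_row (Es ! k) | Bob \<Rightarrow> a) * (case p of Alice \<Rightarrow> b | Bob \<Rightarrow> dim_row (Es ! k)))"
    by (intro carrier_matI) (auto simp: local_op_def split: party.splits)
  ultimately show ?case
    using Local.IH[of "cont k"] Local.prems(1) by auto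
qed

text \<open>
  A value outside of \<open>{..<M}\<close> on the output wires cannot be read out. The tree reports it as FAIL,
  while the circuit would lose it.
\<close>

definition readout_tail :: "nat \<Rightarrow> locc_circuit \<Rightarrow> locc" where
  "readout_tail M C = (let a = alice_wires C; b = bob_wires C;
      es = env_states a (alice_out C); fs = env_states b (bob_out C)
    in Local Alice (map (readout a (alice_out C) M) es @ [pmat a (\<lambda>x. M \<le> wires_val (alice_out C) x)])
      (\<lambda>k. if k < length es \<and> \<not> bit (es ! k) (fail_wire C) then
         Local Bob (map (readout b (bob_out C) M) fs @ [pmat b (\<lambda>y. M \<le> wires_val (bob_out C) y)])
           (\<lambda>l. Halt (if l < length fs then Some (wires_val (record_wires C) (es ! k)) else None))
       else Halt None))"

definition circuit_protocol :: "nat \<Rightarrow> nat \<Rightarrow> nat \<Rightarrow> locc_circuit \<Rightarrow> locc" where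
  "circuit_protocol N K M C = (let a = alice_wires C; b = bob_wires C
    in Local Alice [encode a N K] (\<lambda>_. Local Bob [encode b N K]
      (\<lambda>_. compile a b (instructions C) (readout_tail M C))))"

lemma locc_protocol_readout_tail:
  "locc_protocol (readout_tail M C) (2 ^ alice_wires C) (2 ^ bob_wires C) M"
  using complete_kraus_readout by (auto simp: readout_tail_def Let_def nth_append)

lemma gepp_circuit_protocol:
  assumes "valid_circuit N K M C" "0 < N" "0 < K"
  shows "gepp N K M (circuit_protocol N K M C)"
  using assms
  by (auto simp: gepp_def circuit_protocol_def Let_def valid_circuit_def complete_kraus_encode
      intro!: locc_protocol_compile locc_protocol_readout_tail)

lemma map_upt_nth: "map (\<lambda>k. f (xs ! k)) [0..<length xs] = map f xs"
  by (metis map_map map_nth comp_apply map_cong)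

text \<open>The successive readouts of Alice and Bob merge into the product operators that
  \<open>circuit_result\<close> uses, with every remaining case reported as FAIL.\<close>

lemma branches_readout_tail:
  fixes C :: locc_circuit and M :: nat
  defines "a \<equiv> alice_wires C" and "b \<equiv> bob_wires C"
  defines "A \<equiv> readout a (alice_out C) M" and "B \<equiv> readout b (bob_out C) M"
    and "LA \<equiv> pmat a (\<lambda>x. M \<le> wires_val (alice_out C) x)"
    and "LB \<equiv> pmat b (\<lambda>y. M \<le> wires_val (bob_out C) y)"
    and "es \<equiv> env_states a (alice_out C)" and "fs \<equiv> env_states b (bob_out C)"
  assumes \<omega>: "\<omega> \<in> carrier_mat (2 ^ a * 2 ^ b) (2 ^ a * 2 ^ b)"
  shows "branches (readout_tail M C) (2 ^ a) (2 ^ b) \<omega> =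
    concat (map (\<lambda>e. if bit e (fail_wire C) then [(None, sandwich (kron (A e) (1\<^sub>m (2 ^ b))) \<omega>)]
        else map (\<lambda>f. (Some (wires_val (record_wires C) e), sandwich (kron (A e) (B f)) \<omega>)) fs @
          [(None, sandwich (kron (A e) LB) \<omega>)]) es) @
      [(None, sandwich (kron LA (1\<^sub>m (2 ^ b))) \<omega>)]"
proof -
  define h where "h = (\<lambda>e. if bit e (fail_wire C) then [(None, sandwich (kron (A e) (1\<^sub>m (2 ^ b))) \<omega>)]
        else map (\<lambda>f. (Some (wires_val (record_wires C) e), sandwich (kron (A e) (B f)) \<omega>)) fs @
          [(None, sandwich (kron (A e) LB) \<omega>)])"
  have carA: "A e \<in> carrier_mat M (2 ^ a)" and carB: "B e \<in> carrier_mat M (2 ^ b)"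
    and carL: "LB \<in> carrier_mat (2 ^ b) (2 ^ b)" for e
    by (auto simp: A_def B_def LB_def)
  have AB: "sandwich (kron (1\<^sub>m M) (B f)) (sandwich (kron (A e) (1\<^sub>m (2 ^ b))) \<omega>) = sandwich (kron (A e) (B f)) \<omega>"
    "sandwich (kron (1\<^sub>m M) LB) (sandwich (kron (A e) (1\<^sub>m (2 ^ b))) \<omega>) = sandwich (kron (A e) LB) \<omega>" for e f
    using sandwich_kron_Alice_Bob[OF carA carB \<omega>] sandwich_kron_Alice_Bob[OF carA carL \<omega>] by auto
  have dims: "dim_row (A e) = M" "dim_row (B e) = M" for e by (auto simp: A_def B_def)
  have tail: "readout_tail M C = Local Alice (map A es @ [LA])
      (\<lambda>k. if k < length es \<and> \<not> bit (es ! k) (fail_wire C) then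
         Local Bob (map B fs @ [LB])
           (\<lambda>l. Halt (if l < length fs then Some (wires_val (record_wires C) (es ! k)) else None))
       else Halt None)"
    unfolding readout_tail_def Let_def a_def b_def A_def B_def LA_def LB_def es_def fs_def ..
  have bob: "branches (Local Bob (map B fs @ [LB]) (\<lambda>l. Halt (if l < length fs then Some r else None))) M (2 ^ b)
      (sandwich (kron (A e) (1\<^sub>m (2 ^ b))) \<omega>) =
    map (\<lambda>f. (Some r, sandwich (kron (A e) (B f)) \<omega>)) fs @ [(None, sandwich (kron (A e) LB) \<omega>)]" for r e
    unfolding branches.simps length_append length_map
    by (simp add: nth_append local_op_def AB concat_map_singleton map_upt_nth[symmetric, of _ fs] cong: map_cong)
  have "branches (readout_tail M C) (2 ^ a) (2 ^ b) \<omega> =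
    concat (map (\<lambda>k. h (es ! k)) [0..<length es]) @ [(None, sandwich (kron LA (1\<^sub>m (2 ^ b))) \<omega>)]"
    unfolding tail branches.simps(2)[of Alice]
    by (auto simp: nth_append local_op_def dims bob h_def simp del: branches.simps(2)
        intro!: arg_cong[where f = concat] map_cong)
  then show ?thesis unfolding map_upt_nth[of h es] unfolding h_def .
qed

lemma sum_list_sum_swap:
  fixes f :: "'b \<Rightarrow> 'c \<Rightarrow> 'a::comm_monoid_add"
  shows "(\<Sum>e\<leftarrow>xs. \<Sum>z\<in>Z. f e z) = (\<Sum>z\<in>Z. \<Sum>e\<leftarrow>xs. f e z)"
  by (induction xs) (auto simp: sum.distrib)

lemma sum_list_concat: "sum_list (concat xss) = sum_list (map sum_list xss)"
  by (induction xss) auto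

lemma Re_sum_list: "Re (sum_list xs) = sum_list (map Re xs)"
  by (induction xs) auto

lemma gepp_input_carrier [simp]: "gepp_input N K \<rho> \<in> carrier_mat (N * K * (N * K)) (N * K * (N * K))"
  by (simp add: gepp_input_def)

lemma final_state_carrier:
  "final_state N K C \<rho> \<in> carrier_mat (2 ^ alice_wires C * 2 ^ bob_wires C) (2 ^ alice_wires C * 2 ^ bob_wires C)"
  unfolding final_state_def Let_def
  by (intro fold_kraus_carrier sandwich_carrier[OF kron_carrier[OF encode_carrier encode_carrier]])

text \<open>FAIL has three causes in the tree: the fail wire, a value of Bob of at least
  \<open>M\<close>, and a value of Alice of at least \<open>M\<close>. All their effects are
  diagonal, so only diagonal entries of the state enter.\<close>

lemma readout_tail_fail:
  fixes C :: locc_circuit and M :: nat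
  defines "a \<equiv> alice_wires C" and "b \<equiv> bob_wires C"
  assumes \<omega>: "\<omega> \<in> carrier_mat (2 ^ a * 2 ^ b) (2 ^ a * 2 ^ b)" and f: "fail_wire C \<notin> set (alice_out C)"
  shows "(\<Sum>(s, \<omega>)\<leftarrow>filter (\<lambda>(s, \<omega>). s = None) (branches (readout_tail M C) (2 ^ a) (2 ^ b) \<omega>). mat_trace \<omega>) =
    (\<Sum>z<2 ^ (a + b). (of_bool (wires_val (alice_out C) (z div 2 ^ b) < M \<and>
        (bit (z div 2 ^ b) (fail_wire C) \<or> M \<le> wires_val (bob_out C) (z mod 2 ^ b))) +
      of_bool (M \<le> wires_val (alice_out C) (z div 2 ^ b))) * \<omega> $$ (z, z))"
proof -
  define A where "A = readout a (alice_out C) M"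
  define B where "B = readout b (bob_out C) M"
  define LA where "LA = pmat a (\<lambda>x. M \<le> wires_val (alice_out C) x)"
  define LB where "LB = pmat b (\<lambda>y. M \<le> wires_val (bob_out C) y)"
  define es where "es = env_states a (alice_out C)"
  define fs where "fs = env_states b (bob_out C)"
  define h where "h = (\<lambda>e. if bit e (fail_wire C) then [(None, sandwich (kron (A e) (1\<^sub>m (2 ^ b))) \<omega>)]
        else map (\<lambda>f. (Some (wires_val (record_wires C) e), sandwich (kron (A e) (B f)) \<omega>)) fs @
          [(None, sandwich (kron (A e) LB) \<omega>)])"
  have br: "branches (readout_tail M C) (2 ^ a) (2 ^ b) \<omega> =
      concat (map h es) @ [(None, sandwich (kron LA (1\<^sub>m (2 ^ b))) \<omega>)]"
    using branches_readout_tail[OF \<omega>[unfolded a_def b_def]]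
    unfolding h_def A_def B_def LA_def LB_def es_def fs_def a_def b_def .
  have hsum: "(\<Sum>(s, \<omega>)\<leftarrow>filter (\<lambda>(s, \<omega>). s = None) (h e). mat_trace \<omega>) =
    (if bit e (fail_wire C) then mat_trace (sandwich (kron (A e) (1\<^sub>m (2 ^ b))) \<omega>)
        else mat_trace (sandwich (kron (A e) LB) \<omega>))" for e
    by (simp add: h_def filter_map comp_def)
  define ag where "ag = (\<lambda>x e. \<forall>w<a. w \<notin> set (alice_out C) \<longrightarrow> bit (x :: nat) w = bit (e :: nat) w)"
  let ?va = "\<lambda>z. wires_val (alice_out C) (z div 2 ^ b)" and ?vb = "\<lambda>z. wires_val (bob_out C) (z mod 2 ^ b)"
  have \<omega>': "\<omega> \<in> carrier_mat (2 ^ (a + b)) (2 ^ (a + b))" using \<omega> by (simp add: power_add)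
  have pa: "pmat b (\<lambda>_. True) = 1\<^sub>m (2 ^ b)" by (rule pmat_True)
  have trA: "mat_trace (sandwich (kron (A e) (1\<^sub>m (2 ^ b))) \<omega>) =
      (\<Sum>z<2 ^ (a + b). of_bool (?va z < M \<and> ag (z div 2 ^ b) e) * \<omega> $$ (z, z))" for e
    by (rule trace_sandwich_pmat[OF _ \<omega>', of _ "M * 2 ^ b"])
      (auto simp: A_def kron_effect readout_effect pa[symmetric] pmat_effect kron_pmat ag_def power_add
        intro!: kron_carrier)
  have trB: "mat_trace (sandwich (kron (A e) LB) \<omega>) =
      (\<Sum>z<2 ^ (a + b). of_bool ((?va z < M \<and> ag (z div 2 ^ b) e) \<and> M \<le> ?vb z) * \<omega> $$ (z, z))" for e
    by (rule trace_sandwich_pmat[OF _ \<omega>', of _ "M * 2 ^ b"])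
      (auto simp: A_def LB_def kron_effect readout_effect pmat_effect kron_pmat ag_def power_add
        intro!: kron_carrier)
  have trL: "mat_trace (sandwich (kron LA (1\<^sub>m (2 ^ b))) \<omega>) =
      (\<Sum>z<2 ^ (a + b). of_bool (M \<le> ?va z) * \<omega> $$ (z, z))"
    by (rule trace_sandwich_pmat[OF _ \<omega>', of _ "2 ^ a * 2 ^ b"])
      (auto simp: LA_def kron_effect pa[symmetric] pmat_effect kron_pmat power_add intro!: kron_carrier)
  have "(\<Sum>(s, \<omega>)\<leftarrow>filter (\<lambda>(s, \<omega>). s = None) (branches (readout_tail M C) (2 ^ a) (2 ^ b) \<omega>). mat_trace \<omega>) =
    (\<Sum>e\<leftarrow>es. if bit e (fail_wire C) then mat_trace (sandwich (kron (A e) (1\<^sub>m (2 ^ b))) \<omega>)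
        else mat_trace (sandwich (kron (A e) LB) \<omega>)) + mat_trace (sandwich (kron LA (1\<^sub>m (2 ^ b))) \<omega>)"
    by (simp add: br filter_concat map_concat sum_list_concat comp_def hsum)
  also have "(\<Sum>e\<leftarrow>es. if bit e (fail_wire C) then mat_trace (sandwich (kron (A e) (1\<^sub>m (2 ^ b))) \<omega>)
        else mat_trace (sandwich (kron (A e) LB) \<omega>)) =
     (\<Sum>e\<leftarrow>es. \<Sum>z<2 ^ (a + b). of_bool (ag (z div 2 ^ b) e) *
        (of_bool (?va z < M \<and> (bit e (fail_wire C) \<or> M \<le> ?vb z)) * \<omega> $$ (z, z)))"
    unfolding trA trB by (intro arg_cong[where f = sum_list] map_cong refl) (auto intro!: sum.cong)
  also have "\<dots> = (\<Sum>z<2 ^ (a + b). of_bool (?va z < M \<and> (bit (clear_wires (alice_out C) (z div 2 ^ b)) (fail_wire C) \<or>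
      M \<le> ?vb z)) * \<omega> $$ (z, z))"
    unfolding sum_list_sum_swap
  proof (intro sum.cong refl)
    fix z :: nat assume "z \<in> {..<2 ^ (a + b)}"
    then have "z div 2 ^ b < 2 ^ a" using div_mod_less(1)[of z "2 ^ a" "2 ^ b"] by (simp add: power_add)
    from sum_env_states[OF this, of "alice_out C"
        "\<lambda>e. of_bool (?va z < M \<and> (bit e (fail_wire C) \<or> M \<le> ?vb z)) * \<omega> $$ (z, z)"]
    show "(\<Sum>e\<leftarrow>es. of_bool (ag (z div 2 ^ b) e) *
        (of_bool (?va z < M \<and> (bit e (fail_wire C) \<or> M \<le> ?vb z)) * \<omega> $$ (z, z))) =
      of_bool (?va z < M \<and> (bit (clear_wires (alice_out C) (z div 2 ^ b)) (fail_wire C) \<or> M \<le> ?vb z)) * \<omega> $$ (z, z)"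
      unfolding ag_def es_def .
  qed
  \<comment> \<open>Clearing the output wires keeps the fail wire, as it is not one of them.\<close>
  finally show ?thesis
    unfolding trL sum.distrib[symmetric] by (simp only: bit_clear_wires f not_False_eq_True simp_thms distrib_right)
qed

lemma readout_tail_out:
  fixes C :: locc_circuit and M :: nat
  defines "a \<equiv> alice_wires C" and "b \<equiv> bob_wires C"
  assumes \<omega>: "\<omega> \<in> carrier_mat (2 ^ a * 2 ^ b) (2 ^ a * 2 ^ b)" and ij: "i < M * M" "j < M * M"
  shows "(\<Sum>A\<leftarrow>map snd (filter (\<lambda>(s, \<omega>). s = Some r) (branches (readout_tail M C) (2 ^ a) (2 ^ b) \<omega>)). A $$ (i, j)) =
    apply_kraus (M * M)
            [kron (readout a (alice_out C) M e) (readout b (bob_out C) M f).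
               e \<leftarrow> filter (\<lambda>e. \<not> bit e (fail_wire C) \<and> wires_val (record_wires C) e = r)
                      (env_states a (alice_out C)),
               f \<leftarrow> env_states b (bob_out C)] \<omega> $$ (i, j)"
proof -
  define A where "A = readout a (alice_out C) M"
  define B where "B = readout b (bob_out C) M"
  define es where "es = env_states a (alice_out C)"
  define fs where "fs = env_states b (bob_out C)"
  define LA where "LA = pmat a (\<lambda>x. M \<le> wires_val (alice_out C) x)"
  define LB where "LB = pmat b (\<lambda>y. M \<le> wires_val (bob_out C) y)"
  define h where "h = (\<lambda>e. if bit e (fail_wire C) then [(None, sandwich (kron (A e) (1\<^sub>m (2 ^ b))) \<omega>)]
        else map (\<lambda>f. (Some (wires_val (record_wires C) e), sandwich (kron (A e) (B f)) \<omega>)) fs @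
          [(None, sandwich (kron (A e) LB) \<omega>)])"
  have br: "branches (readout_tail M C) (2 ^ a) (2 ^ b) \<omega> =
      concat (map h es) @ [(None, sandwich (kron LA (1\<^sub>m (2 ^ b))) \<omega>)]"
    using branches_readout_tail[OF \<omega>[unfolded a_def b_def]]
    unfolding h_def A_def B_def LA_def LB_def es_def fs_def a_def b_def .
  have hsum: "(\<Sum>A\<leftarrow>map snd (filter (\<lambda>(s, \<omega>). s = Some r) (h e)). A $$ (i, j)) =
    (if \<not> bit e (fail_wire C) \<and> wires_val (record_wires C) e = r then
       (\<Sum>f\<leftarrow>fs. sandwich (kron (A e) (B f)) \<omega> $$ (i, j)) else 0)" for e
    by (simp add: h_def filter_map comp_def)
  have "(\<Sum>A\<leftarrow>map snd (filter (\<lambda>(s, \<omega>). s = Some r) (branches (readout_tail M C) (2 ^ a) (2 ^ b) \<omega>)). A $$ (i, j)) =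
    (\<Sum>e\<leftarrow>es. if \<not> bit e (fail_wire C) \<and> wires_val (record_wires C) e = r then
       (\<Sum>f\<leftarrow>fs. sandwich (kron (A e) (B f)) \<omega> $$ (i, j)) else 0)"
    by (simp add: br filter_concat map_concat sum_list_concat comp_def hsum[unfolded map_map comp_def])
  also have "\<dots> = (\<Sum>e\<leftarrow>filter (\<lambda>e. \<not> bit e (fail_wire C) \<and> wires_val (record_wires C) e = r) es.
      \<Sum>f\<leftarrow>fs. sandwich (kron (A e) (B f)) \<omega> $$ (i, j))"
    by (induction es) auto
  also have "\<dots> = apply_kraus (M * M) [kron (A e) (B f).
      e \<leftarrow> filter (\<lambda>e. \<not> bit e (fail_wire C) \<and> wires_val (record_wires C) e = r) es, f \<leftarrow> fs] \<omega> $$ (i, j)"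
    using ij by (subst apply_kraus_index[where c = "2 ^ a * 2 ^ b"])
      (auto simp: A_def B_def map_concat sum_list_concat comp_def intro!: kron_carrier)
  finally show ?thesis by (simp add: A_def B_def es_def fs_def)
qed

text \<open>The outputs of tree and circuit agree by construction. The failure probabilities agree
  because of \<open>no_leak\<close>: a value outside of the output range would be counted as FAIL by
  the tree only.\<close>

theorem implements_circuit_protocol:
  fixes C :: locc_circuit
  defines "a \<equiv> alice_wires C" and "b \<equiv> bob_wires C"
  assumes valid: "valid_circuit N K M C" and pos: "0 < N" "0 < K"
    and no_leak: "\<And>\<rho> z. density_operator (N * N) \<rho> \<Longrightarrow> z < 2 ^ (a + b) \<Longrightarrow> final_state N K C \<rho> $$ (z, z) \<noteq> 0 \<Longrightarrow>
      wires_val (alice_out C) (z div 2 ^ b) < M \<and> wires_val (bob_out C) (z mod 2 ^ b) < M"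
  shows "implements N K M C (circuit_protocol N K M C)"
proof -
  let ?P = "circuit_protocol N K M C" and ?T = "readout_tail M C"
  let ?D = "carrier_mat (2 ^ a * 2 ^ b) (2 ^ a * 2 ^ b) :: complex mat set"
  have f: "fail_wire C \<notin> set (alice_out C)" using valid by (auto simp: valid_circuit_def)
  have "circuit_result N K M C \<rho> = gepp_result N K M ?P \<rho>" if \<rho>: "density_operator (N * N) \<rho>" for \<rho>
  proof -
    define \<omega>0 where "\<omega>0 = sandwich (kron (encode a N K) (encode b N K)) (gepp_input N K \<rho>)"
    define \<omega> where "\<omega> = final_state N K C \<rho>"
    have \<omega>0: "\<omega>0 \<in> ?D" unfolding \<omega>0_def by (rule sandwich_carrier[OF kron_carrier[OF encode_carrier encode_carrier]])
    have \<omega>: "\<omega> \<in> ?D" using final_state_carrier[of N K C \<rho>] by (simp add: \<omega>_def a_def b_def)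
    have fin: "\<omega> = fold (\<lambda>s. apply_kraus (2 ^ a * 2 ^ b) (instruction_kraus a b s)) (instructions C) \<omega>0"
      by (simp add: \<omega>_def final_state_def Let_def \<omega>0_def a_def b_def)
    define bs where "bs = branches ?P (N * K) (N * K) (gepp_input N K \<rho>)"
    have bs: "bs = branches (compile a b (instructions C) ?T) (2 ^ a) (2 ^ b) \<omega>0"
      using sandwich_kron_Alice_Bob[of "encode a N K" "2 ^ a" "N * K" "encode b N K" "2 ^ b" "N * K" "gepp_input N K \<rho>"]
      by (simp add: bs_def circuit_protocol_def Let_def local_op_def \<omega>0_def a_def b_def)
    let ?F = "\<lambda>bs. \<Sum>(s, \<omega>)\<leftarrow>filter (\<lambda>(s :: nat option, \<omega>). s = None) bs. mat_trace \<omega>"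
    have addf: "?F (branches ?T (2 ^ a) (2 ^ b) (\<omega>\<^sub>1 + \<omega>\<^sub>2)) =
        ?F (branches ?T (2 ^ a) (2 ^ b) \<omega>\<^sub>1) + ?F (branches ?T (2 ^ a) (2 ^ b) \<omega>\<^sub>2)"
      if "\<omega>\<^sub>1 \<in> ?D" "\<omega>\<^sub>2 \<in> ?D" for \<omega>\<^sub>1 \<omega>\<^sub>2
      unfolding readout_tail_fail[where C = C, folded a_def b_def, OF add_carrier_mat[OF that(2)] f]
        readout_tail_fail[where C = C, folded a_def b_def, OF that(1) f] readout_tail_fail[where C = C, folded a_def b_def, OF that(2) f]
        sum.distrib[symmetric]
      using that by (intro sum.cong refl) (simp add: distrib_left power_add)
    have "(\<Sum>(s, \<omega>)\<leftarrow>filter (\<lambda>(s, \<omega>). s = None) bs. mat_trace \<omega>) =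
      (\<Sum>(s, \<omega>)\<leftarrow>filter (\<lambda>(s, \<omega>). s = None) (branches ?T (2 ^ a) (2 ^ b) \<omega>). mat_trace \<omega>)"
      unfolding bs fin
      by (rule branches_compile[where \<Phi> = "\<lambda>bs. \<Sum>(s, \<omega>)\<leftarrow>filter (\<lambda>(s, \<omega>). s = None) bs. mat_trace \<omega>"])
        (use \<omega>0 addf in auto)
    \<comment> \<open>Wherever the diagonal entry is nonzero, both output values are below
      \<open>M\<close>; of the three causes of FAIL only the fail wire is left.\<close>
    also have "\<dots> = (\<Sum>z<2 ^ (a + b). of_bool (bit (z div 2 ^ b) (fail_wire C)) * \<omega> $$ (z, z))"
      unfolding readout_tail_fail[where C = C, folded a_def b_def, OF \<omega> f]
    proof (intro sum.cong refl)
      fix z :: nat assume "z \<in> {..<2 ^ (a + b)}"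
      then have "\<omega> $$ (z, z) = 0 \<or> wires_val (alice_out C) (z div 2 ^ b) < M \<and> wires_val (bob_out C) (z mod 2 ^ b) < M"
        using no_leak[OF \<rho>, of z] by (auto simp: \<omega>_def)
      then show "(of_bool (wires_val (alice_out C) (z div 2 ^ b) < M \<and>
        (bit (z div 2 ^ b) (fail_wire C) \<or> M \<le> wires_val (bob_out C) (z mod 2 ^ b))) +
      of_bool (M \<le> wires_val (alice_out C) (z div 2 ^ b))) * \<omega> $$ (z, z) =
        of_bool (bit (z div 2 ^ b) (fail_wire C)) * \<omega> $$ (z, z)"
        by auto
    qed
    also have "\<dots> = mat_trace (sandwich (local_op Alice (2 ^ a) (2 ^ b) (wire_proj a (fail_wire C) True)) \<omega>)"
      using \<omega> by (intro trace_sandwich_pmat[symmetric, where r = "2 ^ a * 2 ^ b"])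
        (auto simp: local_op_def wire_proj_eq_pmat kron_effect pmat_True[symmetric] pmat_effect kron_pmat power_add
          intro!: kron_carrier)
    finally have "?F bs = mat_trace (sandwich (local_op Alice (2 ^ a) (2 ^ b) (wire_proj a (fail_wire C) True)) \<omega>)" .
    from arg_cong[OF this, of Re] have fail: "(\<Sum>(s, \<omega>)\<leftarrow>filter (\<lambda>(s, \<omega>). s = None) bs. Re (mat_trace \<omega>)) =
        Re (mat_trace (sandwich (local_op Alice (2 ^ a) (2 ^ b) (wire_proj a (fail_wire C) True)) \<omega>))"
      by (simp only: Re_sum_list map_map comp_def case_prod_unfold)
    define Es where "Es = (\<lambda>r. [kron (readout a (alice_out C) M e) (readout b (bob_out C) M f).
               e \<leftarrow> filter (\<lambda>e. \<not> bit e (fail_wire C) \<and> wires_val (record_wires C) e = r)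
                      (env_states a (alice_out C)),
               f \<leftarrow> env_states b (bob_out C)])"
    have out: "mat_sum (M * M) (map snd (filter (\<lambda>(s, \<omega>). s = Some r) bs)) = apply_kraus (M * M) (Es r) \<omega>"
      (is "?L = ?R") for r
    proof -
      have carb: "A \<in> carrier_mat (M * M) (M * M)" if "A \<in> set (map snd (filter (\<lambda>(s, \<omega>). s = Some r) bs))" for A
        using that branches_carrier[OF gepp_circuit_protocol[OF valid pos, unfolded gepp_def] gepp_input_carrier]
        by (auto simp: bs_def)
      have L: "?L \<in> carrier_mat (M * M) (M * M)" using carb by (rule mat_sum_carrier)
      have kc: "E \<in> carrier_mat (M * M) (2 ^ a * 2 ^ b)" if "E \<in> set (Es r)" for E
        using that by (auto simp: Es_def intro!: kron_carrier)
      have R: "apply_kraus (M * M) (Es r) \<omega>' \<in> carrier_mat (M * M) (M * M)" for \<omega>' using kc by (rule apply_kraus_carrier)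
      show ?thesis
      proof (rule eq_matI)
        fix i j assume "i < dim_row ?R" "j < dim_col ?R"
        then have ij: "i < M * M" "j < M * M" using R[of \<omega>] by auto
        \<comment> \<open>\<open>branches_compile\<close> speaks of scalar functionals, so the
          output matrices are compared entry by entry.\<close>
        let ?G = "\<lambda>bs. \<Sum>A\<leftarrow>map snd (filter (\<lambda>(s, \<omega>). s = Some r) bs). A $$ (i, j)"
        have tail: "?G (branches ?T (2 ^ a) (2 ^ b) \<omega>') = apply_kraus (M * M) (Es r) \<omega>' $$ (i, j)"
          if "\<omega>' \<in> ?D" for \<omega>'
          unfolding Es_def by (rule readout_tail_out[where C = C, folded a_def b_def, OF that ij])
        have addg: "?G (branches ?T (2 ^ a) (2 ^ b) (\<omega>\<^sub>1 + \<omega>\<^sub>2)) =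
            ?G (branches ?T (2 ^ a) (2 ^ b) \<omega>\<^sub>1) + ?G (branches ?T (2 ^ a) (2 ^ b) \<omega>\<^sub>2)"
          if "\<omega>\<^sub>1 \<in> ?D" "\<omega>\<^sub>2 \<in> ?D" for \<omega>\<^sub>1 \<omega>\<^sub>2
          using carrier_matD[OF R[of \<omega>\<^sub>2]] ij
          unfolding tail[OF that(1)] tail[OF that(2)] tail[OF add_carrier_mat[OF that(2)]] apply_kraus_add[where Es = "Es r", OF kc that, simplified]
          by simp
        have "?L $$ (i, j) = ?G bs" by (rule mat_sum_index[OF carb ij])
        also have "\<dots> = ?G (branches ?T (2 ^ a) (2 ^ b) \<omega>)"
          unfolding bs fin by (rule branches_compile[where \<Phi> = ?G]) (use \<omega>0 addg in auto)
        also have "\<dots> = ?R $$ (i, j)" by (rule tail[OF \<omega>])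
        finally show "?L $$ (i, j) = ?R $$ (i, j)" .
      qed (use L R[of \<omega>] in auto)
    qed
    show ?thesis
      unfolding circuit_result_def gepp_result_def Let_def bs_def[symmetric] a_def[symmetric] b_def[symmetric]
        \<omega>_def[symmetric] fail out Es_def ..
  qed
  then show ?thesis using valid by (simp add: implements_def)
qed

lemma sum_Pow_Un:
  fixes f :: "'b set \<Rightarrow> 'a::comm_monoid_add"
  assumes "A \<inter> B = {}"
  shows "(\<Sum>C\<in>Pow (A \<union> B). f C) = (\<Sum>C\<in>Pow A. \<Sum>D\<in>Pow B. f (C \<union> D))"
proof -
  have "(\<Sum>C\<in>Pow (A \<union> B). f C) = (\<Sum>(C, D)\<in>Pow A \<times> Pow B. f (C \<union> D))"
    by (rule sum.reindex_bij_witness[of _ "\<lambda>(C, D). C \<union> D" "\<lambda>C. (C \<inter> A, C \<inter> B)"])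
      (use assms in \<open>auto simp flip: Int_Un_distrib intro!: arg_cong[where f = f]\<close>)
  then show ?thesis by (simp add: sum.cartesian_product)
qed

lemma sum_Pow_image:
  assumes "inj_on h A"
  shows "(\<Sum>C\<in>Pow (h ` A). f C) = (\<Sum>C\<in>Pow A. f (h ` C))"
  using bij_betw_Pow[OF inj_on_imp_bij_betw[OF assms]]
  by (rule sum.reindex_bij_betw[symmetric])

subsection \<open>The register of both parties\<close>

definition hadamard :: "complex mat" where
  "hadamard = mat 2 2 (\<lambda>(i, j). (- 1) ^ (i * j) / complex_of_real (sqrt 2))"

text \<open>Bits 0 and 1 are the controls and bit 2 is the target. Conjunction gives the Toffoli
  gate that adds a product to a parity, disjunction the gate that accumulates the failed
  tests.\<close>

definition controlled_flip :: "(bool \<Rightarrow> bool \<Rightarrow> bool) \<Rightarrow> complex mat" where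
  "controlled_flip f = mat 8 8 (\<lambda>(i, j). of_bool (i mod 4 = j mod 4 \<and>
     odd (i div 4) = (odd (j div 4) \<noteq> f (odd j) (odd (j div 2)))))"

lemma hadamard_unitary: "hadamard \<in> carrier_mat 2 2" "mat_adjoint hadamard * hadamard = 1\<^sub>m 2"
proof -
  show car: "hadamard \<in> carrier_mat 2 2" by (simp add: hadamard_def)
  define h where "h = 1 / complex_of_real (sqrt 2)"
  have h: "cnj h = h" "h * h = 1 / 2"
    by (simp_all add: h_def flip: of_real_mult)
  have H: "hadamard $$ (i, j) = (- 1) ^ (i * j) * h" if "i < 2" "j < 2" for i j
    using that by (simp add: hadamard_def h_def)
  show "mat_adjoint hadamard * hadamard = 1\<^sub>m 2"
  proof (rule eq_matI)
    fix i j assume "i < dim_row (1\<^sub>m 2 :: complex mat)" "j < dim_col (1\<^sub>m 2 :: complex mat)"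
    then have ij: "i < 2" "j < 2" by auto
    have "{..<2 :: nat} = {0, 1}" by auto
    then have "(mat_adjoint hadamard * hadamard) $$ (i, j) = h * h + (- 1) ^ i * ((- 1) ^ j * (h * h))"
      unfolding effect_index[OF car ij] using ij by (simp add: H h(1))
    also have "\<dots> = 1\<^sub>m 2 $$ (i, j)"
      unfolding h(2) using ij by (elim less_2_cases[THEN disjE]) simp_all
    finally show "(mat_adjoint hadamard * hadamard) $$ (i, j) = 1\<^sub>m 2 $$ (i, j)" .
  qed (use car in auto)
qed

lemma controlled_flip_unitary:
  "controlled_flip f \<in> carrier_mat 8 8" "mat_adjoint (controlled_flip f) * controlled_flip f = 1\<^sub>m 8"
proof -
  show car: "controlled_flip f \<in> carrier_mat 8 8" by (simp add: controlled_flip_def)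
  \<comment> \<open>The matrix is the permutation matrix of \<open>g\<close>, which keeps the two
    controls and is therefore injective.\<close>
  define g where "g = (\<lambda>j :: nat. j mod 4 + 4 * of_bool (odd (j div 4) \<noteq> f (odd j) (odd (j div 2))))"
  have g: "g j < 8" "g j mod 4 = j mod 4" "odd (g j div 4) = (odd (j div 4) \<noteq> f (odd j) (odd (j div 2)))"
    for j by (auto simp: g_def)
  have eight: "i = j" if "i < 8" "j < 8" "i mod 4 = j mod 4" "odd (i div 4) = odd (j div 4)" for i j :: nat
  proof -
    have "i div 4 < 2" "j div 4 < 2" using that by auto
    then have "i div 4 = j div 4" using that(4) by (auto simp: less_2_cases_iff)
    then show ?thesis using that(3) by (metis div_mult_mod_eq)
  qed
  have odd4: "odd (j :: nat) = odd (j mod 4)" "odd (j div 2) = odd (j mod 4 div 2)" for j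
    by presburger+
  have E: "controlled_flip f $$ (i, j) = of_bool (i = g j)" if "i < 8" "j < 8" for i j
  proof -
    have "i = g j \<longleftrightarrow> i mod 4 = j mod 4 \<and> odd (i div 4) = (odd (j div 4) \<noteq> f (odd j) (odd (j div 2)))"
      using g[of j] eight[OF that(1) g(1)] by metis
    then show ?thesis using that by (simp add: controlled_flip_def)
  qed
  have inj: "i = j" if "g i = g j" "i < 8" "j < 8" for i j
  proof (rule eight[OF that(2,3)])
    show m: "i mod 4 = j mod 4" using that(1) g(2) by metis
    have "odd i = odd j" "odd (i div 2) = odd (j div 2)"
      using m odd4(1)[of i] odd4(1)[of j] odd4(2)[of i] odd4(2)[of j] by argo+
    then show "odd (i div 4) = odd (j div 4)" using g(3)[of i] g(3)[of j] that(1) by auto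
  qed
  show "mat_adjoint (controlled_flip f) * controlled_flip f = 1\<^sub>m 8"
  proof (rule eq_matI)
    fix i j assume "i < dim_row (1\<^sub>m 8 :: complex mat)" "j < dim_col (1\<^sub>m 8 :: complex mat)"
    then have ij: "i < 8" "j < 8" by auto
    have "(mat_adjoint (controlled_flip f) * controlled_flip f) $$ (i, j) =
      (\<Sum>k<8. if k = g i then of_bool (g i = g j) else 0)"
      unfolding effect_index[OF car ij] using ij by (intro sum.cong refl) (auto simp: E)
    also have "\<dots> = of_bool (i = j)" using g(1)[of i] inj[OF _ ij] by (subst sum.delta) auto
    finally show "(mat_adjoint (controlled_flip f) * controlled_flip f) $$ (i, j) = 1\<^sub>m 8 $$ (i, j)"
      using ij by auto
  qed (use car in auto)
qed

definition toggle :: "bool \<Rightarrow> 'w \<Rightarrow> 'w set \<Rightarrow> 'w set" where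
  "toggle c w Y = {v. (v \<in> Y) \<noteq> (c \<and> v = w)}"

lemma in_toggle: "v \<in> toggle c w Y \<longleftrightarrow> (v \<in> Y) \<noteq> (c \<and> v = w)"
  by (simp add: toggle_def)

lemma UNIV_party: "(UNIV :: party set) = {Alice, Bob}"
  using party.exhaust by auto

lemma finite_UNIV_party [simp]: "finite (UNIV :: party set)"
  by (simp add: UNIV_party)

lemma all_party: "(\<forall>p. P p) \<longleftrightarrow> P Alice \<and> P Bob"
  by (metis party.exhaust)

text \<open>A basis state of the joint register is represented by the set of the wires that carry a 1.\<close>

locale register =
  fixes n :: nat and pos :: "'r \<Rightarrow> nat" and R :: "'r set"
  assumes pos: "bij_betw pos R {..<n}"
begin

text \<open>Alice's wires are the more significant ones, since the Kronecker index of the pair (x,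
  y) is \<open>x * 2 ^ n + y\<close>.\<close>

definition num :: "party \<times> 'r \<Rightarrow> nat" where
  "num v = (case v of (Alice, r) \<Rightarrow> n + pos r | (Bob, r) \<Rightarrow> pos r)"

definition wires :: "(party \<times> 'r) set" where
  "wires = UNIV \<times> R"

definition idx :: "(party \<times> 'r) set \<Rightarrow> nat" where
  "idx Z = set_encode (num ` Z)"

definition part :: "party \<Rightarrow> nat \<Rightarrow> nat" where
  "part p z = (case p of Alice \<Rightarrow> z div 2 ^ n | Bob \<Rightarrow> z mod 2 ^ n)"

lemma finite_R: "finite R"
  using bij_betw_finite[OF pos] by simp

lemma finite_wires [simp]: "finite wires"
  using finite_R by (simp add: wires_def)

lemma in_wires [simp]: "(p, r) \<in> wires \<longleftrightarrow> r \<in> R"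
  by (simp add: wires_def)

lemma pos_less: "r \<in> R \<Longrightarrow> pos r < n"
  using pos by (auto simp: bij_betw_def)

lemma pos_inj: "r \<in> R \<Longrightarrow> r' \<in> R \<Longrightarrow> pos r = pos r' \<longleftrightarrow> r = r'"
  using pos by (auto simp: bij_betw_def inj_on_def)

lemma pos_surj: "w < n \<Longrightarrow> \<exists>r\<in>R. pos r = w"
  using pos by (metis bij_betw_def image_iff lessThan_iff)

lemma num_bij: "bij_betw num wires {..<n + n}"
  unfolding bij_betw_def
proof
  show "inj_on num wires"
    using pos_less pos_inj by (force simp: inj_on_def num_def wires_def split: party.splits)
  have "w \<in> num ` wires" if "w < n + n" for w
  proof (cases "w < n")
    case True
    then obtain r where "r \<in> R" "pos r = w" using pos_surj by blast
    then show ?thesis by (intro image_eqI[of _ _ "(Bob, r)"]) (auto simp: num_def)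
  next
    case False
    then have "w - n < n" using that by auto
    then obtain r where "r \<in> R" "pos r = w - n" using pos_surj by blast
    then show ?thesis using False by (intro image_eqI[of _ _ "(Alice, r)"]) (auto simp: num_def)
  qed
  then show "num ` wires = {..<n + n}"
    using pos_less by (force simp: num_def wires_def split: party.splits)
qed

lemma idx_bij: "bij_betw idx (Pow wires) {..<2 ^ (n + n)}"
  unfolding bij_betw_def
proof
  have fin: "finite (num ` Z)" if "Z \<in> Pow wires" for Z
    using that finite_subset[OF _ finite_wires] by auto
  show "inj_on idx (Pow wires)"
    using fin num_bij unfolding inj_on_def idx_def
    by (metis PowD bij_betw_imp_inj_on inj_on_image_eq_iff set_encode_inverse)
  have "z \<in> idx ` Pow wires" if "z < 2 ^ (n + n)" for z
  proof -
    have "{w. bit z w} \<subseteq> {..<n + n}" using that bit_less_exp by auto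
    then obtain Z where Z: "Z \<subseteq> wires" "{w. bit z w} = num ` Z"
      using num_bij by (metis bij_betw_def subset_image_iff)
    have "idx Z = z"
      unfolding idx_def Z(2)[symmetric] by (rule bit_eqI) (auto simp: bit_set_encode finite_bits)
    then show ?thesis using Z by auto
  qed
  moreover have "idx Z < 2 ^ (n + n)" if "Z \<subseteq> wires" for Z
    unfolding idx_def using that num_bij by (intro set_encode_less) (auto simp: bij_betw_def)
  ultimately show "idx ` Pow wires = {..<2 ^ (n + n)}" by auto
qed

lemma idx_less: "Z \<subseteq> wires \<Longrightarrow> idx Z < 2 ^ n * 2 ^ n"
  using idx_bij by (auto simp: bij_betw_def power_add)

lemma bit_idx: "Z \<subseteq> wires \<Longrightarrow> v \<in> wires \<Longrightarrow> bit (idx Z) (num v) \<longleftrightarrow> v \<in> Z"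
  unfolding idx_def using num_bij finite_subset[OF _ finite_wires]
  by (subst bit_set_encode) (auto simp: bij_betw_def inj_on_def)

lemma bit_part: "Z \<subseteq> wires \<Longrightarrow> r \<in> R \<Longrightarrow> bit (part p (idx Z)) (pos r) \<longleftrightarrow> (p, r) \<in> Z"
  using bit_idx[of Z "(p, r)"] pos_less
  by (cases p) (auto simp: part_def bit_div_exp bit_mod_exp num_def)

lemma part_less: "Z \<subseteq> wires \<Longrightarrow> part p (idx Z) < 2 ^ n"
  using div_mod_less[OF idx_less] by (cases p) (auto simp: part_def)

lemma agree_iff:
  assumes "Z \<subseteq> wires" "Y \<subseteq> wires" "set rs \<subseteq> R"
  shows "(\<forall>w<n. w \<notin> set (map pos rs) \<longrightarrow> bit (part p (idx Z)) w = bit (part p (idx Y)) w) \<longleftrightarrow>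
    (\<forall>r\<in>R. r \<notin> set rs \<longrightarrow> ((p, r) \<in> Z \<longleftrightarrow> (p, r) \<in> Y))" (is "?L \<longleftrightarrow> ?R")
proof
  assume ?L
  show ?R
  proof (intro ballI impI)
    fix r assume r: "r \<in> R" "r \<notin> set rs"
    then have "pos r < n" "pos r \<notin> set (map pos rs)" using assms(3) pos_less pos_inj by auto
    then show "(p, r) \<in> Z \<longleftrightarrow> (p, r) \<in> Y" using \<open>?L\<close> bit_part[OF assms(1) r(1), of p] bit_part[OF assms(2) r(1), of p] by blast
  qed
next
  assume ?R
  show ?L
  proof (intro allI impI)
    fix w assume w: "w < n" "w \<notin> set (map pos rs)"
    then obtain r where r: "r \<in> R" "w = pos r" using pos_surj by blast
    then show "bit (part p (idx Z)) w = bit (part p (idx Y)) w"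
      using \<open>?R\<close> w bit_part[OF assms(1) r(1), of p] bit_part[OF assms(2) r(1), of p] by auto
  qed
qed

lemma part_eq_iff:
  assumes "Z \<subseteq> wires" "Y \<subseteq> wires"
  shows "part p (idx Z) = part p (idx Y) \<longleftrightarrow> (\<forall>r\<in>R. (p, r) \<in> Z \<longleftrightarrow> (p, r) \<in> Y)"
  using agree_iff[OF assms, of "[]" p] bits_eqI[OF part_less[OF assms(1), of p] part_less[OF assms(2), of p]] by auto

lemma set_eq_iff_parts:
  assumes "Z \<subseteq> wires" "Y \<subseteq> wires"
  shows "Z = Y \<longleftrightarrow> (\<forall>p. \<forall>r\<in>R. (p, r) \<in> Z \<longleftrightarrow> (p, r) \<in> Y)"
  using assms by (auto simp: wires_def)

definition val :: "party \<Rightarrow> 'r list \<Rightarrow> (party \<times> 'r) set \<Rightarrow> nat" where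
  "val p rs Z = horner_sum of_bool 2 (map (\<lambda>r. (p, r) \<in> Z) rs)"

lemma wires_val_part: "Z \<subseteq> wires \<Longrightarrow> set rs \<subseteq> R \<Longrightarrow> wires_val (map pos rs) (part p (idx Z)) = val p rs Z"
  unfolding wires_val_def val_def map_map comp_def
  by (intro arg_cong[where f = "horner_sum of_bool 2"] map_cong refl) (auto simp: bit_part subset_iff)

lemma lift_gate_part:
  assumes "Z \<subseteq> wires" "Y \<subseteq> wires" "set rs \<subseteq> R"
  shows "lift_gate n (map pos rs) U $$ (part p (idx Z), part p (idx Y)) =
    (if \<forall>r\<in>R. r \<notin> set rs \<longrightarrow> ((p, r) \<in> Z \<longleftrightarrow> (p, r) \<in> Y) then U $$ (val p rs Z, val p rs Y) else 0)"
  unfolding agree_iff[OF assms, symmetric] wires_val_part[OF assms(1,3), symmetric] wires_val_part[OF assms(2,3), symmetric]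
  using part_less[OF assms(1), of p] part_less[OF assms(2), of p] by (simp add: lift_gate_def)

lemma one_part:
  assumes "Z \<subseteq> wires" "Y \<subseteq> wires"
  shows "1\<^sub>m (2 ^ n) $$ (part p (idx Z), part p (idx Y)) = of_bool (\<forall>r\<in>R. (p, r) \<in> Z \<longleftrightarrow> (p, r) \<in> Y)"
  using part_less part_eq_iff[OF assms, of p] assms by auto

lemma wire_proj_part:
  assumes "Z \<subseteq> wires" "Y \<subseteq> wires" "r \<in> R"
  shows "wire_proj n (pos r) c $$ (part p (idx Z), part p (idx Y)) =
    of_bool ((\<forall>r\<in>R. (p, r) \<in> Z \<longleftrightarrow> (p, r) \<in> Y) \<and> ((p, r) \<in> Y) = c)"
  using part_less part_eq_iff[OF assms(1,2), of p] bit_part[OF assms(2,3), of p] assms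
  by (auto simp: wire_proj_eq_pmat)

lemma kron_idx:
  assumes "Z \<subseteq> wires" "Y \<subseteq> wires" "A \<in> carrier_mat (2 ^ n) (2 ^ n)" "B \<in> carrier_mat (2 ^ n) (2 ^ n)"
  shows "kron A B $$ (idx Z, idx Y) =
    A $$ (part Alice (idx Z), part Alice (idx Y)) * B $$ (part Bob (idx Z), part Bob (idx Y))"
  using idx_less assms by (auto simp: part_def)

text \<open>The identity on the other register adds all its wires to those on which ket and bra
  index must agree.\<close>

lemma local_gate_idx:
  assumes "Z \<subseteq> wires" "Y \<subseteq> wires" "set rs \<subseteq> R"
  shows "local_op p (2 ^ n) (2 ^ n) (lift_gate n (map pos rs) U) $$ (idx Z, idx Y) =
    (if \<forall>v\<in>wires. v \<notin> {p} \<times> set rs \<longrightarrow> (v \<in> Z \<longleftrightarrow> v \<in> Y) then U $$ (val p rs Z, val p rs Y) else 0)"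
proof (cases p)
  case Alice
  then show ?thesis
    unfolding local_op_def using assms
    by (simp add: kron_idx lift_gate_part one_part wires_def all_party) blast
next
  case Bob
  then show ?thesis
    unfolding local_op_def using assms
    by (simp add: kron_idx lift_gate_part one_part wires_def all_party) blast
qed

subsection \<open>Kernels\<close>

text \<open>The expectation of an observable whose transposed matrix is \<chi>. Working with \<chi>
  instead of the state turns the run of the circuit into substitutions in a function of two
  sets.\<close>

definition pairing :: "((party \<times> 'r) set \<Rightarrow> (party \<times> 'r) set \<Rightarrow> complex) \<Rightarrow> complex mat \<Rightarrow> complex" where
  "pairing \<chi> \<omega> = (\<Sum>Z\<in>Pow wires. \<Sum>Y\<in>Pow wires. \<chi> Z Y * \<omega> $$ (idx Z, idx Y))"

lemma pairing_cong:
  "(\<And>Z Y. Z \<subseteq> wires \<Longrightarrow> Y \<subseteq> wires \<Longrightarrow> \<chi> Z Y = \<chi>' Z Y) \<Longrightarrow> pairing \<chi> \<omega> = pairing \<chi>' \<omega>"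
  unfolding pairing_def by (intro sum.cong refl) auto

lemma pairing_add:
  assumes "\<omega> \<in> carrier_mat (2 ^ n * 2 ^ n) (2 ^ n * 2 ^ n)" "\<omega>' \<in> carrier_mat (2 ^ n * 2 ^ n) (2 ^ n * 2 ^ n)"
  shows "pairing \<chi> (\<omega> + \<omega>') = pairing \<chi> \<omega> + pairing \<chi> \<omega>'"
  unfolding pairing_def sum.distrib[symmetric] using assms idx_less
  by (intro sum.cong refl) (auto simp: distrib_left)

lemma pairing_sandwich:
  assumes E: "E \<in> carrier_mat (2 ^ n * 2 ^ n) c" and \<omega>: "\<omega> \<in> carrier_mat c c"
  shows "pairing \<chi> (sandwich E \<omega>) = (\<Sum>k<c. \<Sum>l<c.
    (\<Sum>Z\<in>Pow wires. \<Sum>Y\<in>Pow wires. \<chi> Z Y * (E $$ (idx Z, k) * cnj (E $$ (idx Y, l)))) * \<omega> $$ (k, l))"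
proof -
  have "pairing \<chi> (sandwich E \<omega>) = (\<Sum>(Z, Y)\<in>Pow wires \<times> Pow wires. \<Sum>(k, l)\<in>{..<c} \<times> {..<c}.
      \<chi> Z Y * (E $$ (idx Z, k) * cnj (E $$ (idx Y, l))) * \<omega> $$ (k, l))"
    unfolding pairing_def sum.cartesian_product[symmetric]
    by (intro sum.cong refl) (auto simp: sandwich_index[OF E \<omega>] idx_less sum_distrib_left mult_ac)
  also have "\<dots> = (\<Sum>(k, l)\<in>{..<c} \<times> {..<c}. \<Sum>(Z, Y)\<in>Pow wires \<times> Pow wires.
      \<chi> Z Y * (E $$ (idx Z, k) * cnj (E $$ (idx Y, l))) * \<omega> $$ (k, l))"
    unfolding case_prod_unfold by (rule sum.swap)
  finally show ?thesis
    by (simp add: sum.cartesian_product[symmetric] sum_distrib_right)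
qed

text \<open>The dual action of a Kraus operator on observables.\<close>

lemma pairing_sandwich_square:
  assumes E: "E \<in> carrier_mat (2 ^ n * 2 ^ n) (2 ^ n * 2 ^ n)" and \<omega>: "\<omega> \<in> carrier_mat (2 ^ n * 2 ^ n) (2 ^ n * 2 ^ n)"
  shows "pairing \<chi> (sandwich E \<omega>) =
    pairing (\<lambda>Z' Y'. \<Sum>Z\<in>Pow wires. \<Sum>Y\<in>Pow wires. \<chi> Z Y * (E $$ (idx Z, idx Z') * cnj (E $$ (idx Y, idx Y')))) \<omega>"
  unfolding pairing_sandwich[OF E \<omega>] pairing_def[of _ \<omega>]
  by (simp flip: sum.reindex_bij_betw[OF idx_bij] power_add)

text \<open>An operator that sends the basis states in \<open>P\<close> to basis states and kills
  the others. Dually, the kernel is composed with \<open>g\<close> and both of its arguments are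
  restricted to \<open>P\<close>.\<close>

lemma pairing_map:
  assumes E: "E \<in> carrier_mat (2 ^ n * 2 ^ n) (2 ^ n * 2 ^ n)" and \<omega>: "\<omega> \<in> carrier_mat (2 ^ n * 2 ^ n) (2 ^ n * 2 ^ n)"
    and g: "\<And>Y. Y \<subseteq> wires \<Longrightarrow> g Y \<subseteq> wires"
    and entry: "\<And>Z Y. Z \<subseteq> wires \<Longrightarrow> Y \<subseteq> wires \<Longrightarrow> E $$ (idx Z, idx Y) = of_bool (P Y \<and> Z = g Y)"
  shows "pairing \<chi> (sandwich E \<omega>) = pairing (\<lambda>Z Y. of_bool (P Z \<and> P Y) * \<chi> (g Z) (g Y)) \<omega>"
  unfolding pairing_sandwich_square[OF E \<omega>]
proof (rule pairing_cong)
  fix Z' Y' assume Z': "Z' \<subseteq> wires" and Y': "Y' \<subseteq> wires"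
  have "(\<Sum>Z\<in>Pow wires. \<Sum>Y\<in>Pow wires. \<chi> Z Y * (E $$ (idx Z, idx Z') * cnj (E $$ (idx Y, idx Y')))) =
    (\<Sum>Z\<in>Pow wires. \<Sum>Y\<in>Pow wires. if Y = g Y' then (if Z = g Z' then of_bool (P Z' \<and> P Y') * \<chi> Z Y else 0) else 0)"
    using Z' Y' by (intro sum.cong refl) (simp add: entry)
  also have "\<dots> = (\<Sum>Z\<in>Pow wires. if Z = g Z' then of_bool (P Z' \<and> P Y') * \<chi> Z (g Y') else 0)"
    using g[OF Y'] by (intro sum.cong refl, subst sum.delta) auto
  also have "\<dots> = of_bool (P Z' \<and> P Y') * \<chi> (g Z') (g Y')"
    using g[OF Z'] by (subst sum.delta) auto
  finally show "(\<Sum>Z\<in>Pow wires. \<Sum>Y\<in>Pow wires. \<chi> Z Y * (E $$ (idx Z, idx Z') * cnj (E $$ (idx Y, idx Y')))) =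
    of_bool (P Z' \<and> P Y') * \<chi> (g Z') (g Y')" .
qed

abbreviation step :: "instruction \<Rightarrow> complex mat \<Rightarrow> complex mat" where
  "step s \<equiv> apply_kraus (2 ^ n * 2 ^ n) (instruction_kraus n n s)"

lemma step_carrier: "step s \<omega> \<in> carrier_mat (2 ^ n * 2 ^ n) (2 ^ n * 2 ^ n)"
  by (rule apply_kraus_carrier[OF instruction_kraus_carrier])

lemma step_gate:
  "step (Gate p ws U) \<omega> = sandwich (local_op p (2 ^ n) (2 ^ n) (lift_gate n ws U)) \<omega>"
    and local_op_gate_carrier: "local_op p (2 ^ n) (2 ^ n) (lift_gate n ws U) \<in> carrier_mat (2 ^ n * 2 ^ n) (2 ^ n * 2 ^ n)"
proof -
  show car: "local_op p (2 ^ n) (2 ^ n) (lift_gate n ws U) \<in> carrier_mat (2 ^ n * 2 ^ n) (2 ^ n * 2 ^ n)"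
    by (cases p) (auto simp: local_op_def intro!: kron_carrier)
  show "step (Gate p ws U) \<omega> = sandwich (local_op p (2 ^ n) (2 ^ n) (lift_gate n ws U)) \<omega>"
    using sandwich_carrier[OF car, of \<omega>] by (cases p) (auto simp: apply_kraus_def)
qed

lemma toggle_wires: "w \<in> wires \<Longrightarrow> Y \<subseteq> wires \<Longrightarrow> toggle c w Y \<subseteq> wires"
  unfolding toggle_def by blast

lemma pairing_controlled_flip:
  fixes f :: "bool \<Rightarrow> bool \<Rightarrow> bool" and p :: party
  assumes r: "distinct [r\<^sub>1, r\<^sub>2, r\<^sub>3]" "{r\<^sub>1, r\<^sub>2, r\<^sub>3} \<subseteq> R" and \<omega>: "\<omega> \<in> carrier_mat (2 ^ n * 2 ^ n) (2 ^ n * 2 ^ n)"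
  defines "g \<equiv> \<lambda>Y. toggle (f ((p, r\<^sub>1) \<in> Y) ((p, r\<^sub>2) \<in> Y)) (p, r\<^sub>3) Y"
  shows "pairing \<chi> (step (Gate p (map pos [r\<^sub>1, r\<^sub>2, r\<^sub>3]) (controlled_flip f)) \<omega>) =
    pairing (\<lambda>Z Y. \<chi> (g Z) (g Y)) \<omega>"
proof -
  have entry: "local_op p (2 ^ n) (2 ^ n) (lift_gate n (map pos [r\<^sub>1, r\<^sub>2, r\<^sub>3]) (controlled_flip f)) $$ (idx Z, idx Y) =
    of_bool (True \<and> Z = g Y)" if Z: "Z \<subseteq> wires" and Y: "Y \<subseteq> wires" for Z Y
  proof -
    have v: "val p [r\<^sub>1, r\<^sub>2, r\<^sub>3] Z = of_bool ((p, r\<^sub>1) \<in> Z) + 2 * (of_bool ((p, r\<^sub>2) \<in> Z) + 2 * of_bool ((p, r\<^sub>3) \<in> Z))" for Z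
      by (simp add: val_def)
    have "controlled_flip f $$ (val p [r\<^sub>1, r\<^sub>2, r\<^sub>3] Z, val p [r\<^sub>1, r\<^sub>2, r\<^sub>3] Y) =
      of_bool (((p, r\<^sub>1) \<in> Z \<longleftrightarrow> (p, r\<^sub>1) \<in> Y) \<and> ((p, r\<^sub>2) \<in> Z \<longleftrightarrow> (p, r\<^sub>2) \<in> Y) \<and>
        ((p, r\<^sub>3) \<in> Z) = (((p, r\<^sub>3) \<in> Y) \<noteq> f ((p, r\<^sub>1) \<in> Y) ((p, r\<^sub>2) \<in> Y)))"
      unfolding v controlled_flip_def by (auto split: if_splits)
    moreover have "Z = g Y \<longleftrightarrow> (\<forall>v\<in>wires. v \<notin> {p} \<times> set [r\<^sub>1, r\<^sub>2, r\<^sub>3] \<longrightarrow> (v \<in> Z \<longleftrightarrow> v \<in> Y)) \<and>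
      ((p, r\<^sub>1) \<in> Z \<longleftrightarrow> (p, r\<^sub>1) \<in> Y) \<and> ((p, r\<^sub>2) \<in> Z \<longleftrightarrow> (p, r\<^sub>2) \<in> Y) \<and>
        ((p, r\<^sub>3) \<in> Z) = (((p, r\<^sub>3) \<in> Y) \<noteq> f ((p, r\<^sub>1) \<in> Y) ((p, r\<^sub>2) \<in> Y))" (is "_ \<longleftrightarrow> ?R")
    proof
      assume "Z = g Y"
      then show ?R using r by (auto simp: g_def in_toggle)
    next
      assume ?R
      have "v \<in> Z \<longleftrightarrow> v \<in> g Y" if "v \<in> wires" for v
        using \<open>?R\<close> that r by (cases "v \<in> {p} \<times> set [r\<^sub>1, r\<^sub>2, r\<^sub>3]") (auto simp: g_def in_toggle)
      moreover have "g Y \<subseteq> wires"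
        using toggle_wires[of "(p, r\<^sub>3)" Y] r(2) Y by (simp add: g_def)
      ultimately show "Z = g Y" using Z by blast
    qed
    ultimately show ?thesis
      using r(2) by (subst local_gate_idx[OF Z Y]) auto
  qed
  have "g Y \<subseteq> wires" if "Y \<subseteq> wires" for Y
    using toggle_wires[of "(p, r\<^sub>3)" Y] r(2) that by (auto simp: g_def)
  from pairing_map[OF local_op_gate_carrier \<omega> this entry] show ?thesis
    unfolding step_gate by simp
qed

text \<open>The measurement dephases the sent wire: pairs of states that differ there contribute
  nothing. For the remaining pairs both outcomes are described by one flip that is controlled by the
  sent bit.\<close>

lemma pairing_send:
  fixes p q :: party
  assumes r: "r \<in> R" "r' \<in> R" and \<omega>: "\<omega> \<in> carrier_mat (2 ^ n * 2 ^ n) (2 ^ n * 2 ^ n)"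
    and q: "p \<noteq> q"
  defines "g \<equiv> \<lambda>Y. toggle ((p, r) \<in> Y) (q, r') Y"
  shows "pairing \<chi> (step (Send p (pos r) (pos r')) \<omega>) =
    pairing (\<lambda>Z Y. of_bool ((p, r) \<in> Z \<longleftrightarrow> (p, r) \<in> Y) * \<chi> (g Z) (g Y)) \<omega>"
proof -
  define E where "E = (case p of Alice \<Rightarrow> kron (wire_proj n (pos r) False) (1\<^sub>m (2 ^ n))
    | Bob \<Rightarrow> kron (1\<^sub>m (2 ^ n)) (wire_proj n (pos r) False))"
  define F where "F = (case p of Alice \<Rightarrow> kron (wire_proj n (pos r) True) (lift_gate n [pos r'] pauli_X)
    | Bob \<Rightarrow> kron (lift_gate n [pos r'] pauli_X) (wire_proj n (pos r) True))"
  have car: "E \<in> carrier_mat (2 ^ n * 2 ^ n) (2 ^ n * 2 ^ n)" "F \<in> carrier_mat (2 ^ n * 2 ^ n) (2 ^ n * 2 ^ n)"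
    by (cases p; auto simp: E_def F_def intro!: kron_carrier)+
  note sc = sandwich_carrier[OF car(1), of \<omega>] sandwich_carrier[OF car(2), of \<omega>]
  have "instruction_kraus n n (Send p (pos r) (pos r')) = [E, F]"
    by (cases p) (auto simp: E_def F_def)
  then have st: "step (Send p (pos r) (pos r')) \<omega> = sandwich E \<omega> + sandwich F \<omega>"
    using sc by (simp add: apply_kraus_def)
  have X: "pauli_X $$ (val u [r'] Z, val u [r'] Y) = of_bool (((u, r') \<in> Z) \<noteq> ((u, r') \<in> Y))" for u Z Y
    by (auto simp: val_def pauli_X_def)
  have g: "g Y \<subseteq> wires" if "Y \<subseteq> wires" for Y
    using toggle_wires[of "(q, r')" Y] r(2) that by (auto simp: g_def)
  have eE: "E $$ (idx Z, idx Y) = of_bool ((p, r) \<notin> Y \<and> Z = Y)" if "Z \<subseteq> wires" "Y \<subseteq> wires" for Z Y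
    using that r by (cases p) (auto simp: E_def kron_idx wire_proj_part one_part set_eq_iff_parts[OF that] all_party)
  have eF: "F $$ (idx Z, idx Y) = of_bool ((p, r) \<in> Y \<and> Z = g Y)" if Z: "Z \<subseteq> wires" and Y: "Y \<subseteq> wires" for Z Y
  proof -
    have r'': "set [r'] \<subseteq> R" using r by auto
    show ?thesis
    proof (cases "(p, r) \<in> Y")
      case True
      have gg: "Z = g Y \<longleftrightarrow> (\<forall>u\<in>R. (p, u) \<in> Z \<longleftrightarrow> (p, u) \<in> Y) \<and> (\<forall>u\<in>R. u \<noteq> r' \<longrightarrow> ((q, u) \<in> Z \<longleftrightarrow> (q, u) \<in> Y)) \<and>
          ((q, r') \<in> Z) \<noteq> ((q, r') \<in> Y)"
        unfolding set_eq_iff_parts[OF Z g[OF Y]] using True q r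
        by (cases p; cases q) (auto simp: all_party g_def in_toggle)
      show ?thesis
        unfolding gg using True q r Z Y lift_gate_part[OF Z Y r'', of pauli_X]
        by (cases p; cases q) (auto simp: F_def kron_idx wire_proj_part X)
    next
      case False
      then show ?thesis using that r
        by (cases p) (auto simp: F_def kron_idx wire_proj_part)
    qed
  qed
  have "pairing \<chi> (step (Send p (pos r) (pos r')) \<omega>) =
    pairing (\<lambda>Z Y. of_bool ((p, r) \<notin> Z \<and> (p, r) \<notin> Y) * \<chi> Z Y) \<omega> +
    pairing (\<lambda>Z Y. of_bool ((p, r) \<in> Z \<and> (p, r) \<in> Y) * \<chi> (g Z) (g Y)) \<omega>"
    unfolding st pairing_add[OF sc]
    by (intro arg_cong2[where f = "(+)"] pairing_map[OF car(1) \<omega> _ eE] pairing_map[OF car(2) \<omega> g eF])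
  \<comment> \<open>Outcome 0 fits into the second form because \<open>g\<close> is the identity
    when the sent bit is 0.\<close>
  also have "\<dots> = pairing (\<lambda>Z Y. of_bool ((p, r) \<in> Z \<longleftrightarrow> (p, r) \<in> Y) * \<chi> (g Z) (g Y)) \<omega>"
    unfolding pairing_def sum.distrib[symmetric]
    by (intro sum.cong refl) (auto simp: g_def toggle_def)
  finally show ?thesis .
qed

text \<open>\<open>Z\<close> and \<open>Y\<close> are the states before the Hadamard gates on
  \<open>W\<close>, while \<open>C\<close> and \<open>D\<close> are the values of \<open>W\<close>
  afterwards. Ket and bra each contribute a factor \<open>1 / sqrt 2\<close> per wire, whence the
  denominator.\<close>

definition hadamard_kernel ::
  "(party \<times> 'r) set \<Rightarrow> ((party \<times> 'r) set \<Rightarrow> (party \<times> 'r) set \<Rightarrow> complex) \<Rightarrow> (party \<times> 'r) set \<Rightarrow> (party \<times> 'r) set \<Rightarrow> complex" where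
  "hadamard_kernel W \<chi> Z Y = (\<Sum>C\<in>Pow W. \<Sum>D\<in>Pow W.
     (- 1) ^ (card (C \<inter> Z) + card (D \<inter> Y)) * \<chi> (Z - W \<union> C) (Y - W \<union> D)) / 2 ^ card W"

lemma pairing_hadamard:
  assumes r: "r \<in> R" and \<omega>: "\<omega> \<in> carrier_mat (2 ^ n * 2 ^ n) (2 ^ n * 2 ^ n)"
  shows "pairing \<chi> (step (Gate p [pos r] hadamard) \<omega>) = pairing (hadamard_kernel {(p, r)} \<chi>) \<omega>"
proof -
  let ?E = "local_op p (2 ^ n) (2 ^ n) (lift_gate n [pos r] hadamard)"
  let ?W = "{(p, r)}"
  have half: "complex_of_real (sqrt 2) * complex_of_real (sqrt 2) = 2"
    by (simp flip: of_real_mult)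
  have entry: "?E $$ (idx Z, idx Y) = (if Z - ?W = Y - ?W then (- 1) ^ card (?W \<inter> Z \<inter> Y) / complex_of_real (sqrt 2) else 0)"
    if Z: "Z \<subseteq> wires" and Y: "Y \<subseteq> wires" for Z Y
  proof -
    have "(\<forall>v\<in>wires. v \<notin> {p} \<times> set [r] \<longrightarrow> (v \<in> Z \<longleftrightarrow> v \<in> Y)) \<longleftrightarrow> Z - ?W = Y - ?W"
      using Z Y by auto
    moreover have "hadamard $$ (val p [r] Z, val p [r] Y) = (- 1) ^ card (?W \<inter> Z \<inter> Y) / complex_of_real (sqrt 2)"
      by (auto simp: val_def hadamard_def)
    moreover have "set [r] \<subseteq> R" using r by auto
    ultimately show ?thesis using local_gate_idx[OF Z Y, of "[r]" p hadamard] by auto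
  qed
  have col: "(\<Sum>Z\<in>Pow wires. \<chi>' Z * ?E $$ (idx Z, idx Y)) =
      (\<Sum>C\<in>Pow ?W. (- 1) ^ card (C \<inter> Y) * \<chi>' (Y - ?W \<union> C)) / complex_of_real (sqrt 2)" if Y: "Y \<subseteq> wires" for Y \<chi>'
  proof -
    have "(\<Sum>Z\<in>Pow wires. \<chi>' Z * ?E $$ (idx Z, idx Y)) =
      (\<Sum>Z\<in>{Z \<in> Pow wires. Z - ?W = Y - ?W}. \<chi>' Z * (- 1) ^ card (?W \<inter> Z \<inter> Y) / complex_of_real (sqrt 2))"
      using Y by (intro sum.mono_neutral_cong_right) (auto simp: entry)
    also have "\<dots> = (\<Sum>C\<in>Pow ?W. (- 1) ^ card (C \<inter> Y) * \<chi>' (Y - ?W \<union> C) / complex_of_real (sqrt 2))"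
      by (rule sum.reindex_bij_witness[of _ "\<lambda>C. Y - ?W \<union> C" "\<lambda>Z. Z \<inter> ?W"])
        (use Y r in \<open>auto simp: Int_commute Int_left_commute mult.commute intro!: arg_cong[where f = \<chi>']\<close>)
    finally show ?thesis by (simp add: sum_divide_distrib)
  qed
  have cE: "cnj (?E $$ (idx Z, idx Y)) = ?E $$ (idx Z, idx Y)" if "Z \<subseteq> wires" "Y \<subseteq> wires" for Z Y
    using entry[OF that] by simp
  show ?thesis
    unfolding step_gate pairing_sandwich_square[OF local_op_gate_carrier \<omega>]
  proof (rule pairing_cong)
    fix Z' Y' assume Z': "Z' \<subseteq> wires" and Y': "Y' \<subseteq> wires"
    have "(\<Sum>Z\<in>Pow wires. \<Sum>Y\<in>Pow wires. \<chi> Z Y * (?E $$ (idx Z, idx Z') * cnj (?E $$ (idx Y, idx Y')))) =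
      (\<Sum>Z\<in>Pow wires. (\<Sum>Y\<in>Pow wires. \<chi> Z Y * ?E $$ (idx Y, idx Y')) * ?E $$ (idx Z, idx Z'))"
      using Y' by (intro sum.cong refl) (auto simp: cE sum_distrib_left sum_distrib_right mult_ac)
    also have "\<dots> = hadamard_kernel ?W \<chi> Z' Y'"
      unfolding col[OF Y'] col[OF Z'] hadamard_kernel_def
      by (simp add: sum_divide_distrib sum_distrib_left power_add mult_ac half)
    finally show "(\<Sum>Z\<in>Pow wires. \<Sum>Y\<in>Pow wires. \<chi> Z Y * (?E $$ (idx Z, idx Z') * cnj (?E $$ (idx Y, idx Y')))) =
      hadamard_kernel ?W \<chi> Z' Y'" .
  qed
qed

text \<open>On disjoint wire sets the sign exponents add and the substitutions commute, so gates
  applied one after the other act as one joint transform.\<close>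

lemma hadamard_kernel_Un:
  assumes "finite V" "finite W" "V \<inter> W = {}"
  shows "hadamard_kernel V (hadamard_kernel W \<chi>) Z Y = hadamard_kernel (V \<union> W) \<chi> Z Y"
proof -
  have eq: "(- 1) ^ (card ((C \<union> C') \<inter> Z) + card ((D \<union> D') \<inter> Y)) * \<chi> (Z - (V \<union> W) \<union> (C \<union> C')) (Y - (V \<union> W) \<union> (D \<union> D')) =
      (- 1) ^ (card (C \<inter> Z) + card (D \<inter> Y)) * ((- 1) ^ (card (C' \<inter> (Z - V \<union> C)) + card (D' \<inter> (Y - V \<union> D))) *
        \<chi> (Z - V \<union> C - W \<union> C') (Y - V \<union> D - W \<union> D'))"
    if "C \<subseteq> V" "C' \<subseteq> W" "D \<subseteq> V" "D' \<subseteq> W" for C C' D D'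
  proof -
    have fin: "finite C" "finite C'" "finite D" "finite D'"
      using that assms finite_subset by blast+
    have "card ((C \<union> C') \<inter> Z) = card (C \<inter> Z) + card (C' \<inter> (Z - V \<union> C))"
      using that assms fin by (subst card_Un_disjoint[symmetric]) (auto intro!: arg_cong[where f = card])
    moreover have "card ((D \<union> D') \<inter> Y) = card (D \<inter> Y) + card (D' \<inter> (Y - V \<union> D))"
      using that assms fin by (subst card_Un_disjoint[symmetric]) (auto intro!: arg_cong[where f = card])
    moreover have "Z - (V \<union> W) \<union> (C \<union> C') = Z - V \<union> C - W \<union> C'" "Y - (V \<union> W) \<union> (D \<union> D') = Y - V \<union> D - W \<union> D'"
      using that assms by auto
    ultimately show ?thesis by (simp add: power_add)
  qed
  have "(\<Sum>C\<in>Pow (V \<union> W). \<Sum>D\<in>Pow (V \<union> W). (- 1) ^ (card (C \<inter> Z) + card (D \<inter> Y)) * \<chi> (Z - (V \<union> W) \<union> C) (Y - (V \<union> W) \<union> D)) =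
    (\<Sum>C\<in>Pow V. \<Sum>C'\<in>Pow W. \<Sum>D\<in>Pow V. \<Sum>D'\<in>Pow W.
      (- 1) ^ (card (C \<inter> Z) + card (D \<inter> Y)) * ((- 1) ^ (card (C' \<inter> (Z - V \<union> C)) + card (D' \<inter> (Y - V \<union> D))) *
        \<chi> (Z - V \<union> C - W \<union> C') (Y - V \<union> D - W \<union> D')))"
    unfolding sum_Pow_Un[OF assms(3)] by (intro sum.cong refl eq) auto
  also have "\<dots> = (\<Sum>C\<in>Pow V. \<Sum>D\<in>Pow V. \<Sum>C'\<in>Pow W. \<Sum>D'\<in>Pow W.
      (- 1) ^ (card (C \<inter> Z) + card (D \<inter> Y)) * ((- 1) ^ (card (C' \<inter> (Z - V \<union> C)) + card (D' \<inter> (Y - V \<union> D))) *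
        \<chi> (Z - V \<union> C - W \<union> C') (Y - V \<union> D - W \<union> D')))"
    by (intro sum.cong refl sum.swap)
  finally show ?thesis
    using assms by (simp add: hadamard_kernel_def card_Un_disjoint power_add sum_divide_distrib sum_distrib_left mult_ac)
qed

lemma hadamard_kernel_empty: "hadamard_kernel {} \<chi> Z Y = \<chi> Z Y"
  by (simp add: hadamard_kernel_def)

lemma pairing_hadamards:
  assumes "distinct vs" "set vs \<subseteq> wires" "\<omega> \<in> carrier_mat (2 ^ n * 2 ^ n) (2 ^ n * 2 ^ n)"
  shows "pairing \<chi> (fold step (map (\<lambda>(p, r). Gate p [pos r] hadamard) vs) \<omega>) = pairing (hadamard_kernel (set vs) \<chi>) \<omega>"
  using assms
proof (induction vs arbitrary: \<omega>)
  case Nil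
  then show ?case by (simp add: hadamard_kernel_empty[abs_def])
next
  case (Cons v vs)
  obtain p r where v: "v = (p, r)" by fastforce
  have "pairing \<chi> (fold step (map (\<lambda>(p, r). Gate p [pos r] hadamard) (v # vs)) \<omega>) =
    pairing (hadamard_kernel (set vs) \<chi>) (step (Gate p [pos r] hadamard) \<omega>)"
    using Cons.IH[OF _ _ step_carrier] Cons.prems v by (simp del: instruction_kraus.simps)
  also have "\<dots> = pairing (hadamard_kernel {(p, r)} (hadamard_kernel (set vs) \<chi>)) \<omega>"
    using Cons.prems v by (intro pairing_hadamard) auto
  also have "\<dots> = pairing (hadamard_kernel (set (v # vs)) \<chi>) \<omega>"
    using Cons.prems v by (intro pairing_cong) (subst hadamard_kernel_Un, auto)
  finally show ?case .
qed

text \<open>Step \<open>i\<close> dephases the wires \<open>S i\<close> and flips wire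
  \<open>w i\<close> under condition \<open>c i\<close>. The two states are compared at the time of
  each step, hence the evolved arguments in the recursion.\<close>

fun agree :: "('i \<Rightarrow> (party \<times> 'r) set \<Rightarrow> bool) \<Rightarrow> ('i \<Rightarrow> party \<times> 'r) \<Rightarrow> ('i \<Rightarrow> (party \<times> 'r) set) \<Rightarrow>
    'i list \<Rightarrow> (party \<times> 'r) set \<Rightarrow> (party \<times> 'r) set \<Rightarrow> bool" where
  "agree c w S [] Z Y \<longleftrightarrow> True"
| "agree c w S (i # is) Z Y \<longleftrightarrow> (\<forall>v\<in>S i. v \<in> Z \<longleftrightarrow> v \<in> Y) \<and>
     agree c w S is (toggle (c i Z) (w i) Z) (toggle (c i Y) (w i) Y)"

lemma pairing_classical:
  assumes "\<And>i \<chi> \<omega>. i \<in> set is \<Longrightarrow> \<omega> \<in> carrier_mat (2 ^ n * 2 ^ n) (2 ^ n * 2 ^ n) \<Longrightarrow>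
      pairing \<chi> (step (s i) \<omega>) = pairing (\<lambda>Z Y. of_bool (\<forall>v\<in>S i. v \<in> Z \<longleftrightarrow> v \<in> Y) *
        \<chi> (toggle (c i Z) (w i) Z) (toggle (c i Y) (w i) Y)) \<omega>"
    and "\<omega> \<in> carrier_mat (2 ^ n * 2 ^ n) (2 ^ n * 2 ^ n)"
  shows "pairing \<chi> (fold step (map s is) \<omega>) = pairing (\<lambda>Z Y. of_bool (agree c w S is Z Y) *
    \<chi> (fold (\<lambda>i Z. toggle (c i Z) (w i) Z) is Z) (fold (\<lambda>i Z. toggle (c i Z) (w i) Z) is Y)) \<omega>"
  using assms
proof (induction "is" arbitrary: \<omega>)
  case (Cons i "is")
  have "pairing \<chi> (fold step (map s (i # is)) \<omega>) = pairing (\<lambda>Z Y. of_bool (agree c w S is Z Y) *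
    \<chi> (fold (\<lambda>i Z. toggle (c i Z) (w i) Z) is Z) (fold (\<lambda>i Z. toggle (c i Z) (w i) Z) is Y)) (step (s i) \<omega>)"
    using Cons.IH[OF Cons.prems(1) step_carrier] by simp
  also have "\<dots> = pairing (\<lambda>Z Y. of_bool (agree c w S (i # is) Z Y) *
    \<chi> (fold (\<lambda>i Z. toggle (c i Z) (w i) Z) (i # is) Z) (fold (\<lambda>i Z. toggle (c i Z) (w i) Z) (i # is) Y)) \<omega>"
    unfolding Cons.prems(1)[OF list.set_intros(1) Cons.prems(2)] by (intro pairing_cong) auto
  finally show ?case .
qed simp

text \<open>No flipped wire is ever dephased, so the comparisons can be made on the initial
  states.\<close>

lemma agree_iff_all:
  assumes "\<And>i j. i \<in> set is \<Longrightarrow> j \<in> set is \<Longrightarrow> w i \<notin> S j"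
  shows "agree c w S is Z Y \<longleftrightarrow> (\<forall>i\<in>set is. \<forall>v\<in>S i. v \<in> Z \<longleftrightarrow> v \<in> Y)"
  using assms
proof (induction "is" arbitrary: Z Y)
  case (Cons i "is")
  have "v \<in> toggle b (w i) Z \<longleftrightarrow> v \<in> Z" if "j \<in> set is" "v \<in> S j" for v j b Z
    using Cons.prems[of i j] that by (auto simp: in_toggle)
  then show ?case using Cons.IH Cons.prems by auto
qed simp

end

text \<open>No step alters the condition of a step, so all conditions can be read off the initial
  state and a wire is flipped once for each active step aimed at it.\<close>

lemma fold_toggle:
  assumes "distinct is" "\<And>i j b Z. i \<in> set is \<Longrightarrow> j \<in> set is \<Longrightarrow> c j (toggle b (w i) Z) = c j Z"
  shows "v \<in> fold (\<lambda>i Z. toggle (c i Z) (w i) Z) is Z \<longleftrightarrow> (v \<in> Z) \<noteq> odd (card {i \<in> set is. w i = v \<and> c i Z})"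
  using assms
proof (induction "is" arbitrary: Z)
  case (Cons i "is")
  have "{j \<in> set is. w j = v \<and> c j (toggle (c i Z) (w i) Z)} = {j \<in> set is. w j = v \<and> c j Z}"
    using Cons.prems(2) by auto
  moreover have "{j \<in> set (i # is). w j = v \<and> c j Z} =
    (if w i = v \<and> c i Z then insert i {j \<in> set is. w j = v \<and> c j Z} else {j \<in> set is. w j = v \<and> c j Z})"
    by auto
  ultimately show ?case
    using Cons.IH[of "toggle (c i Z) (w i) Z"] Cons.prems by (auto simp: in_toggle)
qed simp

subsection \<open>The hashing circuit\<close>

text \<open>\<open>Dat\<close> holds the noisy qubits, \<open>Eb j\<close> a half of the EPR pair
  number j, and \<open>Key\<close> the binary index of the untouched maximally entangled factor.
  \<open>Rnd j i\<close> is the coefficient of data bit i in parity j. \<open>Chn\<close> is a chain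
  of ancillas for the disjunction of all test results, and its last wire decides on FAIL.\<close>

datatype role = Dat nat | Eb nat | Key nat | Rnd nat nat | Chn nat

lemma odd_card_inj:
  assumes "inj_on g A"
  shows "odd (card {i \<in> A. g i = v \<and> P i}) \<longleftrightarrow> (\<exists>i\<in>A. g i = v \<and> P i)"
proof (cases "\<exists>i\<in>A. g i = v \<and> P i")
  case True
  then obtain i where "i \<in> A" "g i = v" "P i" by blast
  then have "{i \<in> A. g i = v \<and> P i} = {i}" using assms by (auto dest: inj_onD)
  then show ?thesis using True by simp
next
  case False
  then have "{i \<in> A. g i = v \<and> P i} = {}" by blast
  then show ?thesis using False by (metis card.empty even_zero)
qed

lemma bit_concat:
  fixes x y :: nat
  assumes "x < 2 ^ a"
  shows "bit (x + 2 ^ a * y) w \<longleftrightarrow> (if w < a then bit x w else bit y (w - a))"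
proof -
  have "x = take_bit a (x + 2 ^ a * y)" "y = drop_bit a (x + 2 ^ a * y)"
    using assms by (auto simp: take_bit_eq_mod drop_bit_eq_div)
  then show ?thesis
    by (metis bit_take_bit_iff bit_drop_bit_eq comp_apply le_add_diff_inverse not_less)
qed

lemma concat_less:
  fixes x y :: nat
  assumes "x < 2 ^ a" "y < 2 ^ b"
  shows "x + 2 ^ a * y < 2 ^ (a + b)"
proof -
  have "x + 2 ^ a * y < 2 ^ a * (y + 1)" using assms by simp
  also have "\<dots> \<le> 2 ^ a * 2 ^ b" using assms by (intro mult_le_mono) auto
  finally show ?thesis by (simp add: power_add)
qed

text \<open>Each party keeps \<open>m\<close> and discards \<open>s\<close> qubits, \<open>t\<close>
  is the number of parities of each kind, and \<open>K\<^sub>0\<close> is the dimension of the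
  untouched factor.\<close>

locale hashing =
  fixes m s t K\<^sub>0 :: nat
  assumes K0: "0 < K\<^sub>0"
begin

definition len :: nat where "len = ceillog2 K\<^sub>0"

definition roles :: "role set" where
  "roles = Dat ` {..<m + s} \<union> Eb ` {..<2 * t} \<union> Key ` {..<len} \<union>
     (\<lambda>(j, i). Rnd j i) ` ({..<2 * t} \<times> {..<m}) \<union> Chn ` {..2 * t}"

text \<open>The order of the first three blocks is imposed by \<open>encode\<close>: data first,
  then the auxiliary index, in which the EPR bits are chosen to be the least significant ones.
  Everything behind is an ancilla.\<close>

primrec pos :: "role \<Rightarrow> nat" where
  "pos (Dat i) = i"
| "pos (Eb j) = m + s + j"
| "pos (Key q) = m + s + 2 * t + q"
| "pos (Rnd j i) = m + s + 2 * t + len + (j * m + i)"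
| "pos (Chn j) = m + s + 2 * t + len + 2 * t * m + j"

definition width :: nat where
  "width = m + s + 2 * t + len + 2 * t * m + (2 * t + 1)"

lemma in_roles [simp]:
  "Dat i \<in> roles \<longleftrightarrow> i < m + s" "Eb j \<in> roles \<longleftrightarrow> j < 2 * t" "Key q \<in> roles \<longleftrightarrow> q < len"
  "Rnd j i \<in> roles \<longleftrightarrow> j < 2 * t \<and> i < m" "Chn j \<in> roles \<longleftrightarrow> j \<le> 2 * t"
  by (auto simp: roles_def image_iff)

lemma row_less: "j < 2 * t \<Longrightarrow> i < m \<Longrightarrow> j * m + i < 2 * t * m"
proof -
  assume "j < 2 * t" "i < m"
  then have "j * m + i < Suc j * m" by simp
  also have "\<dots> \<le> 2 * t * m" using \<open>j < 2 * t\<close> by (intro mult_le_mono) auto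
  finally show ?thesis .
qed

lemma row_inj: "i < m \<Longrightarrow> i' < m \<Longrightarrow> j * m + i = j' * m + i' \<Longrightarrow> j = j' \<and> i = i'"
  by (metis add.commute div_mult_self3 div_less mod_less mod_mult_self2 add.right_neutral add_diff_cancel_right' not_less_zero)

lemma pos_bij: "bij_betw pos roles {..<width}"
proof (rule bij_betw_imageI)
  show "inj_on pos roles"
  proof (rule inj_onI)
    fix x y assume "x \<in> roles" "y \<in> roles" "pos x = pos y"
    moreover have "\<And>j i. x = Rnd j i \<Longrightarrow> j * m + i < 2 * t * m" "\<And>j i. y = Rnd j i \<Longrightarrow> j * m + i < 2 * t * m"
      using \<open>x \<in> roles\<close> \<open>y \<in> roles\<close> row_less by auto
    ultimately show "x = y"
      by (cases x; cases y) (auto dest: row_inj)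
  qed
  have "w \<in> pos ` roles" if w: "w < width" for w
  proof -
    define L where "L = m + s + 2 * t + len"
    consider "w < m + s" | "m + s \<le> w" "w < m + s + 2 * t" | "m + s + 2 * t \<le> w" "w < L"
      | "L \<le> w" "w < L + 2 * t * m" | "L + 2 * t * m \<le> w"
      by linarith
    then show ?thesis
    proof cases
      case 1
      then show ?thesis by (intro image_eqI[of _ _ "Dat w"]) auto
    next
      case 2
      then show ?thesis by (intro image_eqI[of _ _ "Eb (w - (m + s))"]) auto
    next
      case 3
      then show ?thesis by (intro image_eqI[of _ _ "Key (w - (m + s + 2 * t))"]) (auto simp: L_def)
    next
      case 4
      then have "w - L < 2 * t * m" by auto
      from div_mod_less[OF this] show ?thesis
        using 4 by (intro image_eqI[of _ _ "Rnd ((w - L) div m) ((w - L) mod m)"]) (auto simp: L_def)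
    next
      case 5
      then show ?thesis
        using w by (intro image_eqI[of _ _ "Chn (w - (L + 2 * t * m))"]) (auto simp: L_def width_def)
    qed
  qed
  moreover have "pos r < width" if "r \<in> roles" for r
    using that row_less by (cases r) (fastforce simp: width_def)+
  ultimately show "pos ` roles = {..<width}" by auto
qed

sublocale register width pos roles
  by unfold_locales (rule pos_bij)

declare pos.simps [simp del]

definition pairs :: "(nat \<times> nat) set" where "pairs = {..<2 * t} \<times> {..<m}"

definition cells :: "(party \<times> nat) set" where "cells = UNIV \<times> {..<m}"

definition rnd_wires :: "(party \<times> role) list" where
  "rnd_wires = map (\<lambda>(j, i). (Alice, Rnd j i)) (List.product [0..<2 * t] [0..<m])"

definition dat_wires :: "(party \<times> role) list" where
  "dat_wires = map (\<lambda>(p, i). (p, Dat i)) (List.product [Alice, Bob] [0..<m])"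

definition parities :: "nat list \<Rightarrow> instruction list" where
  "parities js = map (\<lambda>(p, j, i). Gate p (map pos [Rnd j i, Dat i, Eb j]) (controlled_flip (\<and>)))
     (List.product [Alice, Bob] (List.product js [0..<m]))"

definition hadamards :: "(party \<times> role) list \<Rightarrow> instruction list" where
  "hadamards vs = map (\<lambda>(p, r). Gate p [pos r] hadamard) vs"

text \<open>A Hadamard gate followed by the measurement inside \<open>Send\<close> yields fair
  public bits. \<open>Send Bob\<close> leaves in Alice's \<open>Eb j\<close> the sum of both halves,
  where the random bit of the EPR pair cancels and the parity of the errors remains. The chain
  starts from the ancilla \<open>Chn 0\<close> in state 0.\<close>

definition circuit_instructions :: "instruction list" where
  "circuit_instructions =
     hadamards rnd_wires @
     map (\<lambda>(j, i). Send Alice (pos (Rnd j i)) (pos (Rnd j i))) (List.product [0..<2 * t] [0..<m]) @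
     parities [0..<t] @
     hadamards dat_wires @
     parities [t..<2 * t] @
     map (\<lambda>j. Send Bob (pos (Eb j)) (pos (Eb j))) [0..<2 * t] @
     map (\<lambda>j. Gate Alice (map pos [Chn j, Eb j, Chn (Suc j)]) (controlled_flip (\<or>))) [0..<2 * t]"

lemma set_rnd_wires: "set rnd_wires = (\<lambda>(j, i). (Alice, Rnd j i)) ` pairs"
  by (auto simp: rnd_wires_def pairs_def)

lemma set_dat_wires: "set dat_wires = (\<lambda>(p, i). (p, Dat i)) ` cells"
  by (auto simp: dat_wires_def cells_def UNIV_party)

lemma distinct_rnd_wires: "distinct rnd_wires"
  by (auto simp: rnd_wires_def distinct_map distinct_product inj_on_def)

lemma distinct_dat_wires: "distinct dat_wires"
  by (auto simp: dat_wires_def distinct_map distinct_product inj_on_def)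

section \<open>Classical action of the segments of the circuit on basis states\<close>

definition copy_rnd :: "(party \<times> role) set \<Rightarrow> (party \<times> role) set" where
  "copy_rnd = fold (\<lambda>(j, i) Z. toggle ((Alice, Rnd j i) \<in> Z) (Bob, Rnd j i) Z) (List.product [0..<2 * t] [0..<m])"

definition add_parities :: "nat list \<Rightarrow> (party \<times> role) set \<Rightarrow> (party \<times> role) set" where
  "add_parities js = fold (\<lambda>(p, j, i) Z. toggle ((p, Rnd j i) \<in> Z \<and> (p, Dat i) \<in> Z) (p, Eb j) Z)
     (List.product [Alice, Bob] (List.product js [0..<m]))"

definition send_syndrome :: "(party \<times> role) set \<Rightarrow> (party \<times> role) set" where
  "send_syndrome = fold (\<lambda>j Z. toggle ((Bob, Eb j) \<in> Z) (Alice, Eb j) Z) [0..<2 * t]"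

definition collect :: "(party \<times> role) set \<Rightarrow> (party \<times> role) set" where
  "collect = fold (\<lambda>j Z. toggle ((Alice, Chn j) \<in> Z \<or> (Alice, Eb j) \<in> Z) (Alice, Chn (Suc j)) Z) [0..<2 * t]"

lemma in_copy_rnd:
  "v \<in> copy_rnd Z \<longleftrightarrow> (v \<in> Z) \<noteq> (\<exists>(j, i)\<in>pairs. (Bob, Rnd j i) = v \<and> (Alice, Rnd j i) \<in> Z)"
proof -
  have "v \<in> fold (\<lambda>a Z. toggle ((\<lambda>(j, i) Z. (Alice, Rnd j i) \<in> Z) a Z) ((\<lambda>(j, i). (Bob, Rnd j i)) a) Z)
      (List.product [0..<2 * t] [0..<m]) Z \<longleftrightarrow>
    (v \<in> Z) \<noteq> odd (card {a \<in> set (List.product [0..<2 * t] [0..<m]). (\<lambda>(j, i). (Bob, Rnd j i)) a = v \<and> (\<lambda>(j, i) Z. (Alice, Rnd j i) \<in> Z) a Z})"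
    by (rule fold_toggle) (auto simp: distinct_product in_toggle)
  also have "odd (card {a \<in> set (List.product [0..<2 * t] [0..<m]). (\<lambda>(j, i). (Bob, Rnd j i)) a = v \<and> (\<lambda>(j, i) Z. (Alice, Rnd j i) \<in> Z) a Z})
     \<longleftrightarrow> (\<exists>(j, i)\<in>pairs. (Bob, Rnd j i) = v \<and> (Alice, Rnd j i) \<in> Z)"
    by (subst odd_card_inj) (auto simp: inj_on_def pairs_def)
  finally show ?thesis by (simp add: copy_rnd_def case_prod_unfold)
qed

lemma in_add_parities:
  assumes "distinct js"
  shows "(p, r) \<in> add_parities js Z \<longleftrightarrow> ((p, r) \<in> Z) \<noteq>
    (\<exists>j\<in>set js. r = Eb j \<and> odd (card {i. i < m \<and> (p, Rnd j i) \<in> Z \<and> (p, Dat i) \<in> Z}))"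
proof -
  let ?is = "List.product [Alice, Bob] (List.product js [0..<m])"
  let ?c = "\<lambda>(p, j, i) Z. (p, Rnd j i) \<in> Z \<and> (p, Dat i) \<in> Z" and ?w = "\<lambda>(p, j, i). (p, Eb j)"
  have "(p, r) \<in> fold (\<lambda>a Z. toggle (?c a Z) (?w a) Z) ?is Z \<longleftrightarrow>
    ((p, r) \<in> Z) \<noteq> odd (card {a \<in> set ?is. ?w a = (p, r) \<and> ?c a Z})"
    by (rule fold_toggle[OF distinct_product]) (auto simp: distinct_product assms in_toggle)
  also have "odd (card {a \<in> set ?is. ?w a = (p, r) \<and> ?c a Z}) \<longleftrightarrow>
     (\<exists>j\<in>set js. r = Eb j \<and> odd (card {i. i < m \<and> (p, Rnd j i) \<in> Z \<and> (p, Dat i) \<in> Z}))"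
  proof (cases "\<exists>j\<in>set js. r = Eb j")
    case True
    then obtain j where j: "j \<in> set js" "r = Eb j" by blast
    have "{a \<in> set ?is. ?w a = (p, r) \<and> ?c a Z} = (\<lambda>i. (p, j, i)) ` {i. i < m \<and> (p, Rnd j i) \<in> Z \<and> (p, Dat i) \<in> Z}"
      using j by (cases p) auto
    moreover have "inj_on (\<lambda>i. (p, j, i)) {i. i < m \<and> (p, Rnd j i) \<in> Z \<and> (p, Dat i) \<in> Z}"
      by (auto simp: inj_on_def)
    ultimately show ?thesis using j by (simp add: card_image)
  next
    case False
    then have "{a \<in> set ?is. ?w a = (p, r) \<and> ?c a Z} = {}" by auto
    then show ?thesis using False by (metis card.empty even_zero)
  qed
  finally show ?thesis by (simp add: add_parities_def case_prod_unfold)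
qed

lemma in_send_syndrome:
  "v \<in> send_syndrome Z \<longleftrightarrow> (v \<in> Z) \<noteq> (\<exists>j<2 * t. v = (Alice, Eb j) \<and> (Bob, Eb j) \<in> Z)"
proof -
  have "v \<in> send_syndrome Z \<longleftrightarrow> (v \<in> Z) \<noteq> odd (card {j \<in> set [0..<2 * t]. (Alice, Eb j) = v \<and> (Bob, Eb j) \<in> Z})"
    unfolding send_syndrome_def by (rule fold_toggle) (auto simp: in_toggle)
  also have "odd (card {j \<in> set [0..<2 * t]. (Alice, Eb j) = v \<and> (Bob, Eb j) \<in> Z}) \<longleftrightarrow>
      (\<exists>j<2 * t. v = (Alice, Eb j) \<and> (Bob, Eb j) \<in> Z)"
    by (subst odd_card_inj) (auto simp: inj_on_def)
  finally show ?thesis .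
qed

text \<open>Each link of the chain is the control of the next, so \<open>fold_toggle\<close> does
  not apply; induction on the length of the chain shows that link j is the disjunction of the first
  j test results.\<close>

lemma in_collect:
  assumes "\<And>j. (Alice, Chn j) \<notin> Z"
  shows "v \<in> collect Z \<longleftrightarrow> v \<in> Z \<or> (\<exists>j\<le>2 * t. v = (Alice, Chn j) \<and> (\<exists>i<j. (Alice, Eb i) \<in> Z))"
proof -
  have "v \<in> fold (\<lambda>j Z. toggle ((Alice, Chn j) \<in> Z \<or> (Alice, Eb j) \<in> Z) (Alice, Chn (Suc j)) Z) [0..<k] Z \<longleftrightarrow>
     v \<in> Z \<or> (\<exists>j\<le>k. v = (Alice, Chn j) \<and> (\<exists>i<j. (Alice, Eb i) \<in> Z))" for k
  proof (induction k arbitrary: v)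
    case (Suc k)
    then show ?case using assms by (auto simp: in_toggle le_Suc_eq less_Suc_eq)
  qed auto
  then show ?thesis unfolding collect_def .
qed

section \<open>Pulling kernels back through the circuit\<close>

abbreviation states :: "complex mat set" where
  "states \<equiv> carrier_mat (2 ^ width * 2 ^ width) (2 ^ width * 2 ^ width)"

lemma fold_step_carrier: "\<omega> \<in> states \<Longrightarrow> fold step is \<omega> \<in> states"
  by (rule fold_kraus_carrier)

lemma pairing_hadamards':
  "distinct vs \<Longrightarrow> set vs \<subseteq> wires \<Longrightarrow> \<omega> \<in> states \<Longrightarrow>
    pairing \<chi> (fold step (hadamards vs) \<omega>) = pairing (hadamard_kernel (set vs) \<chi>) \<omega>"
  unfolding hadamards_def by (rule pairing_hadamards)

lemma pairing_send_rnd: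
  assumes "\<omega> \<in> states"
  shows "pairing \<chi> (fold step (map (\<lambda>(j, i). Send Alice (pos (Rnd j i)) (pos (Rnd j i))) (List.product [0..<2 * t] [0..<m])) \<omega>) =
    pairing (\<lambda>Z Y. of_bool (\<forall>v\<in>set rnd_wires. v \<in> Z \<longleftrightarrow> v \<in> Y) * \<chi> (copy_rnd Z) (copy_rnd Y)) \<omega>"
proof -
  let ?is = "List.product [0..<2 * t] [0..<m]"
  let ?c = "\<lambda>(j, i) Z. (Alice, Rnd j i) \<in> Z" and ?w = "\<lambda>(j, i). (Bob, Rnd j i)" and ?S = "\<lambda>(j, i). {(Alice, Rnd j i)}"
  have "pairing \<chi> (fold step (map (\<lambda>(j, i). Send Alice (pos (Rnd j i)) (pos (Rnd j i))) ?is) \<omega>) =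
    pairing (\<lambda>Z Y. of_bool (agree ?c ?w ?S ?is Z Y) *
      \<chi> (fold (\<lambda>a Z. toggle (?c a Z) (?w a) Z) ?is Z) (fold (\<lambda>a Z. toggle (?c a Z) (?w a) Z) ?is Y)) \<omega>"
    by (rule pairing_classical) (auto simp: assms pairing_send simp del: instruction_kraus.simps)
  moreover have "agree ?c ?w ?S ?is Z Y \<longleftrightarrow> (\<forall>v\<in>set rnd_wires. v \<in> Z \<longleftrightarrow> v \<in> Y)" for Z Y
    by (subst agree_iff_all) (auto simp: rnd_wires_def)
  ultimately show ?thesis by (simp add: copy_rnd_def case_prod_unfold)
qed

lemma pairing_parities:
  assumes "\<omega> \<in> states" "set js \<subseteq> {..<2 * t}"
  shows "pairing \<chi> (fold step (parities js) \<omega>) = pairing (\<lambda>Z Y. \<chi> (add_parities js Z) (add_parities js Y)) \<omega>"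
proof -
  let ?is = "List.product [Alice, Bob] (List.product js [0..<m])"
  let ?c = "\<lambda>(p, j, i) Z. (p, Rnd j i) \<in> Z \<and> (p, Dat i) \<in> Z" and ?w = "\<lambda>(p, j, i). (p, Eb j)"
  have "pairing \<chi> (fold step (map (\<lambda>(p, j, i). Gate p (map pos [Rnd j i, Dat i, Eb j]) (controlled_flip (\<and>))) ?is) \<omega>) =
    pairing (\<lambda>Z Y. of_bool (agree ?c ?w (\<lambda>_. {}) ?is Z Y) *
      \<chi> (fold (\<lambda>a Z. toggle (?c a Z) (?w a) Z) ?is Z) (fold (\<lambda>a Z. toggle (?c a Z) (?w a) Z) ?is Y)) \<omega>"
  proof (rule pairing_classical[OF _ assms(1)])
    fix a \<chi> \<omega> assume a: "a \<in> set ?is" and \<omega>: "\<omega> \<in> states"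
    obtain p j i where pji: "a = (p, j, i)" by (cases a)
    show "pairing \<chi> (step ((\<lambda>(p, j, i). Gate p (map pos [Rnd j i, Dat i, Eb j]) (controlled_flip (\<and>))) a) \<omega>) =
      pairing (\<lambda>Z Y. of_bool (\<forall>v\<in>{}. (v \<in> Z) = (v \<in> Y)) * \<chi> (toggle (?c a Z) (?w a) Z) (toggle (?c a Y) (?w a) Y)) \<omega>"
      using a assms(2) pji pairing_controlled_flip[OF _ _ \<omega>, of "Rnd j i" "Dat i" "Eb j" \<chi> p "(\<and>)"]
      by auto
  qed
  moreover have "agree ?c ?w (\<lambda>_. {}) ?is Z Y" for Z Y by (subst agree_iff_all) auto
  ultimately show ?thesis by (simp add: parities_def add_parities_def case_prod_unfold)
qed

lemma pairing_send_syndrome: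
  assumes "\<omega> \<in> states"
  shows "pairing \<chi> (fold step (map (\<lambda>j. Send Bob (pos (Eb j)) (pos (Eb j))) [0..<2 * t]) \<omega>) =
    pairing (\<lambda>Z Y. of_bool (\<forall>j<2 * t. (Bob, Eb j) \<in> Z \<longleftrightarrow> (Bob, Eb j) \<in> Y) *
      \<chi> (send_syndrome Z) (send_syndrome Y)) \<omega>"
proof -
  let ?c = "\<lambda>j Z. (Bob, Eb j) \<in> Z" and ?w = "\<lambda>j. (Alice, Eb j)" and ?S = "\<lambda>j. {(Bob, Eb j)}"
  have "pairing \<chi> (fold step (map (\<lambda>j. Send Bob (pos (Eb j)) (pos (Eb j))) [0..<2 * t]) \<omega>) =
    pairing (\<lambda>Z Y. of_bool (agree ?c ?w ?S [0..<2 * t] Z Y) *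
      \<chi> (fold (\<lambda>a Z. toggle (?c a Z) (?w a) Z) [0..<2 * t] Z) (fold (\<lambda>a Z. toggle (?c a Z) (?w a) Z) [0..<2 * t] Y)) \<omega>"
    by (rule pairing_classical) (auto simp: assms pairing_send simp del: instruction_kraus.simps)
  moreover have "agree ?c ?w ?S [0..<2 * t] Z Y \<longleftrightarrow> (\<forall>j<2 * t. (Bob, Eb j) \<in> Z \<longleftrightarrow> (Bob, Eb j) \<in> Y)" for Z Y
    by (subst agree_iff_all) auto
  ultimately show ?thesis by (simp add: send_syndrome_def)
qed

lemma pairing_collect:
  assumes "\<omega> \<in> states"
  shows "pairing \<chi> (fold step (map (\<lambda>j. Gate Alice (map pos [Chn j, Eb j, Chn (Suc j)]) (controlled_flip (\<or>))) [0..<2 * t]) \<omega>) =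
    pairing (\<lambda>Z Y. \<chi> (collect Z) (collect Y)) \<omega>"
proof -
  let ?c = "\<lambda>j Z. (Alice, Chn j) \<in> Z \<or> (Alice, Eb j) \<in> Z" and ?w = "\<lambda>j. (Alice, Chn (Suc j))"
  have "pairing \<chi> (fold step (map (\<lambda>j. Gate Alice (map pos [Chn j, Eb j, Chn (Suc j)]) (controlled_flip (\<or>))) [0..<2 * t]) \<omega>) =
    pairing (\<lambda>Z Y. of_bool (agree ?c ?w (\<lambda>_. {}) [0..<2 * t] Z Y) *
      \<chi> (fold (\<lambda>a Z. toggle (?c a Z) (?w a) Z) [0..<2 * t] Z) (fold (\<lambda>a Z. toggle (?c a Z) (?w a) Z) [0..<2 * t] Y)) \<omega>"
  proof (rule pairing_classical[OF _ assms])
    fix j \<chi> \<omega> assume j: "j \<in> set [0..<2 * t]" and \<omega>: "\<omega> \<in> states"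
    show "pairing \<chi> (step (Gate Alice (map pos [Chn j, Eb j, Chn (Suc j)]) (controlled_flip (\<or>))) \<omega>) =
      pairing (\<lambda>Z Y. of_bool (\<forall>v\<in>{}. (v \<in> Z) = (v \<in> Y)) * \<chi> (toggle (?c j Z) (?w j) Z) (toggle (?c j Y) (?w j) Y)) \<omega>"
      using j pairing_controlled_flip[OF _ _ \<omega>, of "Chn j" "Eb j" "Chn (Suc j)" \<chi> Alice "(\<or>)"]
      by auto
  qed
  moreover have "agree ?c ?w (\<lambda>_. {}) [0..<2 * t] Z Y" for Z Y by (subst agree_iff_all) auto
  ultimately show ?thesis by (simp add: collect_def)
qed

definition second_half :: "(party \<times> role) set \<Rightarrow> (party \<times> role) set" where
  "second_half Z = collect (send_syndrome (add_parities [t..<2 * t] Z))"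

definition first_half :: "(party \<times> role) set \<Rightarrow> (party \<times> role) set" where
  "first_half Z = add_parities [0..<t] (copy_rnd Z)"

text \<open>Kernels are pulled back from the end of the circuit, so the nested kernel, read from
  outside to inside, follows the circuit in time.\<close>

lemma pairing_circuit:
  assumes "\<omega> \<in> states"
  shows "pairing \<chi> (fold step circuit_instructions \<omega>) =
    pairing (hadamard_kernel (set rnd_wires) (\<lambda>Z Y. of_bool (\<forall>v\<in>set rnd_wires. v \<in> Z \<longleftrightarrow> v \<in> Y) *
      hadamard_kernel (set dat_wires) (\<lambda>Z Y.
        of_bool (\<forall>j<2 * t. (Bob, Eb j) \<in> add_parities [t..<2 * t] Z \<longleftrightarrow> (Bob, Eb j) \<in> add_parities [t..<2 * t] Y) *
        \<chi> (second_half Z) (second_half Y)) (first_half Z) (first_half Y))) \<omega>"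
proof -
  have w: "set rnd_wires \<subseteq> wires" "set dat_wires \<subseteq> wires"
    by (auto simp: set_rnd_wires set_dat_wires pairs_def cells_def)
  have js: "set [0..<t] \<subseteq> {..<2 * t}" "set [t..<2 * t] \<subseteq> {..<2 * t}" by auto
  show ?thesis
    unfolding circuit_instructions_def fold_append comp_apply
    by (simp only: pairing_collect pairing_send_syndrome pairing_parities pairing_hadamards' pairing_send_rnd
        fold_step_carrier assms w js distinct_rnd_wires distinct_dat_wires second_half_def first_half_def)
qed

end

section \<open>The initial state as a sum over basis inputs\<close>

lemma mult_add_div_mod:
  fixes x y b :: nat
  assumes "y < b"
  shows "(x * b + y) div b = x" "(x * b + y) mod b = y"
  using assms by (auto simp: div_mult_self3)

lemma set_encode_bij: "bij_betw set_encode (Pow {..<n}) {..<2 ^ n}"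
proof (rule bij_betw_imageI)
  show "inj_on set_encode (Pow {..<n})"
    by (rule inj_onI) (metis PowD finite_lessThan finite_subset set_encode_inverse)
  have "x \<in> set_encode ` Pow {..<n}" if "x < 2 ^ n" for x :: nat
  proof (rule image_eqI[of _ _ "set_decode x"])
    show "set_decode x \<in> Pow {..<n}"
      using bit_less_exp[OF that] by (auto simp: set_decode_def bit_iff_odd)
  qed simp
  then show "set_encode ` Pow {..<n} = {..<2 ^ n}" by (auto simp: set_encode_less)
qed

context hashing
begin

definition N :: nat where "N = 2 ^ (m + s)"
definition K :: nat where "K = K\<^sub>0 * 2 ^ (2 * t)"
definition M :: nat where "M = 2 ^ m * K\<^sub>0"

definition data :: "(party \<times> nat) set" where "data = UNIV \<times> {..<m + s}"

text \<open>The auxiliary state is supported on equal indices of Alice and Bob. Hence one common EPR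
  string and one common key accompany the joint data bits of both parties.\<close>

definition inputs :: "((party \<times> nat) set \<times> nat set \<times> nat) set" where
  "inputs = Pow data \<times> Pow {..<2 * t} \<times> {..<K\<^sub>0}"

definition side :: "party \<Rightarrow> (party \<times> nat) set \<Rightarrow> nat" where
  "side p X = set_encode {i. (p, i) \<in> X}"

definition data_idx :: "(party \<times> nat) set \<Rightarrow> nat" where
  "data_idx X = side Alice X * N + side Bob X"

fun aux_val :: "nat set \<times> nat \<Rightarrow> nat" where
  "aux_val (e, \<kappa>) = \<kappa> * 2 ^ (2 * t) + set_encode e"

text \<open>The index of a basis input in the regrouped state \<open>gepp_input\<close>.\<close>

fun code :: "(party \<times> nat) set \<times> nat set \<times> nat \<Rightarrow> nat" where
  "code (X, a) = (side Alice X * K + aux_val a) * (N * K) + (side Bob X * K + aux_val a)"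

fun encoded :: "(party \<times> nat) set \<times> nat set \<times> nat \<Rightarrow> (party \<times> role) set" where
  "encoded (X, e, \<kappa>) = {(p, r). case r of Dat i \<Rightarrow> (p, i) \<in> X | Eb j \<Rightarrow> j \<in> e | Key q \<Rightarrow> bit \<kappa> q | _ \<Rightarrow> False}"

lemma finite_data [simp]: "finite data"
  by (simp add: data_def)

lemma finite_inputs [simp]: "finite inputs"
  by (simp add: inputs_def)

lemma N_pos: "0 < N" and K_pos: "0 < K" and M_pos: "0 < M"
  using K0 by (auto simp: N_def K_def M_def)

lemma K0_le: "K\<^sub>0 \<le> 2 ^ len"
  unfolding len_def by (rule le_two_power_ceillog2)

lemma side_less: "X \<subseteq> data \<Longrightarrow> side p X < N"
  unfolding side_def N_def by (rule set_encode_less) (auto simp: data_def)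

lemma bit_side: "X \<subseteq> data \<Longrightarrow> bit (side p X) i \<longleftrightarrow> (p, i) \<in> X"
  unfolding side_def by (subst bit_set_encode) (auto simp: data_def intro: finite_subset[of _ "{..<m + s}"])

lemma mult_add_less: "x < a \<Longrightarrow> y < b \<Longrightarrow> x * b + y < a * (b :: nat)"
proof -
  assume "x < a" "y < b"
  then have "x * b + y < Suc x * b" by simp
  also have "\<dots> \<le> a * b" using \<open>x < a\<close> by (intro mult_le_mono) auto
  finally show ?thesis .
qed

lemma aux_val_less: "e \<subseteq> {..<2 * t} \<Longrightarrow> \<kappa> < K\<^sub>0 \<Longrightarrow> aux_val (e, \<kappa>) < K"
  unfolding K_def aux_val.simps by (intro mult_add_less set_encode_less)

lemma code_div_mod:
  assumes "(X, a) \<in> inputs"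
  shows "code (X, a) < N * K * (N * K)"
    "code (X, a) div (N * K) = side Alice X * K + aux_val a"
    "code (X, a) mod (N * K) = side Bob X * K + aux_val a"
    "code (X, a) div (N * K) div K = side Alice X" "code (X, a) div (N * K) mod K = aux_val a"
    "code (X, a) mod (N * K) div K = side Bob X" "code (X, a) mod (N * K) mod K = aux_val a"
proof -
  obtain e \<kappa> where a: "a = (e, \<kappa>)" by fastforce
  have k: "aux_val a < K" using assms aux_val_less by (auto simp: inputs_def a)
  have X: "X \<subseteq> data" using assms by (auto simp: inputs_def)
  have b: "side p X * K + aux_val a < N * K" for p
    by (rule mult_add_less[OF side_less[OF X] k])
  show "code (X, a) < N * K * (N * K)" unfolding code.simps by (rule mult_add_less[OF b b])
  show 1: "code (X, a) div (N * K) = side Alice X * K + aux_val a"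
    unfolding code.simps by (rule mult_add_div_mod[OF b])
  show 2: "code (X, a) mod (N * K) = side Bob X * K + aux_val a"
    unfolding code.simps by (rule mult_add_div_mod[OF b])
  show "code (X, a) div (N * K) div K = side Alice X" "code (X, a) div (N * K) mod K = aux_val a"
    "code (X, a) mod (N * K) div K = side Bob X" "code (X, a) mod (N * K) mod K = aux_val a"
    unfolding 1 2 by (rule mult_add_div_mod[OF k])+
qed

declare code.simps [simp del] and aux_val.simps [simp del]

text \<open>The image is the set of indices at which the amplitude of \<open>max_ent K\<close> does
  not vanish; \<open>sum_code\<close> uses this to restrict sums over all indices to
  \<open>inputs\<close>.\<close>

lemma code_bij:
  "bij_betw code inputs {k. k < N * K * (N * K) \<and> k div (N * K) mod K = k mod (N * K) mod K}"
proof (rule bij_betw_imageI)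
  show "inj_on code inputs"
  proof (rule inj_onI)
    fix a b assume ab: "a \<in> inputs" "b \<in> inputs" "code a = code b"
    obtain X e \<kappa> X' e' \<kappa>' where a: "a = (X, e, \<kappa>)" and b: "b = (X', e', \<kappa>')" by (metis prod_cases3)
    note d = code_div_mod[OF ab(1)[unfolded a]] code_div_mod[OF ab(2)[unfolded b]]
    have X: "X \<subseteq> data" "X' \<subseteq> data" and e: "e \<in> Pow {..<2 * t}" "e' \<in> Pow {..<2 * t}"
      using ab by (auto simp: a b inputs_def)
    have "side p X = side p X'" for p
      using d(4,6,11,13) ab(3) unfolding a b by (cases p) metis+
    then have "X = X'" using bit_side[OF X(1)] bit_side[OF X(2)] by (auto simp: set_eq_iff)
    have av: "aux_val (e, \<kappa>) = aux_val (e', \<kappa>')" using d(5,12) ab(3) unfolding a b by metis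
    have "set_encode e < 2 ^ (2 * t)" "set_encode e' < 2 ^ (2 * t)"
      using e by (auto intro: set_encode_less)
    from this[THEN mult_add_div_mod(1)] this[THEN mult_add_div_mod(2)]
    have "\<kappa> = \<kappa>'" "set_encode e = set_encode e'"
      using av unfolding aux_val.simps by metis+
    then have "e = e'" using set_encode_bij[of "2 * t"] e by (auto simp: bij_betw_def inj_on_def)
    then show "a = b" using \<open>X = X'\<close> \<open>\<kappa> = \<kappa>'\<close> by (simp add: a b)
  qed
  have "k \<in> code ` inputs" if k: "k < N * K * (N * K)" "k div (N * K) mod K = k mod (N * K) mod K" for k
  proof -
    define x where "x = (\<lambda>p. case p of Alice \<Rightarrow> k div (N * K) div K | Bob \<Rightarrow> k mod (N * K) div K)"
    define y where "y = k mod (N * K) mod K"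
    have less: "k div (N * K) < N * K" "k mod (N * K) < N * K" using div_mod_less[OF k(1)] .
    have x: "x p < N" for p
      using div_mod_less[OF less(1)] div_mod_less[OF less(2)] by (cases p) (auto simp: x_def)
    have y: "y < K" using K_pos by (simp add: y_def)
    define X where "X = {(p, i). bit (x p) i}"
    have X: "X \<subseteq> data" using x bit_less_exp by (auto simp: X_def data_def N_def)
    have sX: "side p X = x p" for p
      by (rule bit_eqI) (simp add: bit_side[OF X], simp add: X_def)
    have yd: "y div 2 ^ (2 * t) < K\<^sub>0" "y mod 2 ^ (2 * t) < 2 ^ (2 * t)"
      using y div_mod_less(1)[of y "K\<^sub>0" "2 ^ (2 * t)"] by (auto simp: K_def)
    have "y mod 2 ^ (2 * t) \<in> set_encode ` Pow {..<2 * t}"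
      unfolding bij_betw_imp_surj_on[OF set_encode_bij] using yd(2) by simp
    then obtain e where e: "e \<in> Pow {..<2 * t}" "set_encode e = y mod 2 ^ (2 * t)" by fastforce
    have av: "aux_val (e, y div 2 ^ (2 * t)) = y" by (simp only: aux_val.simps e div_mult_mod_eq)
    have "code (X, e, y div 2 ^ (2 * t)) = (x Alice * K + y) * (N * K) + (x Bob * K + y)"
      unfolding code.simps av sX ..
    also have "x Alice * K + y = k div (N * K)"
      unfolding y_def k(2)[symmetric] by (simp only: x_def party.case div_mult_mod_eq)
    also have "x Bob * K + y = k mod (N * K)"
      unfolding y_def by (simp only: x_def party.case div_mult_mod_eq)
    also have "k div (N * K) * (N * K) + k mod (N * K) = k" by (rule div_mult_mod_eq)
    finally have "k = code (X, e, y div 2 ^ (2 * t))" by (rule sym)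
    moreover have "(X, e, y div 2 ^ (2 * t)) \<in> inputs" using X e(1) yd(1) by (simp add: inputs_def)
    ultimately show ?thesis by (rule image_eqI)
  qed
  then show "code ` inputs = {k. k < N * K * (N * K) \<and> k div (N * K) mod K = k mod (N * K) mod K}"
    using code_div_mod by auto
qed

lemma sum_code:
  assumes "\<And>k. k < N * K * (N * K) \<Longrightarrow> k div (N * K) mod K \<noteq> k mod (N * K) mod K \<Longrightarrow> f k = 0"
  shows "(\<Sum>k<N * K * (N * K). f k) = (\<Sum>a\<in>inputs. f (code a))"
proof -
  have "(\<Sum>k<N * K * (N * K). f k) = (\<Sum>k\<in>{k. k < N * K * (N * K) \<and> k div (N * K) mod K = k mod (N * K) mod K}. f k)"
    using assms by (intro sum.mono_neutral_right) auto
  then show ?thesis by (simp add: sum.reindex_bij_betw[OF code_bij])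
qed

text \<open>Ket and bra of the auxiliary state each contribute \<open>1 / sqrt K\<close>.\<close>

lemma gepp_input_code:
  assumes "a \<in> inputs" "b \<in> inputs"
  shows "gepp_input N K \<rho> $$ (code a, code b) = \<rho> $$ (data_idx (fst a), data_idx (fst b)) / of_nat K"
proof -
  obtain X u X' u' where ab: "a = (X, u)" "b = (X', u')" by (meson surj_pair)
  note d = code_div_mod[OF assms(1)[unfolded ab]] code_div_mod[OF assms(2)[unfolded ab]]
  have u: "u \<in> Pow {..<2 * t} \<times> {..<K\<^sub>0}" "u' \<in> Pow {..<2 * t} \<times> {..<K\<^sub>0}"
    using assms by (auto simp: ab inputs_def)
  have me: "max_ent K $ (k * K + k) = 1 / complex_of_real (sqrt (real K))" if "k < K" for k
    using that mult_add_less[OF that that] by (simp add: max_ent_def)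
  have "aux_val u < K" "aux_val u' < K" using u aux_val_less by auto
  moreover have "complex_of_real (sqrt (real K)) * complex_of_real (sqrt (real K)) = of_nat K"
    by (simp flip: of_real_mult)
  ultimately show ?thesis
    using d by (simp add: ab gepp_input_def data_index_def aux_index_def data_idx_def me)
qed

lemma gepp_input_zero:
  assumes "k < N * K * (N * K)" "l < N * K * (N * K)"
    "k div (N * K) mod K \<noteq> k mod (N * K) mod K \<or> l div (N * K) mod K \<noteq> l mod (N * K) mod K"
  shows "gepp_input N K \<rho> $$ (k, l) = 0"
proof -
  have me: "max_ent K $ (x * K + y) = 0" if "x < K" "y < K" "x \<noteq> y" for x y
    using that mult_add_less[OF that(1,2)] by (simp add: max_ent_def)
  have "k div (N * K) mod K < K" "k mod (N * K) mod K < K" "l div (N * K) mod K < K" "l mod (N * K) mod K < K"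
    using K_pos by auto
  then show ?thesis using assms me by (auto simp: gepp_input_def aux_index_def)
qed

lemma in_encoded [simp]:
  "(p, Dat i) \<in> encoded (X, e, \<kappa>) \<longleftrightarrow> (p, i) \<in> X" "(p, Eb j) \<in> encoded (X, e, \<kappa>) \<longleftrightarrow> j \<in> e"
  "(p, Key q) \<in> encoded (X, e, \<kappa>) \<longleftrightarrow> bit \<kappa> q" "(p, Rnd j i) \<notin> encoded (X, e, \<kappa>)"
  "(p, Chn j) \<notin> encoded (X, e, \<kappa>)"
  by auto

declare encoded.simps [simp del]

lemma encoded_wires:
  assumes "(X, e, \<kappa>) \<in> inputs"
  shows "encoded (X, e, \<kappa>) \<subseteq> wires"
proof
  fix v assume v: "v \<in> encoded (X, e, \<kappa>)"
  obtain p r where pr: "v = (p, r)" by fastforce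
  have "\<kappa> < 2 ^ len" using assms K0_le by (auto simp: inputs_def)
  then show "v \<in> wires"
    using v assms bit_less_exp[of \<kappa> len] unfolding pr by (cases r) (auto simp: inputs_def data_def)
qed

text \<open>Here the chosen numbering of the wires meets the binary format fixed by
  \<open>encode\<close>; both sides are compared bit by bit.\<close>

lemma part_encoded:
  assumes "(X, e, \<kappa>) \<in> inputs"
  shows "part p (idx (encoded (X, e, \<kappa>))) = side p X + 2 ^ (m + s) * aux_val (e, \<kappa>)"
proof (rule bits_eqI[of _ width])
  have X: "X \<subseteq> data" and e: "e \<subseteq> {..<2 * t}" and \<kappa>: "\<kappa> < 2 ^ len"
    using assms K0_le by (auto simp: inputs_def)
  have se: "set_encode e < 2 ^ (2 * t)" using e by (rule set_encode_less)
  have av: "aux_val (e, \<kappa>) = set_encode e + 2 ^ (2 * t) * \<kappa>" by (simp add: aux_val.simps)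
  have "side p X + 2 ^ (m + s) * aux_val (e, \<kappa>) < 2 ^ (m + s + (2 * t + len))"
    unfolding av by (intro concat_less side_less[OF X, unfolded N_def] se \<kappa>)
  also have "\<dots> \<le> 2 ^ width" by (intro power_increasing) (auto simp: width_def)
  finally show "side p X + 2 ^ (m + s) * aux_val (e, \<kappa>) < 2 ^ width" .
  note wi = encoded_wires[OF assms]
  show "part p (idx (encoded (X, e, \<kappa>))) < 2 ^ width" by (rule part_less[OF wi])
  have fe: "finite e" using e finite_subset by blast
  fix w assume "w < width"
  then obtain r where r: "r \<in> roles" "w = pos r" using pos_surj by blast
  have "bit (side p X + 2 ^ (m + s) * aux_val (e, \<kappa>)) w \<longleftrightarrow>
      (if w < m + s then (p, w) \<in> X else if w - (m + s) < 2 * t then w - (m + s) \<in> e else bit \<kappa> (w - (m + s) - 2 * t))"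
    unfolding av bit_concat[OF side_less[OF X, unfolded N_def]] bit_concat[OF se] bit_side[OF X] bit_set_encode[OF fe] ..
  then show "bit (part p (idx (encoded (X, e, \<kappa>)))) w = bit (side p X + 2 ^ (m + s) * aux_val (e, \<kappa>)) w"
    using r bit_part[OF wi r(1), of p] bit_less_exp[OF \<kappa>, of "w - (m + s) - 2 * t"]
    by (cases r) (auto simp: pos.simps)
qed

lemma encode_entry:
  assumes Z: "Z \<subseteq> wires" and a: "a \<in> inputs"
  shows "kron (encode width N K) (encode width N K) $$ (idx Z, code a) = of_bool (Z = encoded a)"
proof -
  obtain X e \<kappa> where xa: "a = (X, e, \<kappa>)" by (metis prod_cases3)
  note a' = a[unfolded xa] and d = code_div_mod[OF a[unfolded xa]]
  have "kron (encode width N K) (encode width N K) $$ (idx Z, code a) =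
    encode width N K $$ (part Alice (idx Z), code a div (N * K)) * encode width N K $$ (part Bob (idx Z), code a mod (N * K))"
    using idx_less[OF Z] d(1) by (simp add: part_def xa)
  also have "\<dots> = of_bool (part Alice (idx Z) = part Alice (idx (encoded a)) \<and> part Bob (idx Z) = part Bob (idx (encoded a)))"
    using part_less[OF Z] d div_mod_less[OF d(1)] part_encoded[OF a']
    by (simp add: encode_def xa N_def)
  also have "\<dots> = of_bool (Z = encoded a)"
    using part_eq_iff[OF Z encoded_wires[OF a']] set_eq_iff_parts[OF Z encoded_wires[OF a']]
    by (auto simp: xa all_party)
  finally show ?thesis .
qed

lemma pairing_initial:
  "pairing \<chi> (sandwich (kron (encode width N K) (encode width N K)) (gepp_input N K \<rho>)) =
    (\<Sum>a\<in>inputs. \<Sum>b\<in>inputs. \<chi> (encoded a) (encoded b) * \<rho> $$ (data_idx (fst a), data_idx (fst b))) / of_nat K"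
proof -
  let ?E = "kron (encode width N K) (encode width N K)" and ?c = "N * K * (N * K)" and ?\<gamma> = "gepp_input N K \<rho>"
  let ?G = "\<lambda>k l. \<Sum>Z\<in>Pow wires. \<Sum>Y\<in>Pow wires. \<chi> Z Y * (?E $$ (idx Z, k) * cnj (?E $$ (idx Y, l)))"
  have G: "?G (code a) (code b) = \<chi> (encoded a) (encoded b)" if ab: "a \<in> inputs" "b \<in> inputs" for a b
  proof -
    have wi: "encoded a \<subseteq> wires" "encoded b \<subseteq> wires"
      using encoded_wires ab by (metis prod_cases3)+
    have "?G (code a) (code b) = (\<Sum>Z\<in>Pow wires. \<Sum>Y\<in>Pow wires. if Y = encoded b then (if Z = encoded a then \<chi> Z Y else 0) else 0)"
      using ab by (intro sum.cong refl) (auto simp: encode_entry simp del: kron_index)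
    also have "\<dots> = (\<Sum>Z\<in>Pow wires. if Z = encoded a then \<chi> Z (encoded b) else 0)"
      using wi by (intro sum.cong refl, subst sum.delta) auto
    also have "\<dots> = \<chi> (encoded a) (encoded b)" using wi by (subst sum.delta) auto
    finally show ?thesis .
  qed
  have "pairing \<chi> (sandwich ?E ?\<gamma>) = (\<Sum>k<?c. \<Sum>l<?c. ?G k l * ?\<gamma> $$ (k, l))"
    by (rule pairing_sandwich[OF kron_carrier[OF encode_carrier encode_carrier] gepp_input_carrier])
  also have "\<dots> = (\<Sum>k<?c. \<Sum>b\<in>inputs. ?G k (code b) * ?\<gamma> $$ (k, code b))"
    by (intro sum.cong refl sum_code) (simp add: gepp_input_zero)
  also have "\<dots> = (\<Sum>a\<in>inputs. \<Sum>b\<in>inputs. ?G (code a) (code b) * ?\<gamma> $$ (code a, code b))"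
    using code_div_mod(1) by (intro sum_code) (auto simp: gepp_input_zero intro!: sum.neutral)
  also have "\<dots> = (\<Sum>a\<in>inputs. \<Sum>b\<in>inputs. \<chi> (encoded a) (encoded b) * (\<rho> $$ (data_idx (fst a), data_idx (fst b)) / of_nat K))"
    by (intro sum.cong refl) (simp add: G gepp_input_code)
  finally show ?thesis by (simp add: sum_divide_distrib)
qed

section \<open>Computational paths through the circuit\<close>

definition parity :: "(nat \<times> nat) set \<Rightarrow> (party \<times> nat) set \<Rightarrow> party \<Rightarrow> nat \<Rightarrow> bool" where
  "parity U V p j = odd (card {i. i < m \<and> (j, i) \<in> U \<and> (p, i) \<in> V})"

text \<open>
  The state of the wires at the end of the computational path that starts at an input, has the random bits
  \<open>U\<close> and passes through \<open>C\<close> after the Hadamard gates on the kept part of the data.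
\<close>

fun final :: "(party \<times> nat) set \<times> nat set \<times> nat \<Rightarrow> (nat \<times> nat) set \<Rightarrow> (party \<times> nat) set \<Rightarrow> (party \<times> role) set" where
  "final (X, e, \<kappa>) U C = {(p, r). case r of
      Dat i \<Rightarrow> (p, i) \<in> (if i < m then C else X)
    | Eb j \<Rightarrow> j < 2 * t \<and> (case p of
        Alice \<Rightarrow> parity U (if j < t then X else C) Alice j \<noteq> parity U (if j < t then X else C) Bob j
      | Bob \<Rightarrow> (j \<in> e) \<noteq> parity U (if j < t then X else C) Bob j)
    | Key q \<Rightarrow> bit \<kappa> q
    | Rnd j i \<Rightarrow> (j, i) \<in> U
    | Chn j \<Rightarrow> p = Alice \<and> j \<le> 2 * t \<and>
        (\<exists>i<j. parity U (if i < t then X else C) Alice i \<noteq> parity U (if i < t then X else C) Bob i)}"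

lemma in_final [simp]:
  "(p, Dat i) \<in> final (X, e, \<kappa>) U C \<longleftrightarrow> (p, i) \<in> (if i < m then C else X)"
  "(Alice, Eb j) \<in> final (X, e, \<kappa>) U C \<longleftrightarrow> j < 2 * t \<and>
    parity U (if j < t then X else C) Alice j \<noteq> parity U (if j < t then X else C) Bob j"
  "(Bob, Eb j) \<in> final (X, e, \<kappa>) U C \<longleftrightarrow> j < 2 * t \<and> (j \<in> e) \<noteq> parity U (if j < t then X else C) Bob j"
  "(p, Key q) \<in> final (X, e, \<kappa>) U C \<longleftrightarrow> bit \<kappa> q"
  "(p, Rnd j i) \<in> final (X, e, \<kappa>) U C \<longleftrightarrow> (j, i) \<in> U"
  "(p, Chn j) \<in> final (X, e, \<kappa>) U C \<longleftrightarrow> p = Alice \<and> j \<le> 2 * t \<and>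
    (\<exists>i<j. parity U (if i < t then X else C) Alice i \<noteq> parity U (if i < t then X else C) Bob i)"
  by auto

declare final.simps [simp del]

definition rnd_img :: "(nat \<times> nat) set \<Rightarrow> (party \<times> role) set" where
  "rnd_img U = (\<lambda>(j, i). (Alice, Rnd j i)) ` U"

definition dat_img :: "(party \<times> nat) set \<Rightarrow> (party \<times> role) set" where
  "dat_img C = (\<lambda>(p, i). (p, Dat i)) ` C"

lemma in_rnd_img [simp]: "(p, r) \<in> rnd_img U \<longleftrightarrow> (\<exists>j i. p = Alice \<and> r = Rnd j i \<and> (j, i) \<in> U)"
  by (force simp: rnd_img_def)

lemma in_dat_img [simp]: "(p, r) \<in> dat_img C \<longleftrightarrow> (\<exists>i. r = Dat i \<and> (p, i) \<in> C)"
  by (force simp: dat_img_def)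

lemma set_wires_img: "set rnd_wires = rnd_img pairs" "set dat_wires = dat_img cells"
  by (simp_all add: set_rnd_wires set_dat_wires rnd_img_def dat_img_def)

lemma in_first_half:
  assumes "(X, e, \<kappa>) \<in> inputs" "U \<subseteq> pairs"
  shows "(p, Dat i) \<in> first_half (encoded (X, e, \<kappa>) \<union> rnd_img U) \<longleftrightarrow> (p, i) \<in> X"
    "(p, Eb j) \<in> first_half (encoded (X, e, \<kappa>) \<union> rnd_img U) \<longleftrightarrow> (j \<in> e) \<noteq> (j < t \<and> parity U X p j)"
    "(p, Key q) \<in> first_half (encoded (X, e, \<kappa>) \<union> rnd_img U) \<longleftrightarrow> bit \<kappa> q"
    "(p, Rnd j i) \<in> first_half (encoded (X, e, \<kappa>) \<union> rnd_img U) \<longleftrightarrow> (j, i) \<in> U"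
    "(p, Chn j) \<notin> first_half (encoded (X, e, \<kappa>) \<union> rnd_img U)"
proof -
  define Z where "Z = copy_rnd (encoded (X, e, \<kappa>) \<union> rnd_img U)"
  have Z: "(p, Dat i) \<in> Z \<longleftrightarrow> (p, i) \<in> X" "(p, Eb j) \<in> Z \<longleftrightarrow> j \<in> e" "(p, Key q) \<in> Z \<longleftrightarrow> bit \<kappa> q"
    "(p, Rnd j i) \<in> Z \<longleftrightarrow> (j, i) \<in> U" "(p, Chn j) \<notin> Z" for p i j q
    using assms(2) by (cases p; auto simp: Z_def in_copy_rnd)+
  show "(p, Dat i) \<in> first_half (encoded (X, e, \<kappa>) \<union> rnd_img U) \<longleftrightarrow> (p, i) \<in> X"
    "(p, Eb j) \<in> first_half (encoded (X, e, \<kappa>) \<union> rnd_img U) \<longleftrightarrow> (j \<in> e) \<noteq> (j < t \<and> parity U X p j)"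
    "(p, Key q) \<in> first_half (encoded (X, e, \<kappa>) \<union> rnd_img U) \<longleftrightarrow> bit \<kappa> q"
    "(p, Rnd j i) \<in> first_half (encoded (X, e, \<kappa>) \<union> rnd_img U) \<longleftrightarrow> (j, i) \<in> U"
    "(p, Chn j) \<notin> first_half (encoded (X, e, \<kappa>) \<union> rnd_img U)"
    unfolding first_half_def Z_def[symmetric] by (auto simp: in_add_parities Z parity_def)
qed

text \<open>Parities below \<open>t\<close> are taken from the data before the Hadamard gates, the
  others from the values \<open>C\<close> behind them. The second claim serves the dephasing of
  Bob's EPR halves: his halves change no more after the parities, so the condition can be read off
  the end of the path.\<close>

lemma path:
  assumes a: "(X, e, \<kappa>) \<in> inputs" and U: "U \<subseteq> pairs" and C: "C \<subseteq> cells"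
  defines "Y \<equiv> first_half (encoded (X, e, \<kappa>) \<union> rnd_img U) - dat_img cells \<union> dat_img C"
  shows "second_half Y = final (X, e, \<kappa>) U C"
    and "j < 2 * t \<Longrightarrow> (Bob, Eb j) \<in> add_parities [t..<2 * t] Y \<longleftrightarrow> (Bob, Eb j) \<in> final (X, e, \<kappa>) U C"
proof -
  have e: "j \<in> e \<Longrightarrow> j < 2 * t" for j using a by (auto simp: inputs_def)
  have Y: "(p, Dat i) \<in> Y \<longleftrightarrow> (p, i) \<in> (if i < m then C else X)"
    "(p, Eb j) \<in> Y \<longleftrightarrow> (j \<in> e) \<noteq> (j < t \<and> parity U X p j)"
    "(p, Key q) \<in> Y \<longleftrightarrow> bit \<kappa> q" "(p, Rnd j i) \<in> Y \<longleftrightarrow> (j, i) \<in> U" "(p, Chn j) \<notin> Y" for p i j q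
    using C by (auto simp: Y_def in_first_half[OF a U] cells_def)
  define Z where "Z = add_parities [t..<2 * t] Y"
  have par: "odd (card {i. i < m \<and> (p, Rnd j i) \<in> Y \<and> (p, Dat i) \<in> Y}) \<longleftrightarrow> parity U C p j" for p j
    unfolding parity_def Y by (auto intro!: arg_cong[where f = "\<lambda>A. odd (card A)"] cong: conj_cong)
  have Z: "(p, Dat i) \<in> Z \<longleftrightarrow> (p, i) \<in> (if i < m then C else X)"
    "(p, Eb j) \<in> Z \<longleftrightarrow> (j \<in> e) \<noteq> (j < 2 * t \<and> parity U (if j < t then X else C) p j)"
    "(p, Key q) \<in> Z \<longleftrightarrow> bit \<kappa> q" "(p, Rnd j i) \<in> Z \<longleftrightarrow> (j, i) \<in> U" "(p, Chn j) \<notin> Z" for p i j q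
    unfolding Z_def in_add_parities[OF distinct_upt] par by (auto simp: Y)
  define S where "S = send_syndrome Z"
  have S: "(p, Dat i) \<in> S \<longleftrightarrow> (p, i) \<in> (if i < m then C else X)"
    "(p, Key q) \<in> S \<longleftrightarrow> bit \<kappa> q" "(p, Rnd j i) \<in> S \<longleftrightarrow> (j, i) \<in> U" "(p, Chn j) \<notin> S"
    "(Bob, Eb j) \<in> S \<longleftrightarrow> (Bob, Eb j) \<in> Z"
    "(Alice, Eb j) \<in> S \<longleftrightarrow> j < 2 * t \<and> parity U (if j < t then X else C) Alice j \<noteq> parity U (if j < t then X else C) Bob j" for p i j q
    unfolding S_def in_send_syndrome using e by (auto simp: Z)
  have "(p, r) \<in> second_half Y \<longleftrightarrow> (p, r) \<in> final (X, e, \<kappa>) U C" for p r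
    unfolding second_half_def Z_def[symmetric] S_def[symmetric]
    by (subst in_collect) (use e in \<open>cases p; cases r; auto simp: S Z\<close>)+
  then show "second_half Y = final (X, e, \<kappa>) U C" by auto
  show "j < 2 * t \<Longrightarrow> (Bob, Eb j) \<in> add_parities [t..<2 * t] Y \<longleftrightarrow> (Bob, Eb j) \<in> final (X, e, \<kappa>) U C"
    unfolding Z_def[symmetric] by (auto simp: Z)
qed

text \<open>Without record wires the only retained value is 0. The kept bits below the key bits give
  the output value \<open>c + 2 ^ m * \<kappa>\<close>, so that equal kept bits and equal keys of
  both parties form the maximally entangled state of dimension
  \<open>2 ^ m * K\<^sub>0\<close>.\<close>

definition circuit :: locc_circuit where
  "circuit = \<lparr>alice_wires = width, bob_wires = width, instructions = circuit_instructions,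
     fail_wire = pos (Chn (2 * t)), record_wires = [],
     alice_out = map pos (map Dat [0..<m] @ map Key [0..<len]),
     bob_out = map pos (map Dat [0..<m] @ map Key [0..<len])\<rparr>"

text \<open>A sum over pairs of paths. The random bits \<open>U\<close> are common to ket and bra
  since they were measured, whereas the Hadamard values \<open>C\<close> and \<open>D\<close>
  interfere.\<close>

definition amplitude_sum ::
  "((party \<times> role) set \<Rightarrow> (party \<times> role) set \<Rightarrow> complex) \<Rightarrow> (party \<times> nat) set \<times> nat set \<times> nat \<Rightarrow>
    (party \<times> nat) set \<times> nat set \<times> nat \<Rightarrow> complex" where
  "amplitude_sum \<chi> a b = (\<Sum>U\<in>Pow pairs. \<Sum>C\<in>Pow cells. \<Sum>D\<in>Pow cells.
     (- 1) ^ (card (C \<inter> fst a) + card (D \<inter> fst b)) *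
     (of_bool (\<forall>j<2 * t. (Bob, Eb j) \<in> final a U C \<longleftrightarrow> (Bob, Eb j) \<in> final b U D) *
      \<chi> (final a U C) (final b U D)))"

lemma finite_pairs [simp]: "finite pairs" and finite_cells [simp]: "finite cells"
  by (simp_all add: pairs_def cells_def)

lemma card_pairs: "card pairs = 2 * t * m" and card_cells: "card cells = 2 * m"
  by (simp_all add: pairs_def cells_def UNIV_party card_cartesian_product)

text \<open>The denominator collects the amplitudes of the auxiliary state, one Hadamard gate for
  each of the \<open>2 * t * m\<close> random bits and one for each of the \<open>m\<close> kept
  qubits of both parties.\<close>

lemma pairing_final_state:
  "pairing \<chi> (final_state N K circuit \<rho>) =
    (\<Sum>a\<in>inputs. \<Sum>b\<in>inputs. amplitude_sum \<chi> a b * \<rho> $$ (data_idx (fst a), data_idx (fst b))) /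
    (of_nat K * 2 ^ (2 * t * m) * 2 ^ (2 * m))"
proof -
  define \<chi>\<^sub>2 where "\<chi>\<^sub>2 = (\<lambda>Z Y.
        of_bool (\<forall>j<2 * t. (Bob, Eb j) \<in> add_parities [t..<2 * t] Z \<longleftrightarrow> (Bob, Eb j) \<in> add_parities [t..<2 * t] Y) *
        \<chi> (second_half Z) (second_half Y))"
  define \<chi>\<^sub>1 where "\<chi>\<^sub>1 = (\<lambda>Z Y. of_bool (\<forall>v\<in>set rnd_wires. v \<in> Z \<longleftrightarrow> v \<in> Y) *
      hadamard_kernel (set dat_wires) \<chi>\<^sub>2 (first_half Z) (first_half Y))"
  have inj: "inj_on (\<lambda>(j, i). (Alice, Rnd j i)) pairs" "inj_on (\<lambda>(p :: party, i). (p, Dat i)) cells"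
    by (auto simp: inj_on_def)
  have cw: "card (set rnd_wires) = 2 * t * m" "card (set dat_wires) = 2 * m"
    using card_image[OF inj(1)] card_image[OF inj(2)] card_pairs card_cells
    by (simp_all add: set_rnd_wires set_dat_wires)
  have val: "hadamard_kernel (set rnd_wires) \<chi>\<^sub>1 (encoded a) (encoded b) =
      amplitude_sum \<chi> a b / (2 ^ (2 * t * m) * 2 ^ (2 * m))" if ab: "a \<in> inputs" "b \<in> inputs" for a b
  proof -
    obtain X e \<kappa> X' e' \<kappa>' where a: "a = (X, e, \<kappa>)" and b: "b = (X', e', \<kappa>')" by (metis prod_cases3)
    note a' = ab(1)[unfolded a] and b' = ab(2)[unfolded b]
    \<comment> \<open>The wires for the random bits start in state 0, so their Hadamard gates
      produce no signs.\<close>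
    have card0: "card (rnd_img U \<inter> encoded a) = 0" "card (rnd_img U \<inter> encoded b) = 0" for U
      by (auto simp: a b intro!: arg_cong[where f = card and y = "{}", simplified])
    have diff: "encoded a - rnd_img pairs \<union> rnd_img U = encoded a \<union> rnd_img U"
      "encoded b - rnd_img pairs \<union> rnd_img U = encoded b \<union> rnd_img U" for U
      by (auto simp: a b)
    have cardD: "card (dat_img C \<inter> first_half (encoded (Y, f, \<mu>) \<union> rnd_img U)) = card (C \<inter> Y)"
      if "(Y, f, \<mu>) \<in> inputs" "U \<subseteq> pairs" "C \<subseteq> cells" for Y f \<mu> U C
    proof -
      have "dat_img C \<inter> first_half (encoded (Y, f, \<mu>) \<union> rnd_img U) = (\<lambda>(p, i). (p, Dat i)) ` (C \<inter> Y)"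
        using in_first_half(1)[OF that(1,2)] by (auto simp: dat_img_def)
      then show ?thesis using inj_on_subset[OF inj(2), of "C \<inter> Y"] that(3) by (simp add: card_image le_infI1)
    qed
    have inner: "hadamard_kernel (set dat_wires) \<chi>\<^sub>2 (first_half (encoded a \<union> rnd_img U)) (first_half (encoded b \<union> rnd_img U)) =
      (\<Sum>C\<in>Pow cells. \<Sum>D\<in>Pow cells. (- 1) ^ (card (C \<inter> fst a) + card (D \<inter> fst b)) *
       (of_bool (\<forall>j<2 * t. (Bob, Eb j) \<in> final a U C \<longleftrightarrow> (Bob, Eb j) \<in> final b U D) *
        \<chi> (final a U C) (final b U D))) / 2 ^ (2 * m)" if U: "U \<subseteq> pairs" for U
    proof -
      have "\<chi>\<^sub>2 (first_half (encoded a \<union> rnd_img U) - dat_img cells \<union> dat_img C)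
          (first_half (encoded b \<union> rnd_img U) - dat_img cells \<union> dat_img D) =
        of_bool (\<forall>j<2 * t. (Bob, Eb j) \<in> final a U C \<longleftrightarrow> (Bob, Eb j) \<in> final b U D) *
          \<chi> (final a U C) (final b U D)" if "C \<subseteq> cells" "D \<subseteq> cells" for C D
        unfolding \<chi>\<^sub>2_def a b path(1)[OF a' U that(1)] path(1)[OF b' U that(2)]
        using path(2)[OF a' U that(1)] path(2)[OF b' U that(2)] by simp
      then show ?thesis
        unfolding hadamard_kernel_def cw unfolding set_dat_wires sum_Pow_image[OF inj(2)]
        unfolding dat_img_def[symmetric]
        using cardD[OF a' U] cardD[OF b' U] by (simp add: a b)
    qed
    have "hadamard_kernel (set rnd_wires) \<chi>\<^sub>1 (encoded a) (encoded b) =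
      (\<Sum>U\<in>Pow pairs. \<Sum>V\<in>Pow pairs. \<chi>\<^sub>1 (encoded a \<union> rnd_img U) (encoded b \<union> rnd_img V)) / 2 ^ (2 * t * m)"
      unfolding hadamard_kernel_def cw unfolding set_rnd_wires sum_Pow_image[OF inj(1)]
      unfolding rnd_img_def[symmetric] card0 diff by simp
    \<comment> \<open>Announcing the random bits dephases them and identifies those of ket and
      bra.\<close>
    also have "\<dots> = (\<Sum>U\<in>Pow pairs. \<Sum>V\<in>Pow pairs. if V = U then
       hadamard_kernel (set dat_wires) \<chi>\<^sub>2 (first_half (encoded a \<union> rnd_img U)) (first_half (encoded b \<union> rnd_img U)) else 0) / 2 ^ (2 * t * m)"
    proof (intro arg_cong2[where f = "(/)"] sum.cong refl)
      fix U V assume UV: "U \<in> Pow pairs" "V \<in> Pow pairs"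
      have "(\<forall>v\<in>set rnd_wires. v \<in> encoded a \<union> rnd_img U \<longleftrightarrow> v \<in> encoded b \<union> rnd_img V) \<longleftrightarrow> V = U"
      proof
        assume h: "\<forall>v\<in>set rnd_wires. v \<in> encoded a \<union> rnd_img U \<longleftrightarrow> v \<in> encoded b \<union> rnd_img V"
        have "(j, i) \<in> U \<longleftrightarrow> (j, i) \<in> V" if "(j, i) \<in> pairs" for j i
          using bspec[OF h, of "(Alice, Rnd j i)"] that by (auto simp: a b set_wires_img)
        then show "V = U" using UV by auto
      qed (auto simp: a b set_wires_img)
      then show "\<chi>\<^sub>1 (encoded a \<union> rnd_img U) (encoded b \<union> rnd_img V) = (if V = U then
       hadamard_kernel (set dat_wires) \<chi>\<^sub>2 (first_half (encoded a \<union> rnd_img U)) (first_half (encoded b \<union> rnd_img U)) else 0)"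
        by (simp add: \<chi>\<^sub>1_def)
    qed
    also have "\<dots> = (\<Sum>U\<in>Pow pairs.
       hadamard_kernel (set dat_wires) \<chi>\<^sub>2 (first_half (encoded a \<union> rnd_img U)) (first_half (encoded b \<union> rnd_img U))) / 2 ^ (2 * t * m)"
      by (intro arg_cong2[where f = "(/)"] sum.cong refl, subst sum.delta) auto
    also have "\<dots> = amplitude_sum \<chi> a b / (2 ^ (2 * t * m) * 2 ^ (2 * m))"
      unfolding amplitude_sum_def by (simp add: inner sum_divide_distrib[symmetric])
    finally show ?thesis .
  qed
  have car: "sandwich (kron (encode width N K) (encode width N K)) (gepp_input N K \<rho>) \<in> states"
    by (rule sandwich_carrier[OF kron_carrier[OF encode_carrier encode_carrier]])
  have "pairing \<chi> (final_state N K circuit \<rho>) =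
    pairing \<chi> (fold step circuit_instructions (sandwich (kron (encode width N K) (encode width N K)) (gepp_input N K \<rho>)))"
    by (simp add: final_state_def Let_def circuit_def)
  also have "\<dots> = pairing (hadamard_kernel (set rnd_wires) \<chi>\<^sub>1) (sandwich (kron (encode width N K) (encode width N K)) (gepp_input N K \<rho>))"
    unfolding pairing_circuit[OF car] \<chi>\<^sub>1_def \<chi>\<^sub>2_def ..
  also have "\<dots> = (\<Sum>a\<in>inputs. \<Sum>b\<in>inputs. amplitude_sum \<chi> a b / (2 ^ (2 * t * m) * 2 ^ (2 * m)) *
      \<rho> $$ (data_idx (fst a), data_idx (fst b))) / of_nat K"
    unfolding pairing_initial by (simp add: val)
  finally show ?thesis by (simp add: sum_divide_distrib mult_ac)
qed

end

subsection \<open>Character sums\<close>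

text \<open>Orthogonality of the characters of the group of subsets under symmetric difference; each
  element of \<open>S\<close> contributes a factor 2 or 0.\<close>

lemma character_sum:
  assumes "finite S"
  shows "(\<Sum>A\<in>Pow S. (- 1) ^ card (A \<inter> x)) = (2 ^ card S * of_bool (S \<inter> x = {}) :: complex)"
  using assms
proof (induction S rule: finite_induct)
  case (insert a S)
  have "(\<Sum>A\<in>Pow (insert a S). (- 1) ^ card (A \<inter> x)) =
      (\<Sum>A\<in>Pow {a}. \<Sum>B\<in>Pow S. (- 1) ^ card ((A \<union> B) \<inter> x) :: complex)"
    using insert sum_Pow_Un[of "{a}" S "\<lambda>A. (- 1) ^ card (A \<inter> x) :: complex"] by simp
  also have "\<dots> = (\<Sum>B\<in>Pow S. (- 1) ^ card (B \<inter> x)) + (\<Sum>B\<in>Pow S. (- 1) ^ card (insert a B \<inter> x))"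
    by (simp add: Pow_insert)
  also have "(\<Sum>B\<in>Pow S. (- 1) ^ card (insert a B \<inter> x)) = (\<Sum>B\<in>Pow S. (- 1) ^ of_bool (a \<in> x) * (- 1) ^ card (B \<inter> x) :: complex)"
  proof (intro sum.cong refl)
    fix B assume "B \<in> Pow S"
    then have "finite (B \<inter> x)" "a \<notin> B \<inter> x" using insert finite_subset by auto
    then show "(- 1 :: complex) ^ card (insert a B \<inter> x) = (- 1) ^ of_bool (a \<in> x) * (- 1) ^ card (B \<inter> x)"
      by (cases "a \<in> x") auto
  qed
  finally show ?case
    using insert by (cases "a \<in> x") (auto simp: sum_negf)
qed simp

definition sd :: "'a set \<Rightarrow> 'a set \<Rightarrow> 'a set" where
  "sd X Y = {a. (a \<in> X) \<noteq> (a \<in> Y)}"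

lemma even_card_sd:
  assumes "finite C"
  shows "even (card (C \<inter> sd X Y)) \<longleftrightarrow> even (card (C \<inter> X) + card (C \<inter> Y))"
proof -
  have "card (C \<inter> X) = card (C \<inter> X \<inter> Y) + card (C \<inter> (X - Y))"
    "card (C \<inter> Y) = card (C \<inter> X \<inter> Y) + card (C \<inter> (Y - X))"
    "card (C \<inter> sd X Y) = card (C \<inter> (X - Y)) + card (C \<inter> (Y - X))"
    using assms by (subst card_Un_disjoint[symmetric]; auto simp: sd_def intro!: arg_cong[where f = card])+
  then have "card (C \<inter> X) + card (C \<inter> Y) = card (C \<inter> sd X Y) + 2 * card (C \<inter> X \<inter> Y)" by simp
  then show ?thesis by simp
qed

lemma sign_sd:
  "finite C \<Longrightarrow> (- 1) ^ (card (C \<inter> X) + card (C \<inter> Y)) = ((- 1) ^ card (C \<inter> sd X Y) :: complex)"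
  using even_card_sd[of C X Y] by (metis neg_one_even_power neg_one_odd_power)

text \<open>The hashing property: a uniformly random subset meets a fixed nonempty one in an even
  number of elements with probability 1/2. The indicator of evenness is the mean of the trivial
  character and the sign.\<close>

lemma sum_even_intersections:
  assumes "finite S"
  shows "(\<Sum>A\<in>Pow S. of_bool (even (card (A \<inter> x)))) = (2 ^ card S * (if S \<inter> x = {} then 1 else 1 / 2) :: complex)"
proof -
  have "(of_bool (even k) :: complex) = (1 + (- 1) ^ k) / 2" for k :: nat by auto
  then have "(\<Sum>A\<in>Pow S. of_bool (even (card (A \<inter> x)))) = ((\<Sum>A\<in>Pow S. 1) + (\<Sum>A\<in>Pow S. (- 1) ^ card (A \<inter> x)) :: complex) / 2"
    by (simp only: sum.distrib[symmetric] sum_divide_distrib)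
  then show ?thesis using assms by (auto simp: character_sum card_Pow)
qed

text \<open>Different rows of the random matrix are independent, so each of them halves the chance
  of missing a nonempty error.\<close>

lemma sum_even_rows:
  assumes "finite J" "x \<subseteq> {..<m}"
  shows "(\<Sum>U\<in>Pow (J \<times> {..<m}). of_bool (\<forall>j\<in>J. even (card {i. i < m \<and> (j, i) \<in> U \<and> i \<in> x}))) =
    (2 ^ (card J * m) * (if x = {} then 1 else 1 / 2 ^ card J) :: complex)"
  using assms(1)
proof (induction J rule: finite_induct)
  case (insert j J)
  let ?row = "\<lambda>j U. even (card {i. i < m \<and> (j, i) \<in> U \<and> i \<in> x})"
  have split: "insert j J \<times> {..<m} = {j} \<times> {..<m} \<union> J \<times> {..<m}" by auto
  have disj: "{j} \<times> {..<m} \<inter> J \<times> {..<m} = {}" using insert by auto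
  have "(\<Sum>U\<in>Pow (insert j J \<times> {..<m}). of_bool (\<forall>j\<in>insert j J. ?row j U)) =
    (\<Sum>A\<in>Pow ({j} \<times> {..<m}). \<Sum>B\<in>Pow (J \<times> {..<m}). of_bool (?row j A) * (of_bool (\<forall>j\<in>J. ?row j B) :: complex))"
    unfolding split sum_Pow_Un[OF disj]
  proof (intro sum.cong refl)
    fix A B assume A: "A \<in> Pow ({j} \<times> {..<m})" and B: "B \<in> Pow (J \<times> {..<m})"
    have "{i. i < m \<and> (j, i) \<in> A \<union> B \<and> i \<in> x} = {i. i < m \<and> (j, i) \<in> A \<and> i \<in> x}"
      using insert(2) B by auto
    moreover have "{i. i < m \<and> (j', i) \<in> A \<union> B \<and> i \<in> x} = {i. i < m \<and> (j', i) \<in> B \<and> i \<in> x}" if "j' \<in> J" for j'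
      using insert(2) A that by auto
    ultimately show "(of_bool (\<forall>j\<in>insert j J. ?row j (A \<union> B)) :: complex) = of_bool (?row j A) * of_bool (\<forall>j\<in>J. ?row j B)"
      by simp
  qed
  also have "\<dots> = (\<Sum>A\<in>Pow ({j} \<times> {..<m}). of_bool (?row j A)) * (\<Sum>B\<in>Pow (J \<times> {..<m}). of_bool (\<forall>j\<in>J. ?row j B))"
    by (simp only: sum_product)
  also have "(\<Sum>A\<in>Pow ({j} \<times> {..<m}). of_bool (?row j A)) = (\<Sum>A\<in>Pow {..<m}. of_bool (even (card (A \<inter> x))) :: complex)"
  proof -
    have "{j} \<times> {..<m} = Pair j ` {..<m}" by auto
    moreover have "inj_on (Pair j) {..<m}" by (simp add: inj_on_def)
    ultimately have "(\<Sum>A\<in>Pow ({j} \<times> {..<m}). of_bool (?row j A)) = (\<Sum>A\<in>Pow {..<m}. of_bool (?row j (Pair j ` A)) :: complex)"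
      by (simp only: sum_Pow_image)
    also have "\<dots> = (\<Sum>A\<in>Pow {..<m}. of_bool (even (card (A \<inter> x))))"
    proof (intro sum.cong refl)
      fix A assume "A \<in> Pow {..<m}"
      then have "{i. i < m \<and> (j, i) \<in> Pair j ` A \<and> i \<in> x} = A \<inter> x" by auto
      then show "(of_bool (?row j (Pair j ` A)) :: complex) = of_bool (even (card (A \<inter> x)))" by simp
    qed
    finally show ?thesis .
  qed
  also have "\<dots> = 2 ^ m * (if x = {} then 1 else 1 / 2)"
    using assms(2) by (subst sum_even_intersections) (auto simp: Int_absorb1)
  finally show ?case
    using insert by (simp add: power_add)
qed simp

text \<open>The one-time pad of the EPR pairs: whatever parities \<open>p\<close> and
  \<open>q\<close> are added, every \<open>e\<close> has exactly one matching \<open>f\<close>.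
  Hence the measurement of Bob's halves discloses nothing about the data.\<close>

lemma sum_matching:
  fixes p q :: "nat \<Rightarrow> bool"
  shows "(\<Sum>e\<in>Pow {..<k}. \<Sum>f\<in>Pow {..<k}. of_bool (\<forall>j<k. ((j \<in> e) \<noteq> p j) = ((j \<in> f) \<noteq> q j))) = (2 ^ k :: complex)"
proof -
  have "(\<Sum>f\<in>Pow {..<k}. of_bool (\<forall>j<k. ((j \<in> e) \<noteq> p j) = ((j \<in> f) \<noteq> q j))) = (1 :: complex)"
    if "e \<in> Pow {..<k}" for e
  proof -
    have "(\<forall>j<k. ((j \<in> e) \<noteq> p j) = ((j \<in> f) \<noteq> q j)) \<longleftrightarrow> f = {j. j < k \<and> ((j \<in> e) \<noteq> p j) \<noteq> q j}"
      if "f \<in> Pow {..<k}" for f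
      using that by (auto simp: set_eq_iff)
    then have "(\<Sum>f\<in>Pow {..<k}. of_bool (\<forall>j<k. ((j \<in> e) \<noteq> p j) = ((j \<in> f) \<noteq> q j))) =
        (\<Sum>f\<in>Pow {..<k}. if f = {j. j < k \<and> ((j \<in> e) \<noteq> p j) \<noteq> q j} then 1 else 0 :: complex)"
      by (intro sum.cong refl) auto
    then show ?thesis by (subst (asm) sum.delta) auto
  qed
  then show ?thesis by (simp add: card_Pow)
qed

section \<open>Averages over the random strings and over the Hadamard paths\<close>

context hashing
begin

text \<open>The bit errors on the kept qubits.\<close>

definition xi :: "(party \<times> nat) set \<Rightarrow> nat set" where
  "xi X = {i. i < m \<and> ((Alice, i) \<in> X) \<noteq> ((Bob, i) \<in> X)}"

definition ok :: "nat set \<Rightarrow> (nat \<times> nat) set \<Rightarrow> (party \<times> nat) set \<Rightarrow> bool" where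
  "ok J U X \<longleftrightarrow> (\<forall>j\<in>J. parity U X Alice j = parity U X Bob j)"

text \<open>The probability that \<open>t\<close> random parities of the bit errors are all
  even.\<close>

definition weight :: "(party \<times> nat) set \<Rightarrow> complex" where
  "weight X = (if xi X = {} then 1 else 1 / 2 ^ t)"

lemma xi_subset: "xi X \<subseteq> {..<m}"
  by (auto simp: xi_def)

text \<open>Parity is additive: the parities of Alice and Bob differ by the parity of the positions
  at which their bits disagree.\<close>

lemma parity_eq_iff: "parity U X Alice j = parity U X Bob j \<longleftrightarrow> even (card {i. i < m \<and> (j, i) \<in> U \<and> i \<in> xi X})"
proof -
  define C where "C = {i. i < m \<and> (j, i) \<in> U}"
  define A where "A = {i. (Alice, i) \<in> X}"
  define B where "B = {i. (Bob, i) \<in> X}"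
  have "finite C" by (simp add: C_def)
  moreover have "{i. i < m \<and> (j, i) \<in> U \<and> (Alice, i) \<in> X} = C \<inter> A" "{i. i < m \<and> (j, i) \<in> U \<and> (Bob, i) \<in> X} = C \<inter> B"
    "{i. i < m \<and> (j, i) \<in> U \<and> i \<in> xi X} = C \<inter> sd A B"
    by (auto simp: A_def B_def C_def xi_def sd_def)
  ultimately show ?thesis
    using even_card_sd[of C A B] unfolding parity_def by simp
qed

lemma ok_xi_empty: "xi X = {} \<Longrightarrow> ok J U X"
  by (simp add: ok_def parity_eq_iff)

lemma ok_xi_cong: "xi X = xi Y \<Longrightarrow> ok J U X = ok J U Y"
  by (simp add: ok_def parity_eq_iff)

lemma sum_ok:
  assumes "finite J" "card J = t"
  shows "(\<Sum>U\<in>Pow (J \<times> {..<m}). of_bool (ok J U X)) = 2 ^ (t * m) * weight X"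
  unfolding ok_def parity_eq_iff sum_even_rows[OF assms(1) xi_subset] by (simp add: weight_def assms(2))

text \<open>The strings of the bit tests and those of the phase tests are independent.\<close>

lemma sum_pairs:
  "(\<Sum>U\<in>Pow pairs. f U) = (\<Sum>V\<in>Pow ({..<t} \<times> {..<m}). \<Sum>W\<in>Pow ({t..<2 * t} \<times> {..<m}). f (V \<union> W))"
proof -
  have pairs: "pairs = {..<t} \<times> {..<m} \<union> {t..<2 * t} \<times> {..<m}" by (auto simp: pairs_def)
  have "({..<t} \<times> {..<m}) \<inter> ({t..<2 * t} \<times> {..<m}) = {}" by auto
  then show ?thesis unfolding pairs by (rule sum_Pow_Un)
qed

lemma ok_left: "W \<subseteq> {t..<2 * t} \<times> {..<m} \<Longrightarrow> ok {..<t} (V \<union> W) X = ok {..<t} V X"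
  and ok_right: "V \<subseteq> {..<t} \<times> {..<m} \<Longrightarrow> ok {t..<2 * t} (V \<union> W) X = ok {t..<2 * t} W X"
proof -
  have *: "parity (V \<union> W) X p j = parity V X p j" if "\<forall>i. (j, i) \<notin> W" for V W X p j
    using that by (simp add: parity_def)
  have **: "parity (V \<union> W) X p j = parity W X p j" if "\<forall>i. (j, i) \<notin> V" for V W X p j
    using that by (simp add: parity_def)
  show "ok {..<t} (V \<union> W) X = ok {..<t} V X" if "W \<subseteq> {t..<2 * t} \<times> {..<m}"
    unfolding ok_def using that by (intro ball_cong refl) (subst (1 2) *, auto)
  show "ok {t..<2 * t} (V \<union> W) X = ok {t..<2 * t} W X" if "V \<subseteq> {..<t} \<times> {..<m}"
    unfolding ok_def using that by (intro ball_cong refl) (subst (1 2) **, auto)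
qed

text \<open>Applying the Hadamard transform and undoing it gives the identity on the kept
  qubits.\<close>

lemma sum_signs:
  "(\<Sum>C\<in>Pow cells. (- 1) ^ (card (C \<inter> X) + card (C \<inter> Y))) = (2 ^ (2 * m) * of_bool (X \<inter> cells = Y \<inter> cells) :: complex)"
proof -
  have "(\<Sum>C\<in>Pow cells. (- 1) ^ (card (C \<inter> X) + card (C \<inter> Y))) = (\<Sum>C\<in>Pow cells. (- 1) ^ card (C \<inter> sd X Y) :: complex)"
    using finite_cells by (intro sum.cong refl sign_sd) (auto intro: finite_subset)
  moreover have "cells \<inter> sd X Y = {} \<longleftrightarrow> X \<inter> cells = Y \<inter> cells" by (auto simp: sd_def)
  ultimately show ?thesis by (simp add: character_sum card_cells)
qed

text \<open>The Hadamard transform of the indicator of equal bits is again supported on equal bits.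
  In other words, the maximally entangled state is fixed by Hadamard gates on both sides.\<close>

lemma sum_diag_signs:
  "(\<Sum>C\<in>Pow cells. (- 1) ^ card (C \<inter> X) * of_bool (xi C = {})) = (2 ^ m * of_bool (xi X = {}) :: complex)"
proof -
  have diag: "{C \<in> Pow cells. xi C = {}} = (\<lambda>c. UNIV \<times> c) ` Pow {..<m}"
  proof (intro equalityI subsetI)
    fix C assume C: "C \<in> {C \<in> Pow cells. xi C = {}}"
    have "(p, i) \<in> C \<longleftrightarrow> (Alice, i) \<in> C" for p i
      using C by (cases p) (auto simp: xi_def cells_def)
    then have "C = UNIV \<times> {i. (Alice, i) \<in> C}" by auto
    moreover have "{i. (Alice, i) \<in> C} \<in> Pow {..<m}" using C by (auto simp: cells_def)
    ultimately show "C \<in> (\<lambda>c. UNIV \<times> c) ` Pow {..<m}" by blast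
  qed (auto simp: cells_def xi_def)
  have "(\<Sum>C\<in>Pow cells. (- 1) ^ card (C \<inter> X) * of_bool (xi C = {})) =
      (\<Sum>C\<in>{C \<in> Pow cells. xi C = {}}. (- 1) ^ card (C \<inter> X) :: complex)"
    by (intro sum.mono_neutral_cong_right) auto
  also have "\<dots> = (\<Sum>c\<in>Pow {..<m}. (- 1) ^ card (((UNIV :: party set) \<times> c) \<inter> X))"
    unfolding diag by (subst sum.reindex) (auto simp: inj_on_def)
  also have "\<dots> = (\<Sum>c\<in>Pow {..<m}. (- 1) ^ card (c \<inter> xi X))"
  proof (intro sum.cong refl)
    fix c assume c: "c \<in> Pow {..<m}"
    then have fin: "finite c" using finite_subset by auto
    define A where "A = {i. (Alice, i) \<in> X}"
    define B where "B = {i. (Bob, i) \<in> X}"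
    have "((UNIV :: party set) \<times> c) \<inter> X = Pair Alice ` (c \<inter> A) \<union> Pair Bob ` (c \<inter> B)"
      by (auto simp: UNIV_party A_def B_def)
    then have "card (((UNIV :: party set) \<times> c) \<inter> X) = card (c \<inter> A) + card (c \<inter> B)"
      using fin by (simp add: card_Un_disjoint card_image inj_on_def disjoint_iff image_iff)
    moreover have "c \<inter> xi X = c \<inter> sd A B" using c by (auto simp: xi_def sd_def A_def B_def)
    ultimately show "(- 1 :: complex) ^ card (((UNIV :: party set) \<times> c) \<inter> X) = (- 1) ^ card (c \<inter> xi X)"
      using sign_sd[OF fin, of A B] by simp
  qed
  also have "\<dots> = 2 ^ m * of_bool (xi X = {})"
    using xi_subset[of X] by (simp add: character_sum Int_absorb1)
  finally show ?thesis .
qed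

lemma xi_sd: "xi (sd X Y) = {} \<longleftrightarrow> xi X = xi Y"
  by (auto simp: xi_def sd_def set_eq_iff)

text \<open>\<open>weight\<close> is 1 / 2^t plus 1 - 1 / 2^t times the indicator of no errors.
  Under the transform the constant becomes a multiple of the identity by \<open>sum_signs\<close>,
  and the indicator becomes constant on pairs with equal bit errors by
  \<open>sum_diag_signs\<close>.\<close>

lemma sum_weight_signs:
  "(\<Sum>C\<in>Pow cells. (- 1) ^ (card (C \<inter> X) + card (C \<inter> Y)) * weight C) =
    1 / 2 ^ t * 2 ^ (2 * m) * of_bool (X \<inter> cells = Y \<inter> cells) + (1 - 1 / 2 ^ t) * 2 ^ m * of_bool (xi X = xi Y)"
proof -
  have "(- 1) ^ (card (C \<inter> X) + card (C \<inter> Y)) * weight C =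
      1 / 2 ^ t * (- 1) ^ (card (C \<inter> X) + card (C \<inter> Y)) + (1 - 1 / 2 ^ t) * ((- 1) ^ card (C \<inter> sd X Y) * of_bool (xi C = {}))"
    if "C \<in> Pow cells" for C
    using sign_sd[of C X Y] finite_subset[of C cells] that by (simp add: weight_def algebra_simps)
  then have "(\<Sum>C\<in>Pow cells. (- 1) ^ (card (C \<inter> X) + card (C \<inter> Y)) * weight C) =
      1 / 2 ^ t * (\<Sum>C\<in>Pow cells. (- 1) ^ (card (C \<inter> X) + card (C \<inter> Y))) +
      (1 - 1 / 2 ^ t) * (\<Sum>C\<in>Pow cells. (- 1) ^ card (C \<inter> sd X Y) * of_bool (xi C = {}))"
    by (simp only: sum.distrib sum_distrib_left cong: sum.cong)
  then show ?thesis unfolding sum_signs sum_diag_signs xi_sd by simp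
qed

text \<open>The bit tests see only \<open>X\<close> and \<open>Y\<close>, the phase tests only
  \<open>C\<close>, and their strings are independent. The sum therefore factorises into the average
  of the bit tests and \<open>sum_weight_signs\<close>.\<close>

lemma sum_pass:
  "(\<Sum>U\<in>Pow pairs. \<Sum>C\<in>Pow cells. (- 1) ^ (card (C \<inter> X) + card (C \<inter> Y)) *
      of_bool (ok {..<t} U X \<and> ok {..<t} U Y \<and> ok {t..<2 * t} U C)) =
    2 ^ (2 * t * m) * weight X *
      (1 / 2 ^ t * 2 ^ (2 * m) * of_bool (X \<inter> cells = Y \<inter> cells) + (1 - 1 / 2 ^ t) * 2 ^ m * of_bool (xi X = xi Y))"
proof -
  let ?P = "Pow ({..<t} \<times> {..<m})" and ?Q = "Pow ({t..<2 * t} \<times> {..<m})"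
  let ?S = "1 / 2 ^ t * 2 ^ (2 * m) * of_bool (X \<inter> cells = Y \<inter> cells) + (1 - 1 / 2 ^ t) * 2 ^ m * of_bool (xi X = xi Y) :: complex"
  have "(\<Sum>U\<in>Pow pairs. \<Sum>C\<in>Pow cells. (- 1) ^ (card (C \<inter> X) + card (C \<inter> Y)) *
      (of_bool (ok {..<t} U X \<and> ok {..<t} U Y \<and> ok {t..<2 * t} U C) :: complex)) =
    (\<Sum>V\<in>?P. \<Sum>W\<in>?Q. \<Sum>C\<in>Pow cells. of_bool (ok {..<t} V X \<and> ok {..<t} V Y) *
      ((- 1) ^ (card (C \<inter> X) + card (C \<inter> Y)) * of_bool (ok {t..<2 * t} W C)))"
    unfolding sum_pairs by (intro sum.cong refl) (auto simp: ok_left ok_right)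
  also have "\<dots> = (\<Sum>V\<in>?P. of_bool (ok {..<t} V X \<and> ok {..<t} V Y) * (\<Sum>W\<in>?Q. \<Sum>C\<in>Pow cells.
      (- 1) ^ (card (C \<inter> X) + card (C \<inter> Y)) * of_bool (ok {t..<2 * t} W C)))"
    by (simp only: sum_distrib_left)
  also have "(\<Sum>W\<in>?Q. \<Sum>C\<in>Pow cells. (- 1) ^ (card (C \<inter> X) + card (C \<inter> Y)) * (of_bool (ok {t..<2 * t} W C) :: complex)) =
     (\<Sum>C\<in>Pow cells. (- 1) ^ (card (C \<inter> X) + card (C \<inter> Y)) * (\<Sum>W\<in>?Q. of_bool (ok {t..<2 * t} W C)))"
    unfolding sum_distrib_left by (rule sum.swap)
  also have "\<dots> = 2 ^ (t * m) * ?S"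
  proof -
    have "(\<Sum>W\<in>?Q. of_bool (ok {t..<2 * t} W C)) = 2 ^ (t * m) * weight C" for C
      by (rule sum_ok) auto
    then show ?thesis
      unfolding sum_weight_signs[symmetric] sum_distrib_left by (intro sum.cong refl) simp
  qed
  \<comment> \<open>With equal bit errors the tests of \<open>X\<close> and \<open>Y\<close> have
    the same result. Otherwise the kept bits differ as well, and both terms of the factor
    \<open>?S\<close> vanish.\<close>
  also have "(\<Sum>V\<in>?P. of_bool (ok {..<t} V X \<and> ok {..<t} V Y) * (2 ^ (t * m) * ?S)) =
    (\<Sum>V\<in>?P. of_bool (ok {..<t} V X) * (2 ^ (t * m) * ?S))"
  proof (cases "xi X = xi Y")
    case True
    then show ?thesis using ok_xi_cong[OF True] by simp
  next
    case False
    then have "X \<inter> cells \<noteq> Y \<inter> cells" by (auto simp: xi_def cells_def set_eq_iff)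
    then show ?thesis using False by simp
  qed
  also have "\<dots> = 2 ^ (2 * t * m) * weight X * ?S"
  proof -
    have "(\<Sum>V\<in>?P. of_bool (ok {..<t} V X)) = 2 ^ (t * m) * weight X" by (rule sum_ok) auto
    then show ?thesis
      unfolding sum_distrib_right[symmetric] by (simp add: mult_2 add_mult_distrib power_add)
  qed
  finally show ?thesis .
qed

subsection \<open>Evaluation of the kernels\<close>

text \<open>The result of test j along a path; the random bit of the EPR pair has already
  cancelled.\<close>

definition flag :: "(nat \<times> nat) set \<Rightarrow> (party \<times> nat) set \<Rightarrow> (party \<times> nat) set \<Rightarrow> nat \<Rightarrow> bool" where
  "flag U X C j \<longleftrightarrow> parity U (if j < t then X else C) Alice j \<noteq> parity U (if j < t then X else C) Bob j"

definition bob_bit :: "(nat \<times> nat) set \<Rightarrow> (party \<times> nat) set \<Rightarrow> (party \<times> nat) set \<Rightarrow> nat \<Rightarrow> bool" where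
  "bob_bit U X C j = parity U (if j < t then X else C) Bob j"

abbreviation matching :: "nat set \<Rightarrow> nat set \<Rightarrow> (nat \<times> nat) set \<Rightarrow> (party \<times> nat) set \<Rightarrow> (party \<times> nat) set \<Rightarrow>
    (party \<times> nat) set \<Rightarrow> (party \<times> nat) set \<Rightarrow> bool" where
  "matching e f U X C Y D \<equiv> \<forall>j<2 * t. ((j \<in> e) \<noteq> bob_bit U X C j) = ((j \<in> f) \<noteq> bob_bit U Y D j)"

lemma in_final_Eb [simp]:
  "(Alice, Eb j) \<in> final (X, e, \<kappa>) U C \<longleftrightarrow> j < 2 * t \<and> flag U X C j"
  "(Bob, Eb j) \<in> final (X, e, \<kappa>) U C \<longleftrightarrow> j < 2 * t \<and> (j \<in> e) \<noteq> bob_bit U X C j"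
  "(p, Chn j) \<in> final (X, e, \<kappa>) U C \<longleftrightarrow> p = Alice \<and> j \<le> 2 * t \<and> (\<exists>i<j. flag U X C i)"
  by (auto simp: flag_def bob_bit_def)

declare in_final(2,3,6) [simp del]

lemma no_flag_iff: "(\<forall>j<2 * t. \<not> flag U X C j) \<longleftrightarrow> ok {..<t} U X \<and> ok {t..<2 * t} U C"
  unfolding ok_def flag_def
  by (auto simp: not_less split: if_splits)

text \<open>Two paths with the same random bits can end in the same state from different kept
  inputs. This is the interference between the values before the Hadamard gates, which are recorded
  only through parities.\<close>

lemma final_eq_iff:
  assumes "(X, e, \<kappa>) \<in> inputs" "(Y, f, \<mu>) \<in> inputs" "C \<subseteq> cells" "D \<subseteq> cells"
  shows "final (X, e, \<kappa>) U C = final (Y, f, \<mu>) U D \<longleftrightarrow>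
    C = D \<and> X - cells = Y - cells \<and> \<kappa> = \<mu> \<and> matching e f U X C Y D \<and> (\<forall>j<2 * t. flag U X C j = flag U Y D j)"
    (is "?L \<longleftrightarrow> ?R")
proof
  assume ?L
  then have mem: "v \<in> final (X, e, \<kappa>) U C \<longleftrightarrow> v \<in> final (Y, f, \<mu>) U D" for v by simp
  have "(p, i) \<in> C \<longleftrightarrow> (p, i) \<in> D" for p i
    using mem[of "(p, Dat i)"] assms(3,4) by (auto simp: cells_def split: if_splits)
  then have "C = D" by auto
  moreover have "(p, i) \<in> X - cells \<longleftrightarrow> (p, i) \<in> Y - cells" for p i
    using mem[of "(p, Dat i)"] by (auto simp: cells_def split: if_splits)
  then have "X - cells = Y - cells" by auto
  moreover have "\<kappa> = \<mu>" using mem[of "(Alice, Key q)" for q] by (intro bit_eqI) auto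
  moreover have "matching e f U X C Y D"
    using mem[of "(Bob, Eb j)" for j] by auto
  moreover have "\<forall>j<2 * t. flag U X C j = flag U Y D j"
    using mem[of "(Alice, Eb j)" for j] by auto
  ultimately show ?R by simp
next
  assume R: ?R
  then have X: "(p, i) \<in> X \<longleftrightarrow> (p, i) \<in> Y" if "\<not> i < m" for p i
    using that by (auto simp: cells_def set_eq_iff)
  have "(p, r) \<in> final (X, e, \<kappa>) U C \<longleftrightarrow> (p, r) \<in> final (Y, f, \<mu>) U D" for p r
    using R X by (cases r; cases p) auto
  then show ?L by auto
qed

definition aux_inputs :: "(nat set \<times> nat) set" where
  "aux_inputs = Pow {..<2 * t} \<times> {..<K\<^sub>0}"

text \<open>The contribution of a fixed pair of paths, summed over EPR strings and keys. The
  condition on \<open>matching\<close> is the dephasing of Bob's EPR halves.\<close>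

definition block :: "((party \<times> role) set \<Rightarrow> (party \<times> role) set \<Rightarrow> complex) \<Rightarrow> (nat \<times> nat) set \<Rightarrow>
    (party \<times> nat) set \<Rightarrow> (party \<times> nat) set \<Rightarrow> (party \<times> nat) set \<Rightarrow> (party \<times> nat) set \<Rightarrow> complex" where
  "block \<chi> U X C Y D = (\<Sum>u\<in>aux_inputs. \<Sum>v\<in>aux_inputs.
     of_bool (matching (fst u) (fst v) U X C Y D) * \<chi> (final (X, u) U C) (final (Y, v) U D))"

lemma pairing_block:
  "pairing \<chi> (final_state N K circuit \<rho>) =
    (\<Sum>X\<in>Pow data. \<Sum>Y\<in>Pow data. (\<Sum>U\<in>Pow pairs. \<Sum>C\<in>Pow cells. \<Sum>D\<in>Pow cells.
       (- 1) ^ (card (C \<inter> X) + card (D \<inter> Y)) * block \<chi> U X C Y D) * \<rho> $$ (data_idx X, data_idx Y)) /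
    (of_nat K * 2 ^ (2 * t * m) * 2 ^ (2 * m))"
proof -
  have inp: "inputs = Pow data \<times> aux_inputs" by (simp add: inputs_def aux_inputs_def)
  have amp: "(\<Sum>u\<in>aux_inputs. \<Sum>v\<in>aux_inputs. amplitude_sum \<chi> (X, u) (Y, v)) =
    (\<Sum>U\<in>Pow pairs. \<Sum>C\<in>Pow cells. \<Sum>D\<in>Pow cells. (- 1) ^ (card (C \<inter> X) + card (D \<inter> Y)) * block \<chi> U X C Y D)" for X Y
  proof -
    have "(\<Sum>u\<in>aux_inputs. \<Sum>v\<in>aux_inputs. amplitude_sum \<chi> (X, u) (Y, v)) =
      (\<Sum>u\<in>aux_inputs. \<Sum>v\<in>aux_inputs. \<Sum>(U, C, D)\<in>Pow pairs \<times> Pow cells \<times> Pow cells.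
        (- 1) ^ (card (C \<inter> X) + card (D \<inter> Y)) * (of_bool (matching (fst u) (fst v) U X C Y D) *
          \<chi> (final (X, u) U C) (final (Y, v) U D)))"
      unfolding amplitude_sum_def sum.cartesian_product[symmetric]
      by (intro sum.cong refl) (auto simp: aux_inputs_def)
    also have "\<dots> = (\<Sum>u\<in>aux_inputs. \<Sum>(U, C, D)\<in>Pow pairs \<times> Pow cells \<times> Pow cells. \<Sum>v\<in>aux_inputs.
        (- 1) ^ (card (C \<inter> X) + card (D \<inter> Y)) * (of_bool (matching (fst u) (fst v) U X C Y D) *
          \<chi> (final (X, u) U C) (final (Y, v) U D)))"
      unfolding case_prod_unfold by (intro sum.cong refl sum.swap)
    also have "\<dots> = (\<Sum>(U, C, D)\<in>Pow pairs \<times> Pow cells \<times> Pow cells. \<Sum>u\<in>aux_inputs. \<Sum>v\<in>aux_inputs.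
        (- 1) ^ (card (C \<inter> X) + card (D \<inter> Y)) * (of_bool (matching (fst u) (fst v) U X C Y D) *
          \<chi> (final (X, u) U C) (final (Y, v) U D)))"
      unfolding case_prod_unfold by (rule sum.swap)
    finally show ?thesis
      unfolding block_def sum_distrib_left sum.cartesian_product[symmetric] by simp
  qed
  let ?r = "\<lambda>X Y. \<rho> $$ (data_idx X, data_idx Y)"
  have "(\<Sum>a\<in>inputs. \<Sum>b\<in>inputs. amplitude_sum \<chi> a b * \<rho> $$ (data_idx (fst a), data_idx (fst b))) =
    (\<Sum>X\<in>Pow data. \<Sum>u\<in>aux_inputs. \<Sum>Y\<in>Pow data. \<Sum>v\<in>aux_inputs. amplitude_sum \<chi> (X, u) (Y, v) * ?r X Y)"
    unfolding inp sum.cartesian_product' by simp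
  also have "\<dots> = (\<Sum>X\<in>Pow data. \<Sum>Y\<in>Pow data. \<Sum>u\<in>aux_inputs. \<Sum>v\<in>aux_inputs. amplitude_sum \<chi> (X, u) (Y, v) * ?r X Y)"
    by (intro sum.cong refl sum.swap)
  also have "\<dots> = (\<Sum>X\<in>Pow data. \<Sum>Y\<in>Pow data. (\<Sum>U\<in>Pow pairs. \<Sum>C\<in>Pow cells. \<Sum>D\<in>Pow cells.
       (- 1) ^ (card (C \<inter> X) + card (D \<inter> Y)) * block \<chi> U X C Y D) * ?r X Y)"
    unfolding amp[symmetric] sum_distrib_right ..
  finally show ?thesis
    unfolding pairing_final_state
    by (rule arg_cong[where f = "\<lambda>x. x / (of_nat K * 2 ^ (2 * t * m) * 2 ^ (2 * m))"])
qed

text \<open>On matching pairs the kernels of interest split into a factor \<open>g\<close> free of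
  auxiliary data and a factor in the keys. The EPR strings then contribute
  \<open>2 ^ (2 * t)\<close> by \<open>sum_matching\<close>.\<close>

lemma block_eval:
  assumes "\<And>e f \<kappa> \<mu>. (X, e, \<kappa>) \<in> inputs \<Longrightarrow> (Y, f, \<mu>) \<in> inputs \<Longrightarrow> matching e f U X C Y D \<Longrightarrow>
      \<chi> (final (X, e, \<kappa>) U C) (final (Y, f, \<mu>) U D) = g * h \<kappa> \<mu>"
    and "X \<in> Pow data" "Y \<in> Pow data"
  shows "block \<chi> U X C Y D = 2 ^ (2 * t) * g * (\<Sum>\<kappa><K\<^sub>0. \<Sum>\<mu><K\<^sub>0. h \<kappa> \<mu>)"
proof -
  have "block \<chi> U X C Y D = (\<Sum>e\<in>Pow {..<2 * t}. \<Sum>\<kappa><K\<^sub>0. \<Sum>f\<in>Pow {..<2 * t}. \<Sum>\<mu><K\<^sub>0.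
      of_bool (matching e f U X C Y D) * (g * h \<kappa> \<mu>))"
    unfolding block_def aux_inputs_def sum.cartesian_product'
  proof (intro sum.cong refl)
    fix e \<kappa> f \<mu> assume "e \<in> Pow {..<2 * t}" "\<kappa> \<in> {..<K\<^sub>0}" "f \<in> Pow {..<2 * t}" "\<mu> \<in> {..<K\<^sub>0}"
    then have "(X, e, \<kappa>) \<in> inputs" "(Y, f, \<mu>) \<in> inputs" using assms(2,3) by (auto simp: inputs_def)
    from assms(1)[OF this]
    show "of_bool (matching (fst (e, \<kappa>)) (fst (f, \<mu>)) U X C Y D) * \<chi> (final (X, e, \<kappa>) U C) (final (Y, f, \<mu>) U D) =
        of_bool (matching e f U X C Y D) * (g * h \<kappa> \<mu>)" by (cases "matching e f U X C Y D") auto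
  qed
  also have "\<dots> = (\<Sum>e\<in>Pow {..<2 * t}. \<Sum>f\<in>Pow {..<2 * t}. \<Sum>\<kappa><K\<^sub>0. \<Sum>\<mu><K\<^sub>0.
      of_bool (matching e f U X C Y D) * (g * h \<kappa> \<mu>))"
    by (intro sum.cong refl sum.swap)
  also have "\<dots> = (\<Sum>e\<in>Pow {..<2 * t}. \<Sum>f\<in>Pow {..<2 * t}. of_bool (matching e f U X C Y D)) *
      (g * (\<Sum>\<kappa><K\<^sub>0. \<Sum>\<mu><K\<^sub>0. h \<kappa> \<mu>))"
  proof -
    have "(\<Sum>\<kappa><K\<^sub>0. \<Sum>\<mu><K\<^sub>0. c * (g * h \<kappa> \<mu>)) = c * (g * (\<Sum>\<kappa><K\<^sub>0. \<Sum>\<mu><K\<^sub>0. h \<kappa> \<mu>))" for c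
      by (simp only: sum_distrib_left)
    then show ?thesis by (simp only: sum_distrib_right)
  qed
  finally show ?thesis unfolding sum_matching by simp
qed

lemma sum_diag: "(\<Sum>\<kappa><K\<^sub>0. \<Sum>\<mu><K\<^sub>0. of_bool (\<kappa> = \<mu>)) = (of_nat K\<^sub>0 :: complex)"
proof -
  have "(\<Sum>\<mu><K\<^sub>0. of_bool (\<kappa> = \<mu>)) = (1 :: complex)" if "\<kappa> < K\<^sub>0" for \<kappa>
    using that sum.delta'[of "{..<K\<^sub>0}" \<kappa> "\<lambda>_. 1 :: complex"] by (simp add: of_bool_def)
  then show ?thesis by simp
qed

definition pass_kernel :: "(party \<times> role) set \<Rightarrow> (party \<times> role) set \<Rightarrow> complex" where
  "pass_kernel Z Y = of_bool (Z = Y \<and> (Alice, Chn (2 * t)) \<notin> Z)"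

definition trace_kernel :: "(party \<times> role) set \<Rightarrow> (party \<times> role) set \<Rightarrow> complex" where
  "trace_kernel Z Y = of_bool (Z = Y)"

definition out_roles :: "role list" where
  "out_roles = map Dat [0..<m] @ map Key [0..<len]"

text \<open>This is \<open>M\<close> times the projection onto the maximally entangled state of the
  output wires, restricted to success, with all other wires traced out.\<close>

definition fidelity_kernel :: "(party \<times> role) set \<Rightarrow> (party \<times> role) set \<Rightarrow> complex" where
  "fidelity_kernel Z Y = of_bool ((Alice, Chn (2 * t)) \<notin> Z \<and>
     (\<forall>v\<in>wires. snd v \<notin> set out_roles \<longrightarrow> (v \<in> Z \<longleftrightarrow> v \<in> Y)) \<and>
     val Alice out_roles Z = val Bob out_roles Z \<and> val Alice out_roles Z < M \<and>
     val Alice out_roles Y = val Bob out_roles Y \<and> val Alice out_roles Y < M)"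

lemma bit_val: "bit (val p rs Z) q \<longleftrightarrow> q < length rs \<and> (p, rs ! q) \<in> Z"
  by (auto simp: val_def bit_horner_sum_bit_iff)

text \<open>The bound below \<open>M\<close> needs \<kappa> < \<open>K\<^sub>0\<close> and not only
  the number of key bits; it is the reason why the output never leaves its range.\<close>

lemma val_final:
  assumes "(X, e, \<kappa>) \<in> inputs" "C \<subseteq> cells"
  shows "val p out_roles (final (X, e, \<kappa>) U C) = set_encode {i. (p, i) \<in> C} + 2 ^ m * \<kappa>"
    "val p out_roles (final (X, e, \<kappa>) U C) < M"
proof -
  have sub: "{i. (p, i) \<in> C} \<subseteq> {..<m}" using assms(2) by (auto simp: cells_def)
  then have fin: "finite {i. (p, i) \<in> C}" by (rule finite_subset) simp
  have c: "set_encode {i. (p, i) \<in> C} < 2 ^ m" using sub by (rule set_encode_less)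
  have \<kappa>: "\<kappa> < K\<^sub>0" using assms(1) by (auto simp: inputs_def)
  have "\<kappa> < 2 ^ len" using \<kappa> K0_le by simp
  then have kl: "q < len" if "bit \<kappa> q" for q using that bit_less_exp by blast
  show v: "val p out_roles (final (X, e, \<kappa>) U C) = set_encode {i. (p, i) \<in> C} + 2 ^ m * \<kappa>"
  proof (rule bit_eqI)
    fix q
    have "q - m < len" if "q < m + len" "\<not> q < m" using that by simp
    then show "bit (val p out_roles (final (X, e, \<kappa>) U C)) q = bit (set_encode {i. (p, i) \<in> C} + 2 ^ m * \<kappa>) q"
      unfolding bit_concat[OF c] bit_val bit_set_encode[OF fin] using kl[of "q - m"]
      by (auto simp: out_roles_def nth_append)
  qed
  have "set_encode {i. (p, i) \<in> C} + 2 ^ m * \<kappa> < 2 ^ m * (\<kappa> + 1)" using c by simp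
  also have "\<dots> \<le> M" unfolding M_def using \<kappa> by (intro mult_le_mono) auto
  finally show "val p out_roles (final (X, e, \<kappa>) U C) < M" unfolding v .
qed

lemma val_final_eq_iff:
  assumes "(X, e, \<kappa>) \<in> inputs" "C \<subseteq> cells"
  shows "val Alice out_roles (final (X, e, \<kappa>) U C) = val Bob out_roles (final (X, e, \<kappa>) U C) \<longleftrightarrow> xi C = {}"
proof -
  have fin: "finite {i. (p, i) \<in> C}" for p
  proof (rule finite_subset)
    show "{i. (p, i) \<in> C} \<subseteq> {..<m}" using assms(2) by (auto simp: cells_def)
  qed simp
  have "val Alice out_roles (final (X, e, \<kappa>) U C) = val Bob out_roles (final (X, e, \<kappa>) U C) \<longleftrightarrow>
      {i. (Alice, i) \<in> C} = {i. (Bob, i) \<in> C}"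
    using set_encode_eq[OF fin fin] by (simp add: val_final(1)[OF assms])
  also have "\<dots> \<longleftrightarrow> xi C = {}" using assms(2) by (auto simp: xi_def cells_def set_eq_iff)
  finally show ?thesis .
qed

lemma block_pass:
  assumes "X \<in> Pow data" "Y \<in> Pow data" "C \<subseteq> cells" "D \<subseteq> cells"
  shows "block pass_kernel U X C Y D = of_nat K * of_bool (C = D \<and> X - cells = Y - cells \<and>
    ok {..<t} U X \<and> ok {..<t} U Y \<and> ok {t..<2 * t} U C)"
proof -
  have "block pass_kernel U X C Y D = 2 ^ (2 * t) * of_bool (C = D \<and> X - cells = Y - cells \<and>
    ok {..<t} U X \<and> ok {..<t} U Y \<and> ok {t..<2 * t} U C) * (\<Sum>\<kappa><K\<^sub>0. \<Sum>\<mu><K\<^sub>0. of_bool (\<kappa> = \<mu>))"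
  proof (rule block_eval[OF _ assms(1,2)])
    fix e f \<kappa> \<mu> assume inp: "(X, e, \<kappa>) \<in> inputs" "(Y, f, \<mu>) \<in> inputs" and mt: "matching e f U X C Y D"
    have "final (X, e, \<kappa>) U C = final (Y, f, \<mu>) U D \<and> (Alice, Chn (2 * t)) \<notin> final (X, e, \<kappa>) U C \<longleftrightarrow>
      (C = D \<and> X - cells = Y - cells \<and> (\<forall>j<2 * t. \<not> flag U X C j) \<and> (\<forall>j<2 * t. \<not> flag U Y D j)) \<and> \<kappa> = \<mu>"
      unfolding final_eq_iff[OF inp assms(3,4)] using mt by auto
    then show "pass_kernel (final (X, e, \<kappa>) U C) (final (Y, f, \<mu>) U D) = of_bool (C = D \<and> X - cells = Y - cells \<and>
      ok {..<t} U X \<and> ok {..<t} U Y \<and> ok {t..<2 * t} U C) * of_bool (\<kappa> = \<mu>)"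
      unfolding pass_kernel_def no_flag_iff by auto
  qed
  then show ?thesis by (simp add: sum_diag K_def)
qed

lemma block_trace:
  assumes "X \<in> Pow data" "Y \<in> Pow data" "C \<subseteq> cells" "D \<subseteq> cells"
  shows "block trace_kernel U X C Y D = of_nat K * of_bool (C = D \<and> X - cells = Y - cells \<and>
    (\<forall>j<2 * t. flag U X C j = flag U Y D j))"
proof -
  have "block trace_kernel U X C Y D = 2 ^ (2 * t) * of_bool (C = D \<and> X - cells = Y - cells \<and>
    (\<forall>j<2 * t. flag U X C j = flag U Y D j)) * (\<Sum>\<kappa><K\<^sub>0. \<Sum>\<mu><K\<^sub>0. of_bool (\<kappa> = \<mu>))"
    by (rule block_eval[OF _ assms(1,2)]) (auto simp: trace_kernel_def final_eq_iff assms(3,4))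
  then show ?thesis by (simp add: sum_diag K_def)
qed

text \<open>The keys are part of the output here and are not traced out: \<kappa> and \<mu> range
  independently, which gives one more factor \<open>K\<^sub>0\<close> than in
  \<open>block_pass\<close>.\<close>

lemma block_fidelity:
  assumes "X \<in> Pow data" "Y \<in> Pow data" "C \<subseteq> cells" "D \<subseteq> cells"
  shows "block fidelity_kernel U X C Y D = of_nat K * of_nat K\<^sub>0 * of_bool (xi C = {} \<and> xi D = {} \<and> X - cells = Y - cells \<and>
    ok {..<t} U X \<and> ok {..<t} U Y)"
proof -
  have "block fidelity_kernel U X C Y D = 2 ^ (2 * t) * of_bool (xi C = {} \<and> xi D = {} \<and> X - cells = Y - cells \<and>
    ok {..<t} U X \<and> ok {..<t} U Y) * (\<Sum>\<kappa><K\<^sub>0. \<Sum>\<mu><K\<^sub>0. 1)"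
  proof (rule block_eval[OF _ assms(1,2)])
    fix e f \<kappa> \<mu> assume inp: "(X, e, \<kappa>) \<in> inputs" "(Y, f, \<mu>) \<in> inputs" and mt: "matching e f U X C Y D"
    let ?F = "final (X, e, \<kappa>) U C" and ?G = "final (Y, f, \<mu>) U D"
    have XY: "X \<subseteq> data" "Y \<subseteq> data" using assms by auto
    have out: "Dat i \<in> set out_roles \<longleftrightarrow> i < m" "Key q \<in> set out_roles \<longleftrightarrow> q < len" "Eb j \<notin> set out_roles"
      "Rnd j i \<notin> set out_roles" "Chn j \<notin> set out_roles" for i q j
      by (auto simp: out_roles_def)
    have env: "(\<forall>v\<in>wires. snd v \<notin> set out_roles \<longrightarrow> (v \<in> ?F \<longleftrightarrow> v \<in> ?G)) \<longleftrightarrow>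
      X - cells = Y - cells \<and> (\<forall>j<2 * t. flag U X C j = flag U Y D j)" (is "?E \<longleftrightarrow> ?E'")
    proof
      assume ?E
      have "(p, i) \<in> X - cells \<longleftrightarrow> (p, i) \<in> Y - cells" for p i
        using bspec[OF \<open>?E\<close>, of "(p, Dat i)"] XY by (auto simp: cells_def data_def out split: if_splits)
      moreover have "flag U X C j = flag U Y D j" if "j < 2 * t" for j
        using bspec[OF \<open>?E\<close>, of "(Alice, Eb j)"] that by (auto simp: out)
      ultimately show ?E' by auto
    next
      assume E': ?E'
      then have X: "(p, i) \<in> X \<longleftrightarrow> (p, i) \<in> Y" if "\<not> i < m" for p i
        using that by (auto simp: cells_def set_eq_iff)
      show ?E
      proof (intro ballI impI)
        fix v assume "v \<in> wires" "snd v \<notin> set out_roles"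
        moreover obtain p r where "v = (p, r)" by fastforce
        ultimately show "v \<in> ?F \<longleftrightarrow> v \<in> ?G" using E' X mt by (cases r; cases p) (auto simp: out)
      qed
    qed
    have "fidelity_kernel ?F ?G = of_bool ((Alice, Chn (2 * t)) \<notin> ?F \<and> X - cells = Y - cells \<and>
        (\<forall>j<2 * t. flag U X C j = flag U Y D j) \<and> xi C = {} \<and> xi D = {})"
      unfolding fidelity_kernel_def env val_final_eq_iff[OF inp(1) assms(3)] val_final_eq_iff[OF inp(2) assms(4)]
      using val_final(2)[OF inp(1) assms(3)] val_final(2)[OF inp(2) assms(4)] by (simp only: simp_thms conj_ac)
    also have "(Alice, Chn (2 * t)) \<notin> ?F \<and> X - cells = Y - cells \<and>
        (\<forall>j<2 * t. flag U X C j = flag U Y D j) \<and> xi C = {} \<and> xi D = {} \<longleftrightarrow>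
      xi C = {} \<and> xi D = {} \<and> X - cells = Y - cells \<and> (\<forall>j<2 * t. \<not> flag U X C j) \<and> (\<forall>j<2 * t. \<not> flag U Y D j)"
      by auto
    \<comment> \<open>Equal bits behind the Hadamard gates pass all phase tests, so these leave no
      trace in the result.\<close>
    finally show "fidelity_kernel ?F ?G = of_bool (xi C = {} \<and> xi D = {} \<and> X - cells = Y - cells \<and>
        ok {..<t} U X \<and> ok {..<t} U Y) * 1"
      unfolding no_flag_iff
      using ok_xi_empty[of C "{t..<2 * t}" U] ok_xi_empty[of D "{t..<2 * t}" U]
      by (cases "xi C = {}"; cases "xi D = {}") simp_all
  qed
  then show ?thesis by (simp add: K_def)
qed

end

subsection \<open>Positive forms\<close>

text \<open>Expanding \<open>\<Sum>\<^sub>e\<^sub>,\<^sub>f q(c\<^sub>e - c\<^sub>f) \<ge> 0\<close> gives the convexity of a positive quadratic form \<open>q\<close>.\<close>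

lemma positive_form_sum_le:
  fixes g :: "'x \<Rightarrow> 'x \<Rightarrow> real" and c :: "'e \<Rightarrow> 'x \<Rightarrow> real"
  assumes pos: "\<And>c. 0 \<le> (\<Sum>X\<in>P. \<Sum>Y\<in>P. c X * c Y * g X Y)"
  shows "(\<Sum>X\<in>P. \<Sum>Y\<in>P. (\<Sum>e\<in>E. c e X) * (\<Sum>e\<in>E. c e Y) * g X Y) \<le>
    card E * (\<Sum>e\<in>E. \<Sum>X\<in>P. \<Sum>Y\<in>P. c e X * c e Y * g X Y)"
proof -
  define b where "b = (\<lambda>c d. \<Sum>X\<in>P. \<Sum>Y\<in>P. c X * d Y * g X Y)"
  have expand: "b (\<lambda>X. c X - d X) (\<lambda>X. c X - d X) = b c c + b d d - b c d - b d c" for c d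
    unfolding b_def sum.distrib[symmetric] sum_subtractf[symmetric]
    by (intro sum.cong refl) (simp add: algebra_simps)
  have "0 \<le> b c c + b d d - b c d - b d c" for c d
    unfolding expand[symmetric] unfolding b_def by (rule pos)
  then have "0 \<le> (\<Sum>e\<in>E. \<Sum>f\<in>E. b (c e) (c e) + b (c f) (c f) - b (c e) (c f) - b (c f) (c e))"
    by (intro sum_nonneg)
  also have "\<dots> = 2 * (card E * (\<Sum>e\<in>E. b (c e) (c e))) - 2 * (\<Sum>e\<in>E. \<Sum>f\<in>E. b (c e) (c f))"
    by (simp add: sum.distrib sum_subtractf sum_distrib_left[symmetric] sum.swap[of "\<lambda>e f. b (c f) (c e)"])
  finally have "(\<Sum>e\<in>E. \<Sum>f\<in>E. b (c e) (c f)) \<le> card E * (\<Sum>e\<in>E. b (c e) (c e))" by simp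
  moreover have "(\<Sum>e\<in>E. \<Sum>f\<in>E. b (c e) (c f)) = b (\<lambda>X. \<Sum>e\<in>E. c e X) (\<lambda>X. \<Sum>e\<in>E. c e X)"
  proof -
    have "(\<Sum>e\<in>E. \<Sum>f\<in>E. b (c e) (c f)) = (\<Sum>(e, f)\<in>E \<times> E. \<Sum>(X, Y)\<in>P \<times> P. c e X * c f Y * g X Y)"
      unfolding b_def sum.cartesian_product' by simp
    also have "\<dots> = (\<Sum>(X, Y)\<in>P \<times> P. \<Sum>(e, f)\<in>E \<times> E. c e X * c f Y * g X Y)"
      unfolding case_prod_unfold by (rule sum.swap)
    also have "\<dots> = (\<Sum>X\<in>P. \<Sum>Y\<in>P. \<Sum>e\<in>E. \<Sum>f\<in>E. c e X * c f Y * g X Y)"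
      unfolding sum.cartesian_product' by simp
    finally show ?thesis
      unfolding b_def unfolding sum_product unfolding sum_distrib_right .
  qed
  ultimately show ?thesis by (simp add: b_def)
qed

text \<open>The form is evaluated at the indicator of \<open>S\<close>. That indicator is the sum of
  \<open>card S\<close> indicators of singletons, and convexity gives the upper bound.\<close>

lemma positive_form_subset_le:
  fixes g :: "'x \<Rightarrow> 'x \<Rightarrow> real"
  assumes pos: "\<And>c. 0 \<le> (\<Sum>X\<in>P. \<Sum>Y\<in>P. c X * c Y * g X Y)" and fin: "finite P" and S: "S \<subseteq> P"
  shows "0 \<le> (\<Sum>X\<in>S. \<Sum>Y\<in>S. g X Y)"
    and "(\<Sum>X\<in>S. \<Sum>Y\<in>S. g X Y) \<le> card S * (\<Sum>X\<in>S. g X X)"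
proof -
  have restrict: "(\<Sum>X\<in>P. \<Sum>Y\<in>P. of_bool (X \<in> A) * of_bool (Y \<in> A) * g X Y) = (\<Sum>X\<in>A. \<Sum>Y\<in>A. g X Y)" if "A \<subseteq> P" for A
  proof -
    have "(\<Sum>Y\<in>P. of_bool (X \<in> A) * of_bool (Y \<in> A) * g X Y) = of_bool (X \<in> A) * (\<Sum>Y\<in>A. g X Y)" for X
      unfolding sum_distrib_left using fin that by (intro sum.mono_neutral_cong_right) auto
    then show ?thesis
      using fin that by (simp only:) (intro sum.mono_neutral_cong_right; auto)
  qed
  show "0 \<le> (\<Sum>X\<in>S. \<Sum>Y\<in>S. g X Y)"
    using pos[of "\<lambda>X. of_bool (X \<in> S)"] restrict[OF S] by simp
  have "(\<Sum>e\<in>S. of_bool (X \<in> {e})) = (of_bool (X \<in> S) :: real)" for X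
    using finite_subset[OF S fin] by (simp add: of_bool_def sum.delta')
  then have "(\<Sum>X\<in>P. \<Sum>Y\<in>P. of_bool (X \<in> S) * of_bool (Y \<in> S) * g X Y) \<le>
      card S * (\<Sum>e\<in>S. \<Sum>X\<in>P. \<Sum>Y\<in>P. of_bool (X \<in> {e}) * of_bool (Y \<in> {e}) * g X Y)"
    using positive_form_sum_le[OF pos, where c = "\<lambda>e X. of_bool (X \<in> {e})" and E = S] by simp
  also have "(\<Sum>e\<in>S. \<Sum>X\<in>P. \<Sum>Y\<in>P. of_bool (X \<in> {e}) * of_bool (Y \<in> {e}) * g X Y) = (\<Sum>e\<in>S. g e e)"
    using S by (intro sum.cong refl, subst restrict) auto
  finally show "(\<Sum>X\<in>S. \<Sum>Y\<in>S. g X Y) \<le> card S * (\<Sum>X\<in>S. g X X)"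
    unfolding restrict[OF S] .
qed

lemma form_mat:
  assumes "\<rho> \<in> carrier_mat n n" "v \<in> carrier_vec n"
  shows "(\<rho> *\<^sub>v v) \<bullet>c v = (\<Sum>k<n. \<Sum>l<n. cnj (v $ k) * v $ l * \<rho> $$ (k, l))"
  using assms by (auto simp: scalar_prod_def atLeast0LessThan sum_distrib_left sum_distrib_right mult_ac intro!: sum.cong)

section \<open>The three functionals as forms in the input state\<close>

context hashing
begin

lemma sum_delta_cells:
  fixes f :: "(party \<times> nat) set \<Rightarrow> complex"
  assumes "C \<in> Pow cells"
  shows "(\<Sum>D\<in>Pow cells. f D * (k * of_bool (C = D \<and> Q))) = f C * (k * of_bool Q)"
proof -
  have "(\<Sum>D\<in>Pow cells. f D * (k * of_bool (C = D \<and> Q))) = (\<Sum>D\<in>Pow cells. if C = D then f D * (k * of_bool Q) else 0)"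
    by (intro sum.cong refl) auto
  then show ?thesis using assms by (subst (asm) sum.delta') auto
qed

lemma split_cells: "X - cells = Y - cells \<and> X \<inter> cells = Y \<inter> cells \<longleftrightarrow> X = Y"
  by auto

text \<open>\<open>weight X\<close> is due to the bit tests. The bracket is due to the phase tests:
  everything passes them with probability at least 1 / 2^t, and the rest of the weight goes to the
  uniform superposition of the states with given discarded bits and given bit errors, which is the
  one without phase errors.\<close>

lemma pairing_pass:
  "pairing pass_kernel (final_state N K circuit \<rho>) =
    (\<Sum>X\<in>Pow data. \<Sum>Y\<in>Pow data. weight X *
      (1 / 2 ^ t * of_bool (X = Y) + (1 - 1 / 2 ^ t) / 2 ^ m * of_bool (X - cells = Y - cells \<and> xi X = xi Y)) *
      \<rho> $$ (data_idx X, data_idx Y))"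
proof -
  let ?Z = "of_nat K * 2 ^ (2 * t * m) * 2 ^ (2 * m) :: complex"
  have Z: "?Z \<noteq> 0" using K_pos by simp
  have m2: "(2 :: complex) ^ (2 * m) = 2 ^ m * 2 ^ m" by (simp add: mult_2 power_add)
  have "(\<Sum>U\<in>Pow pairs. \<Sum>C\<in>Pow cells. \<Sum>D\<in>Pow cells.
       (- 1) ^ (card (C \<inter> X) + card (D \<inter> Y)) * block pass_kernel U X C Y D) =
     ?Z * (weight X * (1 / 2 ^ t * of_bool (X = Y) + (1 - 1 / 2 ^ t) / 2 ^ m * of_bool (X - cells = Y - cells \<and> xi X = xi Y)))"
    if XY: "X \<in> Pow data" "Y \<in> Pow data" for X Y
  proof -
    have "(\<Sum>U\<in>Pow pairs. \<Sum>C\<in>Pow cells. \<Sum>D\<in>Pow cells.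
       (- 1) ^ (card (C \<inter> X) + card (D \<inter> Y)) * block pass_kernel U X C Y D) =
      (\<Sum>U\<in>Pow pairs. \<Sum>C\<in>Pow cells. \<Sum>D\<in>Pow cells. (- 1) ^ (card (C \<inter> X) + card (D \<inter> Y)) * (of_nat K * of_bool (C = D \<and> X - cells = Y - cells \<and>
    ok {..<t} U X \<and> ok {..<t} U Y \<and> ok {t..<2 * t} U C)))"
      using XY by (intro sum.cong refl) (simp add: block_pass)
    also have "\<dots> = (\<Sum>U\<in>Pow pairs. \<Sum>C\<in>Pow cells. (- 1) ^ (card (C \<inter> X) + card (C \<inter> Y)) * (of_nat K * of_bool (X - cells = Y - cells \<and>
    ok {..<t} U X \<and> ok {..<t} U Y \<and> ok {t..<2 * t} U C)))"
      by (intro sum.cong refl sum_delta_cells)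
    also have "\<dots> = (\<Sum>U\<in>Pow pairs. \<Sum>C\<in>Pow cells. of_nat K * of_bool (X - cells = Y - cells) * ((- 1) ^ (card (C \<inter> X) + card (C \<inter> Y)) *
      of_bool (ok {..<t} U X \<and> ok {..<t} U Y \<and> ok {t..<2 * t} U C)))"
      by (intro sum.cong refl) auto
    also have "\<dots> = of_nat K * of_bool (X - cells = Y - cells) * (\<Sum>U\<in>Pow pairs. \<Sum>C\<in>Pow cells. (- 1) ^ (card (C \<inter> X) + card (C \<inter> Y)) *
      of_bool (ok {..<t} U X \<and> ok {..<t} U Y \<and> ok {t..<2 * t} U C))"
      by (simp only: sum_distrib_left)
    also have "\<dots> = ?Z * (weight X * (1 / 2 ^ t * of_bool (X - cells = Y - cells \<and> X \<inter> cells = Y \<inter> cells) +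
        (1 - 1 / 2 ^ t) / 2 ^ m * of_bool (X - cells = Y - cells \<and> xi X = xi Y)))"
      unfolding sum_pass m2 by (auto simp: field_simps)
    finally show ?thesis unfolding split_cells .
  qed
  then have "pairing pass_kernel (final_state N K circuit \<rho>) =
    (\<Sum>X\<in>Pow data. \<Sum>Y\<in>Pow data. ?Z * (weight X * (1 / 2 ^ t * of_bool (X = Y) + (1 - 1 / 2 ^ t) / 2 ^ m * of_bool (X - cells = Y - cells \<and> xi X = xi Y)) *
      \<rho> $$ (data_idx X, data_idx Y))) / ?Z"
    unfolding pairing_block by (intro arg_cong2[where f = "(/)"] refl sum.cong) (simp only: mult.assoc)
  then show ?thesis unfolding sum_distrib_left[symmetric] using Z by (simp only: nonzero_mult_div_cancel_left not_False_eq_True)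
qed

text \<open>Preservation of the trace, obtained by the same path sum; it identifies the failure
  probability with 1 minus the passing part.\<close>

lemma pairing_trace:
  "pairing trace_kernel (final_state N K circuit \<rho>) = (\<Sum>X\<in>Pow data. \<rho> $$ (data_idx X, data_idx X))"
proof -
  let ?Z = "of_nat K * 2 ^ (2 * t * m) * 2 ^ (2 * m) :: complex"
  have Z: "?Z \<noteq> 0" using K_pos by simp
  have "(\<Sum>U\<in>Pow pairs. \<Sum>C\<in>Pow cells. \<Sum>D\<in>Pow cells.
       (- 1) ^ (card (C \<inter> X) + card (D \<inter> Y)) * block trace_kernel U X C Y D) = ?Z * of_bool (X = Y)"
    if XY: "X \<in> Pow data" "Y \<in> Pow data" for X Y
  proof -
    \<comment> \<open>For equal \<open>C\<close> the phase tests agree automatically, so the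
      condition no longer involves \<open>C\<close> and the signs can be summed freely.\<close>
    have fl: "(\<forall>j<2 * t. flag U X C j = flag U Y C j) \<longleftrightarrow> (\<forall>j<t. flag U X {} j = flag U Y {} j)" for U C
      by (auto simp: flag_def)
    have "(\<Sum>U\<in>Pow pairs. \<Sum>C\<in>Pow cells. \<Sum>D\<in>Pow cells.
       (- 1) ^ (card (C \<inter> X) + card (D \<inter> Y)) * block trace_kernel U X C Y D) =
      (\<Sum>U\<in>Pow pairs. \<Sum>C\<in>Pow cells. \<Sum>D\<in>Pow cells. (- 1) ^ (card (C \<inter> X) + card (D \<inter> Y)) * (of_nat K * of_bool (C = D \<and> X - cells = Y - cells \<and>
        (\<forall>j<t. flag U X {} j = flag U Y {} j))))"
      using XY fl by (intro sum.cong refl) (auto simp: block_trace)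
    also have "\<dots> = (\<Sum>U\<in>Pow pairs. \<Sum>C\<in>Pow cells. (- 1) ^ (card (C \<inter> X) + card (C \<inter> Y)) * (of_nat K * of_bool (X - cells = Y - cells \<and>
        (\<forall>j<t. flag U X {} j = flag U Y {} j))))"
      by (intro sum.cong refl sum_delta_cells)
    also have "\<dots> = (\<Sum>U\<in>Pow pairs. of_nat K * of_bool (X - cells = Y - cells \<and> (\<forall>j<t. flag U X {} j = flag U Y {} j)) *
        (2 ^ (2 * m) * of_bool (X \<inter> cells = Y \<inter> cells)))"
      by (intro sum.cong refl) (simp only: sum_distrib_right[symmetric] sum_signs mult.commute)
    also have "\<dots> = (\<Sum>U\<in>Pow pairs. of_nat K * 2 ^ (2 * m) * of_bool (X = Y))"
      by (intro sum.cong refl) (use split_cells[of X Y] in auto)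
    also have "\<dots> = ?Z * of_bool (X = Y)" by (simp add: card_Pow card_pairs)
    finally show ?thesis .
  qed
  then have "pairing trace_kernel (final_state N K circuit \<rho>) =
    (\<Sum>X\<in>Pow data. \<Sum>Y\<in>Pow data. ?Z * (of_bool (X = Y) * \<rho> $$ (data_idx X, data_idx Y))) / ?Z"
    unfolding pairing_block by (intro arg_cong2[where f = "(/)"] refl sum.cong) (simp only: mult.assoc)
  also have "\<dots> = (\<Sum>X\<in>Pow data. \<Sum>Y\<in>Pow data. of_bool (X = Y) * \<rho> $$ (data_idx X, data_idx Y))"
    unfolding sum_distrib_left[symmetric] using Z by (simp only: nonzero_mult_div_cancel_left not_False_eq_True)
  also have "\<dots> = (\<Sum>X\<in>Pow data. \<Sum>Y\<in>Pow data. if X = Y then \<rho> $$ (data_idx X, data_idx Y) else 0)"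
    by (intro sum.cong refl) auto
  also have "\<dots> = (\<Sum>X\<in>Pow data. \<rho> $$ (data_idx X, data_idx X))"
    by (intro sum.cong refl, subst sum.delta') auto
  finally show ?thesis .
qed

text \<open>Neither kind of test restricts this sum: states without bit errors pass the bit tests,
  and \<open>sum_diag_signs\<close> carries the equality of bits through the Hadamard gates. Hence
  no power of 1 / 2^t appears.\<close>

lemma pairing_fidelity:
  "pairing fidelity_kernel (final_state N K circuit \<rho>) = of_nat K\<^sub>0 *
    (\<Sum>X\<in>Pow data. \<Sum>Y\<in>Pow data. of_bool (X - cells = Y - cells \<and> xi X = {} \<and> xi Y = {}) * \<rho> $$ (data_idx X, data_idx Y))"
proof -
  let ?Z = "of_nat K * 2 ^ (2 * t * m) * 2 ^ (2 * m) :: complex"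
  have Z: "?Z \<noteq> 0" using K_pos by simp
  have m2: "(2 :: complex) ^ (2 * m) = 2 ^ m * 2 ^ m" by (simp add: mult_2 power_add)
  have "(\<Sum>U\<in>Pow pairs. \<Sum>C\<in>Pow cells. \<Sum>D\<in>Pow cells.
       (- 1) ^ (card (C \<inter> X) + card (D \<inter> Y)) * block fidelity_kernel U X C Y D) =
      ?Z * (of_nat K\<^sub>0 * of_bool (X - cells = Y - cells \<and> xi X = {} \<and> xi Y = {}))"
    if XY: "X \<in> Pow data" "Y \<in> Pow data" for X Y
  proof -
    let ?u = "\<lambda>U. of_nat K * of_nat K\<^sub>0 * of_bool (X - cells = Y - cells \<and> ok {..<t} U X \<and> ok {..<t} U Y) :: complex"
    have "(\<Sum>U\<in>Pow pairs. \<Sum>C\<in>Pow cells. \<Sum>D\<in>Pow cells.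
       (- 1) ^ (card (C \<inter> X) + card (D \<inter> Y)) * block fidelity_kernel U X C Y D) =
      (\<Sum>U\<in>Pow pairs. \<Sum>C\<in>Pow cells. \<Sum>D\<in>Pow cells. ?u U *
        (((- 1) ^ card (C \<inter> X) * of_bool (xi C = {})) * ((- 1) ^ card (D \<inter> Y) * of_bool (xi D = {}))))"
      using XY by (intro sum.cong refl) (auto simp: block_fidelity power_add)
    also have "\<dots> = (\<Sum>U\<in>Pow pairs. ?u U * ((2 ^ m * of_bool (xi X = {})) * (2 ^ m * of_bool (xi Y = {}))))"
      unfolding sum_diag_signs[symmetric] sum_product by (simp only: sum_distrib_left)
    also have "\<dots> = (\<Sum>U\<in>Pow pairs. 2 ^ (2 * m) * of_nat K * (of_nat K\<^sub>0 * of_bool (X - cells = Y - cells \<and> xi X = {} \<and> xi Y = {})))"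
      by (intro sum.cong refl) (auto simp: ok_xi_empty m2)
    also have "\<dots> = ?Z * (of_nat K\<^sub>0 * of_bool (X - cells = Y - cells \<and> xi X = {} \<and> xi Y = {}))"
      by (simp add: card_Pow card_pairs)
    finally show ?thesis .
  qed
  then have "pairing fidelity_kernel (final_state N K circuit \<rho>) =
    (\<Sum>X\<in>Pow data. \<Sum>Y\<in>Pow data. ?Z * (of_nat K\<^sub>0 * (of_bool (X - cells = Y - cells \<and> xi X = {} \<and> xi Y = {}) * \<rho> $$ (data_idx X, data_idx Y)))) / ?Z"
    unfolding pairing_block by (intro arg_cong2[where f = "(/)"] refl sum.cong) (simp only: mult.assoc)
  then show ?thesis unfolding sum_distrib_left[symmetric] using Z by (simp only: nonzero_mult_div_cancel_left not_False_eq_True)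
qed

subsection \<open>Bounds\<close>

lemma data_idx_bij: "bij_betw data_idx (Pow data) {..<N * N}"
proof (rule bij_betw_imageI)
  have side_inj: "X = Y" if "X \<subseteq> data" "Y \<subseteq> data" "\<And>p. side p X = side p Y" for X Y
    using bit_side[OF that(1)] bit_side[OF that(2)] that(3) by (auto simp: set_eq_iff)
  show "inj_on data_idx (Pow data)"
  proof (rule inj_onI)
    fix X Y assume X: "X \<in> Pow data" and Y: "Y \<in> Pow data" and eq: "data_idx X = data_idx Y"
    then have sub: "X \<subseteq> data" "Y \<subseteq> data" by auto
    show "X = Y"
    proof (rule side_inj[OF sub])
      fix p
      show "side p X = side p Y"
        using mult_add_div_mod[OF side_less[OF sub(1), of Bob], of "side Alice X"]
          mult_add_div_mod[OF side_less[OF sub(2), of Bob], of "side Alice Y"] eq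
        unfolding data_idx_def by (cases p) metis+
    qed
  qed
  have "k \<in> data_idx ` Pow data" if k: "k < N * N" for k
  proof -
    define x where "x = (\<lambda>p. case p of Alice \<Rightarrow> k div N | Bob \<Rightarrow> k mod N)"
    have x: "x p < N" for p using div_mod_less[OF k] by (cases p) (auto simp: x_def)
    define X where "X = {(p, i). bit (x p) i}"
    have X: "X \<subseteq> data" using x bit_less_exp by (auto simp: X_def data_def N_def)
    have sX: "side p X = x p" for p
      by (rule bit_eqI) (simp add: bit_side[OF X], simp add: X_def)
    have "data_idx X = k" unfolding data_idx_def sX x_def by (simp only: party.case div_mult_mod_eq)
    then show ?thesis using X by auto
  qed
  moreover have "data_idx X < N * N" if "X \<subseteq> data" for X
    unfolding data_idx_def using that by (intro mult_add_less side_less)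
  ultimately show "data_idx ` Pow data = {..<N * N}" by auto
qed

text \<open>The data that the pass kernel conserves: the discarded bits and the bit errors of the
  kept ones.\<close>

definition sector :: "(party \<times> nat) set \<Rightarrow> (party \<times> nat) set \<times> nat set" where
  "sector X = (X - cells, xi X)"

text \<open>Within a sector the kept bits of Alice determine those of Bob.\<close>

lemma card_sector: "card {X \<in> Pow data. sector X = d} \<le> 2 ^ m"
proof -
  have "inj_on (\<lambda>X. {i. i < m \<and> (Alice, i) \<in> X}) {X \<in> Pow data. sector X = d}"
  proof (rule inj_onI)
    fix X Y assume XY: "X \<in> {X \<in> Pow data. sector X = d}" "Y \<in> {X \<in> Pow data. sector X = d}"
      and eq: "{i. i < m \<and> (Alice, i) \<in> X} = {i. i < m \<and> (Alice, i) \<in> Y}"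
    have cl: "X - cells = Y - cells" "xi X = xi Y" using XY by (auto simp: sector_def)
    have A: "(Alice, i) \<in> X \<longleftrightarrow> (Alice, i) \<in> Y" if "i < m" for i using eq that by auto
    have B: "(Bob, i) \<in> X \<longleftrightarrow> (Bob, i) \<in> Y" if "i < m" for i
      using cl(2) A[OF that] that by (auto simp: xi_def set_eq_iff)
    have "(p, i) \<in> X \<longleftrightarrow> (p, i) \<in> Y" for p i
    proof (cases "i < m")
      case True
      then show ?thesis using A B by (cases p) auto
    next
      case False
      then show ?thesis using cl(1) by (auto simp: cells_def set_eq_iff)
    qed
    then show "X = Y" by auto
  qed
  then have "card {X \<in> Pow data. sector X = d} \<le> card (Pow {..<m})"
    by (rule card_inj_on_le) auto
  then show ?thesis by (simp add: card_Pow)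
qed

text \<open>The order on complex numbers makes a nonnegative value real, so both claims come from
  positivity of \<rho>. Real test vectors suffice because all kernels have real
  coefficients.\<close>

lemma density_form:
  assumes "density_operator (N * N) \<rho>"
  shows "0 \<le> (\<Sum>X\<in>Pow data. \<Sum>Y\<in>Pow data. c X * c Y * Re (\<rho> $$ (data_idx X, data_idx Y)))"
    "(\<Sum>X\<in>Pow data. \<Sum>Y\<in>Pow data. c X * c Y * Im (\<rho> $$ (data_idx X, data_idx Y))) = 0"
proof -
  define v where "v = vec (N * N) (\<lambda>k. complex_of_real (c (inv_into (Pow data) data_idx k)))"
  have car: "\<rho> \<in> carrier_mat (N * N) (N * N)" "v \<in> carrier_vec (N * N)"
    using assms by (auto simp: density_operator_def v_def)
  have v: "v $ data_idx X = complex_of_real (c X)" if "X \<in> Pow data" for X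
  proof -
    have "data_idx X < N * N" using that data_idx_bij by (auto simp: bij_betw_def)
    moreover have "inv_into (Pow data) data_idx (data_idx X) = X"
      using that data_idx_bij by (intro inv_into_f_f) (auto simp: bij_betw_def)
    ultimately show ?thesis by (simp add: v_def)
  qed
  have "(\<rho> *\<^sub>v v) \<bullet>c v = (\<Sum>X\<in>Pow data. \<Sum>Y\<in>Pow data. complex_of_real (c X * c Y) * \<rho> $$ (data_idx X, data_idx Y))"
    unfolding form_mat[OF car] sum.reindex_bij_betw[OF data_idx_bij, symmetric]
    by (intro sum.cong refl) (simp add: v)
  moreover have "0 \<le> (\<rho> *\<^sub>v v) \<bullet>c v" using assms car by (auto simp: density_operator_def)
  ultimately have "0 \<le> (\<Sum>X\<in>Pow data. \<Sum>Y\<in>Pow data. complex_of_real (c X * c Y) * \<rho> $$ (data_idx X, data_idx Y))"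
    by simp
  then show "0 \<le> (\<Sum>X\<in>Pow data. \<Sum>Y\<in>Pow data. c X * c Y * Re (\<rho> $$ (data_idx X, data_idx Y)))"
    "(\<Sum>X\<in>Pow data. \<Sum>Y\<in>Pow data. c X * c Y * Im (\<rho> $$ (data_idx X, data_idx Y))) = 0"
    by (auto simp: less_eq_complex_def)
qed

lemma density_trace:
  assumes "density_operator (N * N) \<rho>"
  shows "(\<Sum>X\<in>Pow data. \<rho> $$ (data_idx X, data_idx X)) = 1"
proof -
  have "\<rho> \<in> carrier_mat (N * N) (N * N)" "mat_trace \<rho> = 1" using assms by (auto simp: density_operator_def)
  then show ?thesis
    by (simp add: mat_trace_def sum.reindex_bij_betw[OF data_idx_bij, symmetric])
qed

definition diagonal :: "(party \<times> nat) set set" where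
  "diagonal = {X \<in> Pow data. \<forall>i. (Alice, i) \<in> X \<longleftrightarrow> (Bob, i) \<in> X}"

lemma fidelity_diagonal:
  assumes "\<rho> \<in> carrier_mat (N * N) (N * N)"
  shows "fidelity N \<rho> = (\<Sum>X\<in>diagonal. \<Sum>Y\<in>diagonal. Re (\<rho> $$ (data_idx X, data_idx Y))) / N"
proof -
  have me: "max_ent N $ data_idx X = of_bool (X \<in> diagonal) / complex_of_real (sqrt N)" if "X \<in> Pow data" for X
  proof -
    have X: "X \<subseteq> data" using that by auto
    have "data_idx X div N = side Alice X" "data_idx X mod N = side Bob X"
      unfolding data_idx_def by (rule mult_add_div_mod[OF side_less[OF X]])+
    moreover have "side Alice X = side Bob X \<longleftrightarrow> X \<in> diagonal"
      using that bit_side[OF X] by (auto simp: diagonal_def bit_eq_iff)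
    moreover have "data_idx X < N * N" using that data_idx_bij by (auto simp: bij_betw_def)
    ultimately show ?thesis by (simp add: max_ent_def)
  qed
  have sq: "complex_of_real (sqrt N) * complex_of_real (sqrt N) = of_nat N" by (simp flip: of_real_mult)
  have "(\<rho> *\<^sub>v max_ent N) \<bullet>c max_ent N = (\<Sum>X\<in>Pow data. \<Sum>Y\<in>Pow data.
      of_bool (X \<in> diagonal) * (of_bool (Y \<in> diagonal) * (\<rho> $$ (data_idx X, data_idx Y) / of_nat N)))"
    unfolding form_mat[OF assms, of "max_ent N", simplified max_ent_def dim_vec vec_carrier, folded max_ent_def, OF TrueI]
      sum.reindex_bij_betw[OF data_idx_bij, symmetric]
    by (intro sum.cong refl) (simp add: me sq)
  also have "\<dots> = (\<Sum>X\<in>diagonal. \<Sum>Y\<in>diagonal. \<rho> $$ (data_idx X, data_idx Y) / of_nat N)"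
  proof -
    have restrict: "(\<Sum>X\<in>Pow data. of_bool (X \<in> diagonal) * f X) = (\<Sum>X\<in>diagonal. f X)" for f :: "_ \<Rightarrow> complex"
      by (rule sum.mono_neutral_cong_right) (auto simp: diagonal_def)
    show ?thesis by (simp only: sum_distrib_left[symmetric] restrict)
  qed
  finally show ?thesis by (simp add: fidelity_def sum_divide_distrib)
qed

abbreviation sectors :: "((party \<times> nat) set \<times> nat set) set" where
  "sectors \<equiv> sector ` Pow data"

abbreviation members :: "(party \<times> nat) set \<times> nat set \<Rightarrow> (party \<times> nat) set set" where
  "members d \<equiv> {X \<in> Pow data. sector X = d}"

definition sector_weight :: "(party \<times> nat) set \<times> nat set \<Rightarrow> real" where
  "sector_weight d = (if snd d = {} then 1 else 1 / 2 ^ t)"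

text \<open>The kernels are block diagonal with respect to sectors; only the diagonal of a block and
  the sum of all its entries occur.\<close>

lemma sector_sum:
  fixes h :: "(party \<times> nat) set \<Rightarrow> (party \<times> nat) set \<Rightarrow> real" and x y :: real
  shows "(\<Sum>X\<in>Pow data. \<Sum>Y\<in>Pow data. w (sector X) * (x * of_bool (X = Y) + y * of_bool (X - cells = Y - cells \<and> xi X = xi Y)) * h X Y) =
    (\<Sum>d\<in>sectors. w d * (x * (\<Sum>X\<in>members d. h X X) + y * (\<Sum>X\<in>members d. \<Sum>Y\<in>members d. h X Y)))"
proof -
  have "(\<Sum>Y\<in>Pow data. w (sector X) * (x * of_bool (X = Y) + y * of_bool (X - cells = Y - cells \<and> xi X = xi Y)) * h X Y) =
      w (sector X) * (x * h X X + y * (\<Sum>Y\<in>members (sector X). h X Y))" if "X \<in> Pow data" for X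
  proof -
    have 1: "(\<Sum>Y\<in>Pow data. of_bool (X = Y) * h X Y) = h X X"
    proof -
      have "(\<Sum>Y\<in>Pow data. of_bool (X = Y) * h X Y) = (\<Sum>Y\<in>Pow data. if X = Y then h X Y else 0)"
        by (intro sum.cong refl) auto
      then show ?thesis using that by (subst (asm) sum.delta') auto
    qed
    have 2: "(\<Sum>Y\<in>Pow data. of_bool (X - cells = Y - cells \<and> xi X = xi Y) * h X Y) = (\<Sum>Y\<in>members (sector X). h X Y)"
      by (rule sum.mono_neutral_cong_right) (auto simp: sector_def)
    have "(\<Sum>Y\<in>Pow data. w (sector X) * (x * of_bool (X = Y) + y * of_bool (X - cells = Y - cells \<and> xi X = xi Y)) * h X Y) =
      w (sector X) * (x * (\<Sum>Y\<in>Pow data. of_bool (X = Y) * h X Y) +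
        y * (\<Sum>Y\<in>Pow data. of_bool (X - cells = Y - cells \<and> xi X = xi Y) * h X Y))"
      unfolding sum_distrib_left sum.distrib[symmetric] by (intro sum.cong refl) (simp only: algebra_simps)
    then show ?thesis unfolding 1 2 .
  qed
  then have "(\<Sum>X\<in>Pow data. \<Sum>Y\<in>Pow data. w (sector X) * (x * of_bool (X = Y) + y * of_bool (X - cells = Y - cells \<and> xi X = xi Y)) * h X Y) =
     (\<Sum>X\<in>Pow data. w (sector X) * (x * h X X + y * (\<Sum>Y\<in>members (sector X). h X Y)))"
    by (intro sum.cong refl)
  also have "\<dots> = (\<Sum>d\<in>sectors. \<Sum>X\<in>members d. w (sector X) * (x * h X X + y * (\<Sum>Y\<in>members (sector X). h X Y)))"
    by (rule sum.image_gen) simp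
  also have "\<dots> = (\<Sum>d\<in>sectors. \<Sum>X\<in>members d. w d * (x * h X X + y * (\<Sum>Y\<in>members d. h X Y)))"
    by (intro sum.cong refl) auto
  finally show ?thesis by (simp only: sum_distrib_left sum.distrib distrib_left)
qed

definition block_sum :: "complex mat \<Rightarrow> (party \<times> nat) set \<times> nat set \<Rightarrow> real" where
  "block_sum \<rho> d = (\<Sum>X\<in>members d. \<Sum>Y\<in>members d. Re (\<rho> $$ (data_idx X, data_idx Y)))"

definition block_trace_sum :: "complex mat \<Rightarrow> (party \<times> nat) set \<times> nat set \<Rightarrow> real" where
  "block_trace_sum \<rho> d = (\<Sum>X\<in>members d. Re (\<rho> $$ (data_idx X, data_idx X)))"

text \<open>The form of imaginary parts vanishes at all real vectors. It and its negative are
  therefore both nonnegative, and \<open>positive_form_subset_le\<close> applies to each.\<close>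

lemma Im_block:
  assumes "density_operator (N * N) \<rho>" "S \<subseteq> Pow data"
  shows "(\<Sum>X\<in>S. \<Sum>Y\<in>S. Im (\<rho> $$ (data_idx X, data_idx Y))) = 0"
proof -
  let ?h = "\<lambda>X Y. Im (\<rho> $$ (data_idx X, data_idx Y))"
  have "0 \<le> (\<Sum>X\<in>S. \<Sum>Y\<in>S. ?h X Y)"
    by (rule positive_form_subset_le(1)[OF _ _ assms(2)]) (use density_form(2)[OF assms(1)] in auto)
  moreover have "0 \<le> (\<Sum>X\<in>S. \<Sum>Y\<in>S. - ?h X Y)"
    by (rule positive_form_subset_le(1)[OF _ _ assms(2)]) (use density_form(2)[OF assms(1)] in \<open>auto simp: sum_negf\<close>)
  ultimately show ?thesis by (simp add: sum_negf)
qed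

lemma Im_diagonal:
  assumes "density_operator (N * N) \<rho>" "X \<in> Pow data"
  shows "Im (\<rho> $$ (data_idx X, data_idx X)) = 0"
  using Im_block[OF assms(1), of "{X}"] assms(2) by simp

text \<open>Diagonal entries and block sums have imaginary part 0, so the trace of the unnormalised
  output is a real number. Real and imaginary part are treated by the same real identity
  \<open>sector_sum\<close>.\<close>

lemma pass_value:
  assumes "density_operator (N * N) \<rho>"
  shows "pairing pass_kernel (final_state N K circuit \<rho>) = complex_of_real
    (\<Sum>d\<in>sectors. sector_weight d * (1 / 2 ^ t * block_trace_sum \<rho> d + (1 - 1 / 2 ^ t) / 2 ^ m * block_sum \<rho> d))"
proof -
  let ?r = "\<lambda>X Y. \<rho> $$ (data_idx X, data_idx Y)"
  let ?k = "\<lambda>X Y. sector_weight (sector X) * (1 / 2 ^ t * of_bool (X = Y) + (1 - 1 / 2 ^ t) / 2 ^ m * of_bool (X - cells = Y - cells \<and> xi X = xi Y))"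
  have k: "weight X * (1 / 2 ^ t * of_bool (X = Y) + (1 - 1 / 2 ^ t) / 2 ^ m * of_bool (X - cells = Y - cells \<and> xi X = xi Y)) =
      complex_of_real (?k X Y)" for X Y
    by (simp add: weight_def sector_weight_def sector_def)
  have "Re (pairing pass_kernel (final_state N K circuit \<rho>)) = (\<Sum>X\<in>Pow data. \<Sum>Y\<in>Pow data. ?k X Y * Re (?r X Y))"
    unfolding pairing_pass k by simp
  also have "\<dots> = (\<Sum>d\<in>sectors. sector_weight d * (1 / 2 ^ t * block_trace_sum \<rho> d + (1 - 1 / 2 ^ t) / 2 ^ m * block_sum \<rho> d))"
    unfolding block_trace_sum_def block_sum_def by (rule sector_sum)
  finally have re: "Re (pairing pass_kernel (final_state N K circuit \<rho>)) =
    (\<Sum>d\<in>sectors. sector_weight d * (1 / 2 ^ t * block_trace_sum \<rho> d + (1 - 1 / 2 ^ t) / 2 ^ m * block_sum \<rho> d))" .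
  have "Im (pairing pass_kernel (final_state N K circuit \<rho>)) = (\<Sum>X\<in>Pow data. \<Sum>Y\<in>Pow data. ?k X Y * Im (?r X Y))"
    unfolding pairing_pass k by simp
  also have "\<dots> = (\<Sum>d\<in>sectors. sector_weight d * (1 / 2 ^ t * (\<Sum>X\<in>members d. Im (?r X X)) +
      (1 - 1 / 2 ^ t) / 2 ^ m * (\<Sum>X\<in>members d. \<Sum>Y\<in>members d. Im (?r X Y))))"
    by (rule sector_sum)
  also have "\<dots> = 0"
  proof -
    have "(\<Sum>X\<in>members d. Im (?r X X)) = 0" for d
      by (rule sum.neutral) (auto simp: Im_diagonal[OF assms])
    moreover have "(\<Sum>X\<in>members d. \<Sum>Y\<in>members d. Im (?r X Y)) = 0" for d
      by (rule Im_block[OF assms]) auto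
    ultimately show ?thesis by (simp only: mult_zero_right add_0 sum.neutral_const)
  qed
  finally show ?thesis using re by (simp add: complex_eq_iff)
qed

lemma fidelity_value:
  "Re (pairing fidelity_kernel (final_state N K circuit \<rho>)) = K\<^sub>0 * (\<Sum>d\<in>sectors. of_bool (snd d = {}) * block_sum \<rho> d)"
proof -
  let ?r = "\<lambda>X Y. \<rho> $$ (data_idx X, data_idx Y)"
  \<comment> \<open>This is the shape of \<open>sector_sum\<close> with coefficients 0 and 1 and the
    indicator of no bit errors as weight.\<close>
  have k: "(of_bool (X - cells = Y - cells \<and> xi X = {} \<and> xi Y = {}) :: complex) = complex_of_real
      (of_bool (snd (sector X) = {}) * (0 * of_bool (X = Y) + 1 * of_bool (X - cells = Y - cells \<and> xi X = xi Y)))" for X Y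
    by (auto simp: sector_def)
  have "Re (pairing fidelity_kernel (final_state N K circuit \<rho>)) = K\<^sub>0 * (\<Sum>X\<in>Pow data. \<Sum>Y\<in>Pow data.
      of_bool (snd (sector X) = {}) * (0 * of_bool (X = Y) + 1 * of_bool (X - cells = Y - cells \<and> xi X = xi Y)) * Re (?r X Y))"
    unfolding pairing_fidelity k by simp
  also have "\<dots> = K\<^sub>0 * (\<Sum>d\<in>sectors. of_bool (snd d = {}) * (0 * (\<Sum>X\<in>members d. Re (?r X X)) +
      1 * (\<Sum>X\<in>members d. \<Sum>Y\<in>members d. Re (?r X Y))))"
    by (rule arg_cong[OF sector_sum])
  finally show ?thesis by (simp add: block_sum_def)
qed

text \<open>A block sum divided by \<open>2 ^ m\<close> is a weight of the state on one Bell vector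
  of the sector, so it cannot exceed the trace of the block.\<close>

lemma block_bounds:
  assumes "density_operator (N * N) \<rho>"
  shows "0 \<le> block_sum \<rho> d" "block_sum \<rho> d \<le> 2 ^ m * block_trace_sum \<rho> d" "0 \<le> block_trace_sum \<rho> d"
proof -
  note pos = positive_form_subset_le[OF density_form(1)[OF assms]]
  have sub: "members d \<subseteq> Pow data" by auto
  show "0 \<le> block_sum \<rho> d" unfolding block_sum_def by (rule pos(1)[OF _ sub]) simp
  have "0 \<le> Re (\<rho> $$ (data_idx X, data_idx X))" if "X \<in> Pow data" for X
    using pos(1)[of "{X}"] that by simp
  then show tr: "0 \<le> block_trace_sum \<rho> d" unfolding block_trace_sum_def by (intro sum_nonneg) auto
  have "block_sum \<rho> d \<le> card (members d) * block_trace_sum \<rho> d"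
    unfolding block_sum_def block_trace_sum_def by (rule pos(2)[OF _ sub]) simp
  also have "\<dots> \<le> 2 ^ m * block_trace_sum \<rho> d"
  proof (rule mult_right_mono)
    have "real (card (members d)) \<le> real (2 ^ m)" using card_sector by (simp only: of_nat_le_iff)
    then show "real (card (members d)) \<le> 2 ^ m" by simp
  qed (rule tr)
  finally show "block_sum \<rho> d \<le> 2 ^ m * block_trace_sum \<rho> d" .
qed

text \<open>Discarding cannot decrease the fidelity. The maximally entangled vector is a sum over
  the values of the discarded bits, one sector for each of at most \<open>2 ^ s\<close> values.
  Convexity costs the factor \<open>2 ^ s\<close>, which cancels against
  \<open>N = 2 ^ (m + s)\<close>.\<close>

lemma fidelity_le:
  assumes "density_operator (N * N) \<rho>"
  shows "fidelity N \<rho> \<le> (\<Sum>d\<in>sectors. of_bool (snd d = {}) * block_sum \<rho> d) / 2 ^ m"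
proof -
  let ?g = "\<lambda>X Y. Re (\<rho> $$ (data_idx X, data_idx Y))"
  let ?E = "sector ` diagonal"
  have xi0: "xi X = {}" if "X \<in> diagonal" for X using that by (auto simp: diagonal_def xi_def)
  \<comment> \<open>Being diagonal depends on the sector only, so the diagonal is a union of whole
    sectors.\<close>
  have mem: "X \<in> diagonal" if X: "X \<in> Pow data" and sX: "sector X \<in> ?E" for X
  proof -
    obtain Y where Y: "Y \<in> diagonal" "sector X = sector Y" using sX by auto
    then have XY: "xi X = {}" "X - cells = Y - cells" using xi0[OF Y(1)] by (auto simp: sector_def)
    have "(Alice, i) \<in> X \<longleftrightarrow> (Bob, i) \<in> X" for i
    proof (cases "i < m")
      case True
      then show ?thesis using XY(1) by (auto simp: xi_def)
    next
      case False
      then have "(p, i) \<in> X \<longleftrightarrow> (p, i) \<in> Y" for p using XY(2) by (auto simp: cells_def set_eq_iff)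
      then show ?thesis using Y(1) by (auto simp: diagonal_def)
    qed
    then show ?thesis using X by (auto simp: diagonal_def)
  qed
  have finE: "finite ?E" by (simp add: diagonal_def)
  have ind: "(\<Sum>d\<in>?E. of_bool (sector X = d)) = (of_bool (X \<in> diagonal) :: real)" if "X \<in> Pow data" for X
    using finE sum.delta'[OF finE, of "sector X" "\<lambda>_. 1 :: real"] mem[OF that] by (auto simp: of_bool_def)
  have restrict: "(\<Sum>X\<in>Pow data. \<Sum>Y\<in>Pow data. of_bool (P X) * of_bool (P Y) * ?g X Y) =
      (\<Sum>X\<in>{X \<in> Pow data. P X}. \<Sum>Y\<in>{X \<in> Pow data. P X}. ?g X Y)" for P
  proof -
    have "(\<Sum>Y\<in>Pow data. of_bool (P X) * of_bool (P Y) * ?g X Y) = of_bool (P X) * (\<Sum>Y\<in>{X \<in> Pow data. P X}. ?g X Y)" for X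
      unfolding sum_distrib_left by (intro sum.mono_neutral_cong_right) auto
    then show ?thesis by (simp only:) (intro sum.mono_neutral_cong_right; auto)
  qed
  have dg: "{X \<in> Pow data. X \<in> diagonal} = diagonal" by (auto simp: diagonal_def)
  have "(\<Sum>X\<in>diagonal. \<Sum>Y\<in>diagonal. ?g X Y) =
      (\<Sum>X\<in>Pow data. \<Sum>Y\<in>Pow data. (\<Sum>d\<in>?E. of_bool (sector X = d)) * (\<Sum>d\<in>?E. of_bool (sector Y = d)) * ?g X Y)"
    unfolding restrict[of "\<lambda>X. X \<in> diagonal", unfolded dg, symmetric] using ind by (intro sum.cong refl) simp
  also have "\<dots> \<le> card ?E * (\<Sum>d\<in>?E. \<Sum>X\<in>Pow data. \<Sum>Y\<in>Pow data. of_bool (sector X = d) * of_bool (sector Y = d) * ?g X Y)"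
    by (rule positive_form_sum_le[OF density_form(1)[OF assms]])
  also have "\<dots> = card ?E * (\<Sum>d\<in>?E. block_sum \<rho> d)"
    unfolding restrict block_sum_def ..
  also have "\<dots> \<le> 2 ^ s * (\<Sum>d\<in>sectors. of_bool (snd d = {}) * block_sum \<rho> d)"
  proof (rule mult_mono)
    \<comment> \<open>A diagonal sector has no bit errors and equal discarded bits on both sides;
      the discarded bits of Alice determine it.\<close>
    have "inj_on (\<lambda>d. {i. (Alice, i) \<in> fst d}) ?E"
    proof (rule inj_onI)
      fix d d' assume d: "d \<in> ?E" "d' \<in> ?E" and eq: "{i. (Alice, i) \<in> fst d} = {i. (Alice, i) \<in> fst d'}"
      obtain X Y where X: "X \<in> diagonal" "d = sector X" and Y: "Y \<in> diagonal" "d' = sector Y" using d by auto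
      have "(p, i) \<in> X - cells \<longleftrightarrow> (p, i) \<in> Y - cells" for p i
        using eq X Y by (cases p) (auto simp: sector_def diagonal_def cells_def set_eq_iff)
      then have "X - cells = Y - cells" by auto
      then show "d = d'" using X Y xi0 by (simp add: sector_def)
    qed
    moreover have "(\<lambda>d. {i. (Alice, i) \<in> fst d}) ` ?E \<subseteq> Pow {m..<m + s}"
      by (auto simp: sector_def diagonal_def cells_def data_def)
    ultimately have "card ?E \<le> card (Pow {m..<m + s})" by (rule card_inj_on_le) simp
    then have "card ?E \<le> 2 ^ s" by (simp add: card_Pow)
    then have "real (card ?E) \<le> real (2 ^ s)" by (simp only: of_nat_le_iff)
    then show "real (card ?E) \<le> 2 ^ s" by simp
    have "(\<Sum>d\<in>?E. block_sum \<rho> d) = (\<Sum>d\<in>?E. of_bool (snd d = {}) * block_sum \<rho> d)"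
      by (intro sum.cong refl) (auto simp: sector_def xi0)
    also have "\<dots> \<le> (\<Sum>d\<in>sectors. of_bool (snd d = {}) * block_sum \<rho> d)"
      by (rule sum_mono2) (auto simp: diagonal_def block_bounds[OF assms])
    finally show "(\<Sum>d\<in>?E. block_sum \<rho> d) \<le> (\<Sum>d\<in>sectors. of_bool (snd d = {}) * block_sum \<rho> d)" .
  qed (auto intro!: sum_nonneg block_bounds[OF assms])
  finally have le: "(\<Sum>X\<in>diagonal. \<Sum>Y\<in>diagonal. ?g X Y) \<le> 2 ^ s * (\<Sum>d\<in>sectors. of_bool (snd d = {}) * block_sum \<rho> d)" .
  have "\<rho> \<in> carrier_mat (N * N) (N * N)" using assms by (simp add: density_operator_def)
  then have "fidelity N \<rho> = (\<Sum>X\<in>diagonal. \<Sum>Y\<in>diagonal. ?g X Y) / N" by (rule fidelity_diagonal)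
  also have "\<dots> \<le> 2 ^ s * (\<Sum>d\<in>sectors. of_bool (snd d = {}) * block_sum \<rho> d) / N"
    by (intro divide_right_mono le) simp
  also have "\<dots> = (\<Sum>d\<in>sectors. of_bool (snd d = {}) * block_sum \<rho> d) / 2 ^ m"
  proof -
    have "2 ^ s * x / real N = x / 2 ^ m" for x by (simp add: N_def power_add)
    then show ?thesis .
  qed
  finally show ?thesis .
qed

text \<open>\<open>F\<close> is the fidelity of the kept part. Each orthogonal Bell component
  carries a bit error or a phase error and is suppressed by the factor 1 / 2^t of the corresponding
  tests.\<close>

lemma pass_bounds:
  assumes "density_operator (N * N) \<rho>"
  defines "F \<equiv> (\<Sum>d\<in>sectors. of_bool (snd d = {}) * block_sum \<rho> d) / 2 ^ m"
    and "T \<equiv> Re (pairing pass_kernel (final_state N K circuit \<rho>))"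
  shows "F \<le> T" "T - F \<le> 2 * (1 - F) / 2 ^ t" "F \<le> 1"
proof -
  define \<eta> :: real where "\<eta> = 1 / 2 ^ t"
  have \<eta>: "0 \<le> \<eta>" "\<eta> \<le> 1" by (auto simp: \<eta>_def)
  \<comment> \<open>\<open>A\<close> and \<open>A'\<close> are the total weights without and with
    bit errors; \<open>F\<close> and \<open>B\<close> are the portions of them that have no phase
    errors.\<close>
  define A where "A = (\<Sum>d\<in>sectors. of_bool (snd d = {}) * block_trace_sum \<rho> d)"
  define A' where "A' = (\<Sum>d\<in>sectors. of_bool (snd d \<noteq> {}) * block_trace_sum \<rho> d)"
  define B where "B = (\<Sum>d\<in>sectors. of_bool (snd d \<noteq> {}) * block_sum \<rho> d) / 2 ^ m"
  note bb = block_bounds[OF assms(1)]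
  have "block_sum \<rho> d / 2 ^ m \<le> block_trace_sum \<rho> d" for d using bb(2)[of d] by (simp add: field_simps)
  then have FA: "F \<le> A" and BA: "B \<le> A'"
    unfolding F_def A_def B_def A'_def sum_divide_distrib by (intro sum_mono; auto)+
  have A'0: "0 \<le> A'" unfolding A'_def by (intro sum_nonneg) (use bb in auto)
  have "A + A' = (\<Sum>d\<in>sectors. block_trace_sum \<rho> d)"
    unfolding A_def A'_def sum.distrib[symmetric] by (intro sum.cong refl) auto
  also have "\<dots> = (\<Sum>X\<in>Pow data. Re (\<rho> $$ (data_idx X, data_idx X)))"
    unfolding block_trace_sum_def by (rule sum.image_gen[symmetric]) simp
  also have "\<dots> = 1" using arg_cong[OF density_trace[OF assms(1)], of Re] by simp
  finally have AA: "A + A' = 1" .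
  have "T = (\<Sum>d\<in>sectors. \<eta> * (of_bool (snd d = {}) * block_trace_sum \<rho> d) + \<eta> * (\<eta> * (of_bool (snd d \<noteq> {}) * block_trace_sum \<rho> d)) +
      (1 - \<eta>) * (of_bool (snd d = {}) * block_sum \<rho> d / 2 ^ m) + (1 - \<eta>) * (\<eta> * (of_bool (snd d \<noteq> {}) * block_sum \<rho> d / 2 ^ m)))"
    unfolding T_def pass_value[OF assms(1)] Re_complex_of_real sector_weight_def \<eta>_def[symmetric]
  proof (intro sum.cong refl)
    fix d
    show "(if snd d = {} then 1 else \<eta>) * (\<eta> * block_trace_sum \<rho> d + (1 - \<eta>) / 2 ^ m * block_sum \<rho> d) =
      \<eta> * (of_bool (snd d = {}) * block_trace_sum \<rho> d) + \<eta> * (\<eta> * (of_bool (snd d \<noteq> {}) * block_trace_sum \<rho> d)) +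
      (1 - \<eta>) * (of_bool (snd d = {}) * block_sum \<rho> d / 2 ^ m) + (1 - \<eta>) * (\<eta> * (of_bool (snd d \<noteq> {}) * block_sum \<rho> d / 2 ^ m))"
      by (cases "snd d = {}") (simp_all add: distrib_left)
  qed
  also have "\<dots> = \<eta> * A + \<eta> * (\<eta> * A') + (1 - \<eta>) * F + (1 - \<eta>) * (\<eta> * B)"
    unfolding A_def A'_def F_def B_def sum_divide_distrib by (simp only: sum.distrib sum_distrib_left)
  finally have T: "T = \<eta> * A + \<eta> * (\<eta> * A') + (1 - \<eta>) * F + (1 - \<eta>) * (\<eta> * B)" .
  have B0: "0 \<le> B" unfolding B_def by (intro divide_nonneg_nonneg sum_nonneg) (use bb in auto)
  have "\<eta> * F \<le> \<eta> * A" using FA \<eta> by (intro mult_left_mono)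
  moreover have "0 \<le> \<eta> * (\<eta> * A')" "0 \<le> (1 - \<eta>) * (\<eta> * B)" using \<eta> A'0 B0 by auto
  ultimately show "F \<le> T" unfolding T by (simp add: algebra_simps)
  show "F \<le> 1" using FA AA A'0 by simp
  have B1: "B \<le> 1 - F" using BA AA FA by simp
  have "\<eta> * A + \<eta> * (\<eta> * A') \<le> \<eta> * A + \<eta> * (1 * A')"
    using \<eta> A'0 by (intro add_left_mono mult_left_mono mult_right_mono) auto
  then have 1: "\<eta> * A + \<eta> * (\<eta> * A') \<le> \<eta>" using AA by (simp flip: distrib_left)
  have 2: "(1 - \<eta>) * (\<eta> * B) \<le> 1 * (\<eta> * (1 - F))"
    using \<eta> B0 B1 by (intro mult_mono) auto
  \<comment> \<open>The terms with \<open>A\<close> and \<open>A'\<close> and the term with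
    \<open>B\<close> are bounded separately, each by \<eta> times 1 - \<open>F\<close> beyond the
    share of \<open>F\<close>; this is the origin of the factor 2.\<close>
  show "T - F \<le> 2 * (1 - F) / 2 ^ t"
    using 1 2 unfolding T by (simp add: \<eta>_def[symmetric] field_simps) (simp add: \<eta>_def field_simps)
qed

end

section \<open>The result of the circuit in terms of the kernels\<close>

lemma ceillog2_mult_power: "0 < k \<Longrightarrow> ceillog2 (k * 2 ^ j) = ceillog2 k + j"
proof (induction j)
  case (Suc j)
  then show ?case using ceillog2_rec_even[of "k * 2 ^ j"] by (simp add: mult_ac)
qed simp

lemma sum_div_mod:
  fixes f :: "nat \<Rightarrow> complex"
  shows "(\<Sum>k<M * M. f k * of_bool (a = k div M \<and> b = k mod M)) = of_bool (a < M \<and> b < M) * f (a * M + b)"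
proof -
  have "a = k div M \<and> b = k mod M \<longleftrightarrow> k = a * M + b \<and> a < M \<and> b < M" if "k < M * M" for k
    using div_mod_less[OF that] mult_add_div_mod[of b M a] by auto
  then have "(\<Sum>k<M * M. f k * of_bool (a = k div M \<and> b = k mod M)) =
      (\<Sum>k<M * M. if k = a * M + b then of_bool (a < M \<and> b < M) * f (a * M + b) else 0)"
    by (intro sum.cong refl) auto
  also have "\<dots> = of_bool (a < M \<and> b < M) * f (a * M + b)"
  proof (cases "a < M \<and> b < M")
    case True
    then have "a * M + b < M * M"
      by (metis add_mult_distrib less_le_trans Suc_leI mult_Suc mult_le_mono1 nat_add_left_cancel_less add.commute)
    then show ?thesis using True by (subst sum.delta) auto
  qed auto
  finally show ?thesis .
qed

lemma sum_list_filter_of_bool: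
  fixes h :: "'b \<Rightarrow> complex"
  shows "(\<Sum>e\<leftarrow>filter Q es. h e) = (\<Sum>e\<leftarrow>es. of_bool (Q e) * h e)"
  by (induction es) auto

context hashing
begin

text \<open>Only ends of paths carry amplitude, so a kernel may be altered at all other basis
  states.\<close>

lemma pairing_final_cong:
  assumes "\<And>a b U C D. a \<in> inputs \<Longrightarrow> b \<in> inputs \<Longrightarrow> C \<subseteq> cells \<Longrightarrow> D \<subseteq> cells \<Longrightarrow>
      \<chi> (final a U C) (final b U D) = \<chi>' (final a U C) (final b U D)"
  shows "pairing \<chi> (final_state N K circuit \<rho>) = pairing \<chi>' (final_state N K circuit \<rho>)"
proof -
  have "amplitude_sum \<chi> a b = amplitude_sum \<chi>' a b" if "a \<in> inputs" "b \<in> inputs" for a b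
    unfolding amplitude_sum_def using assms[OF that] by (intro sum.cong refl) auto
  then show ?thesis unfolding pairing_final_state by simp
qed

lemma final_state_states: "final_state N K circuit \<rho> \<in> states"
  using final_state_carrier[of N K circuit \<rho>] by (simp add: circuit_def)

lemma set_out_roles: "set out_roles \<subseteq> roles"
  by (auto simp: out_roles_def)

text \<open>A diagonal entry is the pairing with the indicator of one basis state. If its output
  value is out of range, no path ends there, and the indicator may be replaced by 0.\<close>

lemma no_leak:
  assumes z: "z < 2 ^ (width + width)" and nz: "final_state N K circuit \<rho> $$ (z, z) \<noteq> 0"
  shows "wires_val (map pos out_roles) (z div 2 ^ width) < M" "wires_val (map pos out_roles) (z mod 2 ^ width) < M"
proof -
  obtain Z where Z: "Z \<subseteq> wires" "z = idx Z" using z idx_bij by (auto simp: bij_betw_def image_iff set_eq_iff)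
  have "val p out_roles Z < M" for p
  proof (rule ccontr)
    assume ge: "\<not> val p out_roles Z < M"
    have "final_state N K circuit \<rho> $$ (z, z) =
        (\<Sum>Z'\<in>Pow wires. if Z' = Z then (\<Sum>Y\<in>Pow wires. if Y = Z then final_state N K circuit \<rho> $$ (idx Z', idx Y) else 0) else 0)"
      using Z by (subst sum.delta, simp, subst sum.delta) auto
    also have "\<dots> = pairing (\<lambda>Z' Y. of_bool (Z' = Z \<and> Y = Z)) (final_state N K circuit \<rho>)"
      unfolding pairing_def by (intro sum.cong refl) (auto intro!: sum.cong)
    also have "\<dots> = pairing (\<lambda>_ _. 0) (final_state N K circuit \<rho>)"
    proof (rule pairing_final_cong)
      fix a b U C D' assume "a \<in> inputs" "C \<subseteq> cells"
      moreover obtain X e \<kappa> where "a = (X, e, \<kappa>)" by (metis prod_cases3)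
      ultimately have "val p out_roles (final a U C) < M" using val_final(2)[of X e \<kappa> C p U] by simp
      then have "final a U C \<noteq> Z" using ge by auto
      then show "of_bool (final a U C = Z \<and> final b U D' = Z) = (0 :: complex)" by simp
    qed
    also have "\<dots> = 0" by (simp add: pairing_def)
    finally show False using nz by simp
  qed
  then show "wires_val (map pos out_roles) (z div 2 ^ width) < M" "wires_val (map pos out_roles) (z mod 2 ^ width) < M"
    using wires_val_part[OF Z(1) set_out_roles, of Alice] wires_val_part[OF Z(1) set_out_roles, of Bob] Z(2)
    by (simp_all add: part_def)
qed

abbreviation fail_pos :: nat where "fail_pos \<equiv> pos (Chn (2 * t))"

lemma fail_pos_out: "fail_pos \<notin> set (map pos out_roles)"
proof
  assume "fail_pos \<in> set (map pos out_roles)"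
  then obtain r where r: "r \<in> set out_roles" "pos r = fail_pos" by auto
  then have "r = Chn (2 * t)" using pos_inj[of r "Chn (2 * t)"] set_out_roles by auto
  then show False using r(1) by (auto simp: out_roles_def)
qed

lemma bit_fail: "Z \<subseteq> wires \<Longrightarrow> bit (part Alice (idx Z)) fail_pos \<longleftrightarrow> (Alice, Chn (2 * t)) \<in> Z"
  by (rule bit_part) auto

definition kraus_out :: "complex mat list" where
  "kraus_out = [kron (readout width (map pos out_roles) M e) (readout width (map pos out_roles) M f).
     e \<leftarrow> filter (\<lambda>e. \<not> bit e fail_pos) (env_states width (map pos out_roles)),
     f \<leftarrow> env_states width (map pos out_roles)]"

definition same_env :: "party \<Rightarrow> (party \<times> role) set \<Rightarrow> (party \<times> role) set \<Rightarrow> bool" where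
  "same_env p Z Y \<longleftrightarrow> (\<forall>r\<in>roles. r \<notin> set out_roles \<longrightarrow> ((p, r) \<in> Z \<longleftrightarrow> (p, r) \<in> Y))"

text \<open>Summing over environments traces out the other wires: both states must agree there. The
  filter \<open>Q\<close> is thereby evaluated on their common environment.\<close>

lemma readout_sum:
  assumes Z: "Z \<subseteq> wires" and Y: "Y \<subseteq> wires" and ij: "i < M" "j < M"
  shows "(\<Sum>e\<leftarrow>env_states width (map pos out_roles). of_bool (Q e) *
      (readout width (map pos out_roles) M e $$ (i, part p (idx Z)) * cnj (readout width (map pos out_roles) M e $$ (j, part p (idx Y))))) =
    of_bool (Q (clear_wires (map pos out_roles) (part p (idx Z))) \<and> same_env p Z Y \<and>
      val p out_roles Z = i \<and> val p out_roles Y = j)"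
proof -
  define ws where "ws = map pos out_roles"
  define x where "x = part p (idx Z)"
  define y where "y = part p (idx Y)"
  have xy: "x < 2 ^ width" "y < 2 ^ width" using part_less Z Y by (auto simp: x_def y_def)
  have v: "wires_val ws x = val p out_roles Z" "wires_val ws y = val p out_roles Y"
    using wires_val_part[OF _ set_out_roles] Z Y by (auto simp: ws_def x_def y_def)
  define ag where "ag = (\<lambda>x e :: nat. \<forall>w<width. w \<notin> set ws \<longrightarrow> bit (x :: nat) w = bit e w)"
  have R: "readout width ws M e $$ (i, x) = of_bool (wires_val ws x = i \<and> ag x e)"
    if "i < M" "x < 2 ^ width" for i x e
    using that by (simp add: readout_def ag_def)
  have "(\<Sum>e\<leftarrow>env_states width ws. of_bool (Q e) * (readout width ws M e $$ (i, x) * cnj (readout width ws M e $$ (j, y)))) =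
    (\<Sum>e\<leftarrow>env_states width ws. of_bool (ag x e) * of_bool (Q e \<and> ag y e \<and> wires_val ws x = i \<and> wires_val ws y = j))"
    using ij xy by (intro arg_cong[where f = sum_list] map_cong refl) (auto simp: R)
  also have "\<dots> = of_bool (Q (clear_wires ws x) \<and> ag y (clear_wires ws x) \<and> wires_val ws x = i \<and> wires_val ws y = j)"
    unfolding ag_def by (rule sum_env_states[OF xy(1)])
  also have "ag y (clear_wires ws x) \<longleftrightarrow> (\<forall>w<width. w \<notin> set ws \<longrightarrow> bit x w = bit y w)"
    by (auto simp: ag_def bit_clear_wires)
  also have "\<dots> \<longleftrightarrow> same_env p Z Y"
    unfolding x_def y_def ws_def same_env_def by (rule agree_iff[OF Z Y set_out_roles])
  finally show ?thesis by (simp add: ws_def x_def y_def v[unfolded ws_def x_def y_def])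
qed

text \<open>A matrix entry of the unnormalised output as a functional of the final state.\<close>

definition out_kernel :: "nat \<Rightarrow> nat \<Rightarrow> (party \<times> role) set \<Rightarrow> (party \<times> role) set \<Rightarrow> complex" where
  "out_kernel k l Z Y = of_bool ((Alice, Chn (2 * t)) \<notin> Z \<and> same_env Alice Z Y \<and> same_env Bob Z Y) *
     (of_bool (val Alice out_roles Z = k div M \<and> val Bob out_roles Z = k mod M) *
      of_bool (val Alice out_roles Y = l div M \<and> val Bob out_roles Y = l mod M))"

lemma kraus_out_carrier: "E \<in> set kraus_out \<Longrightarrow> E \<in> carrier_mat (M * M) (2 ^ width * 2 ^ width)"
  by (auto simp: kraus_out_def intro!: kron_carrier)

lemma apply_kraus_out:
  assumes \<omega>: "\<omega> \<in> states" and kl: "k < M * M" "l < M * M"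
  shows "apply_kraus (M * M) kraus_out \<omega> $$ (k, l) = pairing (out_kernel k l) \<omega>"
proof -
  define R where "R = readout width (map pos out_roles) M"
  define es where "es = env_states width (map pos out_roles)"
  note kd = div_mod_less[OF kl(1)] and ld = div_mod_less[OF kl(2)]
  have RE: "R e \<in> carrier_mat M (2 ^ width)" for e by (simp add: R_def)
  have entry: "kron (R e) (R f) $$ (k, idx Z) = R e $$ (k div M, part Alice (idx Z)) * R f $$ (k mod M, part Bob (idx Z))"
    if "k < M * M" "Z \<subseteq> wires" for e f k Z
    using that idx_less[OF that(2)] by (simp add: R_def part_def)
  have sand: "sandwich (kron (R e) (R f)) \<omega> $$ (k, l) = (\<Sum>Z\<in>Pow wires. \<Sum>Y\<in>Pow wires.
      (R e $$ (k div M, part Alice (idx Z)) * cnj (R e $$ (l div M, part Alice (idx Y)))) *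
      (R f $$ (k mod M, part Bob (idx Z)) * cnj (R f $$ (l mod M, part Bob (idx Y)))) * \<omega> $$ (idx Z, idx Y))" for e f
  proof -
    have "sandwich (kron (R e) (R f)) \<omega> $$ (k, l) = (\<Sum>z<2 ^ (width + width). \<Sum>y<2 ^ (width + width).
        kron (R e) (R f) $$ (k, z) * \<omega> $$ (z, y) * cnj (kron (R e) (R f) $$ (l, y)))"
      using sandwich_index[OF kron_carrier[OF RE RE] \<omega> kl] by (simp add: power_add)
    also have "\<dots> = (\<Sum>Z\<in>Pow wires. \<Sum>Y\<in>Pow wires.
      (R e $$ (k div M, part Alice (idx Z)) * cnj (R e $$ (l div M, part Alice (idx Y)))) *
      (R f $$ (k mod M, part Bob (idx Z)) * cnj (R f $$ (l mod M, part Bob (idx Y)))) * \<omega> $$ (idx Z, idx Y))"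
      unfolding sum.reindex_bij_betw[OF idx_bij, symmetric]
      by (intro sum.cong refl) (simp add: entry kl mult_ac del: kron_index)
    finally show ?thesis .
  qed
  have "apply_kraus (M * M) kraus_out \<omega> $$ (k, l) = (\<Sum>E\<leftarrow>kraus_out. sandwich E \<omega> $$ (k, l))"
    by (rule apply_kraus_index[OF kraus_out_carrier kl])
  also have "\<dots> = (\<Sum>e\<leftarrow>filter (\<lambda>e. \<not> bit e fail_pos) es. \<Sum>f\<leftarrow>es. sandwich (kron (R e) (R f)) \<omega> $$ (k, l))"
    by (simp add: kraus_out_def R_def es_def map_concat sum_list_concat comp_def)
  also have "\<dots> = (\<Sum>Z\<in>Pow wires. \<Sum>Y\<in>Pow wires. (\<Sum>e\<leftarrow>es. of_bool (\<not> bit e fail_pos) *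
      (R e $$ (k div M, part Alice (idx Z)) * cnj (R e $$ (l div M, part Alice (idx Y))))) *
      (\<Sum>f\<leftarrow>es. of_bool True * (R f $$ (k mod M, part Bob (idx Z)) * cnj (R f $$ (l mod M, part Bob (idx Y))))) * \<omega> $$ (idx Z, idx Y))"
    unfolding sand sum_list_sum_swap sum_list_filter_of_bool
    by (intro sum.cong refl) (simp add: sum_list_mult_const[symmetric] sum_list_const_mult[symmetric] mult_ac)
  also have "\<dots> = pairing (out_kernel k l) \<omega>"
    unfolding pairing_def
  proof (intro sum.cong refl)
    fix Z Y assume "Z \<in> Pow wires" "Y \<in> Pow wires"
    then have Z: "Z \<subseteq> wires" and Y: "Y \<subseteq> wires" by auto
    have cl: "bit (clear_wires (map pos out_roles) (part Alice (idx Z))) fail_pos \<longleftrightarrow> (Alice, Chn (2 * t)) \<in> Z"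
      unfolding bit_clear_wires using fail_pos_out bit_fail[OF Z] by simp
    show "(\<Sum>e\<leftarrow>es. of_bool (\<not> bit e fail_pos) *
      (R e $$ (k div M, part Alice (idx Z)) * cnj (R e $$ (l div M, part Alice (idx Y))))) *
      (\<Sum>f\<leftarrow>es. of_bool True * (R f $$ (k mod M, part Bob (idx Z)) * cnj (R f $$ (l mod M, part Bob (idx Y))))) * \<omega> $$ (idx Z, idx Y) =
      out_kernel k l Z Y * \<omega> $$ (idx Z, idx Y)"
      unfolding R_def es_def readout_sum[OF Z Y kd(1) ld(1)] readout_sum[OF Z Y kd(2) ld(2)] cl out_kernel_def
      by auto
  qed
  finally show ?thesis .
qed

lemma pairing_sum: "pairing (\<lambda>Z Y. \<Sum>i\<in>I. \<chi> i Z Y) \<omega> = (\<Sum>i\<in>I. pairing (\<chi> i) \<omega>)"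
proof -
  have "pairing (\<lambda>Z Y. \<Sum>i\<in>I. \<chi> i Z Y) \<omega> = (\<Sum>Z\<in>Pow wires. \<Sum>Y\<in>Pow wires. \<Sum>i\<in>I. \<chi> i Z Y * \<omega> $$ (idx Z, idx Y))"
    by (simp add: pairing_def sum_distrib_right)
  also have "\<dots> = (\<Sum>Z\<in>Pow wires. \<Sum>i\<in>I. \<Sum>Y\<in>Pow wires. \<chi> i Z Y * \<omega> $$ (idx Z, idx Y))"
    by (intro sum.cong refl sum.swap)
  also have "\<dots> = (\<Sum>i\<in>I. \<Sum>Z\<in>Pow wires. \<Sum>Y\<in>Pow wires. \<chi> i Z Y * \<omega> $$ (idx Z, idx Y))"
    by (rule sum.swap)
  finally show ?thesis by (simp add: pairing_def)
qed

lemma pairing_scale: "pairing (\<lambda>Z Y. c * \<chi> Z Y) \<omega> = c * pairing \<chi> \<omega>"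
  by (simp add: pairing_def sum_distrib_left mult.assoc)

lemma val_eq_iff: "val p rs Z = val p rs Y \<longleftrightarrow> (\<forall>r\<in>set rs. (p, r) \<in> Z \<longleftrightarrow> (p, r) \<in> Y)"
proof
  assume eq: "val p rs Z = val p rs Y"
  show "\<forall>r\<in>set rs. (p, r) \<in> Z \<longleftrightarrow> (p, r) \<in> Y"
  proof
    fix r assume "r \<in> set rs"
    then obtain q where "q < length rs" "r = rs ! q" by (metis in_set_conv_nth)
    then show "(p, r) \<in> Z \<longleftrightarrow> (p, r) \<in> Y" using bit_val[of p rs Z q] bit_val[of p rs Y q] eq by simp
  qed
next
  assume "\<forall>r\<in>set rs. (p, r) \<in> Z \<longleftrightarrow> (p, r) \<in> Y"
  then show "val p rs Z = val p rs Y" by (intro bit_eqI) (auto simp: bit_val)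
qed

lemma same_env_val_iff:
  assumes "Z \<subseteq> wires" "Y \<subseteq> wires"
  shows "Z = Y \<longleftrightarrow> (\<forall>p. same_env p Z Y \<and> val p out_roles Z = val p out_roles Y)"
proof -
  have "(\<forall>r\<in>roles. (p, r) \<in> Z \<longleftrightarrow> (p, r) \<in> Y) \<longleftrightarrow> same_env p Z Y \<and> val p out_roles Z = val p out_roles Y" for p
    unfolding same_env_def val_eq_iff using set_out_roles by blast
  then show ?thesis unfolding set_eq_iff_parts[OF assms] by blast
qed

text \<open>Summing over the diagonal identifies ket and bra on the output wires as well, which
  gives the pass kernel up to the restriction to values below \<open>M\<close>; every end of a path
  satisfies that restriction.\<close>

lemma trace_out:
  "mat_trace (apply_kraus (M * M) kraus_out (final_state N K circuit \<rho>)) = pairing pass_kernel (final_state N K circuit \<rho>)"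
proof -
  let ?\<omega> = "final_state N K circuit \<rho>"
  have car: "apply_kraus (M * M) kraus_out ?\<omega> \<in> carrier_mat (M * M) (M * M)"
    by (rule apply_kraus_carrier[OF kraus_out_carrier])
  have "mat_trace (apply_kraus (M * M) kraus_out ?\<omega>) = pairing (\<lambda>Z Y. \<Sum>k<M * M. out_kernel k k Z Y) ?\<omega>"
    using car unfolding mat_trace_def pairing_sum by (simp add: apply_kraus_out final_state_states)
  also have "\<dots> = pairing (\<lambda>Z Y. of_bool (val Alice out_roles Z < M \<and> val Bob out_roles Z < M) * pass_kernel Z Y) ?\<omega>"
  proof (rule pairing_cong)
    fix Z Y assume ZY: "Z \<subseteq> wires" "Y \<subseteq> wires"
    let ?a = "val Alice out_roles Z" and ?b = "val Bob out_roles Z" and ?a' = "val Alice out_roles Y" and ?b' = "val Bob out_roles Y"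
    let ?c = "(Alice, Chn (2 * t)) \<notin> Z \<and> same_env Alice Z Y \<and> same_env Bob Z Y"
    have "(\<Sum>k<M * M. out_kernel k k Z Y) = (\<Sum>k<M * M. of_bool (?c \<and> ?a = ?a' \<and> ?b = ?b') * of_bool (?a = k div M \<and> ?b = k mod M))"
      unfolding out_kernel_def by (intro sum.cong refl) auto
    also have "\<dots> = of_bool (?a < M \<and> ?b < M) * of_bool (?c \<and> ?a = ?a' \<and> ?b = ?b')"
      by (rule sum_div_mod)
    also have "?c \<and> ?a = ?a' \<and> ?b = ?b' \<longleftrightarrow> Z = Y \<and> (Alice, Chn (2 * t)) \<notin> Z"
      unfolding same_env_val_iff[OF ZY] all_party by auto
    finally show "(\<Sum>k<M * M. out_kernel k k Z Y) = of_bool (?a < M \<and> ?b < M) * pass_kernel Z Y"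
      by (simp add: pass_kernel_def)
  qed
  also have "\<dots> = pairing pass_kernel ?\<omega>"
  proof (rule pairing_final_cong)
    fix a b U C D' assume "a \<in> inputs" "C \<subseteq> cells"
    moreover obtain X e \<kappa> where "a = (X, e, \<kappa>)" by (metis prod_cases3)
    ultimately have "val p out_roles (final a U C) < M" for p using val_final(2)[of X e \<kappa> C p U] by simp
    then show "of_bool (val Alice out_roles (final a U C) < M \<and> val Bob out_roles (final a U C) < M) *
      pass_kernel (final a U C) (final b U D') = pass_kernel (final a U C) (final b U D')" by simp
  qed
  finally show ?thesis .
qed

text \<open>The two amplitudes \<open>1 / sqrt M\<close> give the denominator; what remains selects
  equal output values of Alice and Bob in ket and bra separately.\<close>

lemma fidelity_out:
  "(apply_kraus (M * M) kraus_out (final_state N K circuit \<rho>) *\<^sub>v max_ent M) \<bullet>c max_ent M =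
    pairing fidelity_kernel (final_state N K circuit \<rho>) / of_nat M"
proof -
  let ?\<omega> = "final_state N K circuit \<rho>"
  let ?d = "\<lambda>k. of_bool (k div M = k mod M) :: complex"
  have car: "apply_kraus (M * M) kraus_out ?\<omega> \<in> carrier_mat (M * M) (M * M)"
    by (rule apply_kraus_carrier[OF kraus_out_carrier])
  have v: "max_ent M \<in> carrier_vec (M * M)" by (simp add: max_ent_def)
  have me: "max_ent M $ k = ?d k / complex_of_real (sqrt M)" if "k < M * M" for k
    using that by (simp add: max_ent_def)
  have sq: "complex_of_real (sqrt M) * complex_of_real (sqrt M) = of_nat M" by (simp flip: of_real_mult)
  have "(apply_kraus (M * M) kraus_out ?\<omega> *\<^sub>v max_ent M) \<bullet>c max_ent M =
      (\<Sum>k<M * M. \<Sum>l<M * M. 1 / of_nat M * (?d k * ?d l * pairing (out_kernel k l) ?\<omega>))"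
    unfolding form_mat[OF car v]
    by (intro sum.cong refl) (simp add: me apply_kraus_out final_state_states sq)
  also have "\<dots> = 1 / of_nat M * pairing (\<lambda>Z Y. \<Sum>k<M * M. \<Sum>l<M * M. ?d k * ?d l * out_kernel k l Z Y) ?\<omega>"
    by (simp only: sum_distrib_left[symmetric] pairing_sum pairing_scale)
  also have "pairing (\<lambda>Z Y. \<Sum>k<M * M. \<Sum>l<M * M. ?d k * ?d l * out_kernel k l Z Y) ?\<omega> = pairing fidelity_kernel ?\<omega>"
  proof (rule pairing_cong)
    fix Z Y assume ZY: "Z \<subseteq> wires" "Y \<subseteq> wires"
    let ?a = "val Alice out_roles Z" and ?b = "val Bob out_roles Z" and ?a' = "val Alice out_roles Y" and ?b' = "val Bob out_roles Y"
    let ?c = "of_bool ((Alice, Chn (2 * t)) \<notin> Z \<and> same_env Alice Z Y \<and> same_env Bob Z Y) :: complex"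
    have "(\<Sum>k<M * M. \<Sum>l<M * M. ?d k * ?d l * out_kernel k l Z Y) =
      ?c * ((\<Sum>k<M * M. ?d k * of_bool (?a = k div M \<and> ?b = k mod M)) * (\<Sum>l<M * M. ?d l * of_bool (?a' = l div M \<and> ?b' = l mod M)))"
      unfolding sum_product unfolding sum_distrib_left out_kernel_def by (intro sum.cong refl) (simp only: mult_ac)
    also have "\<dots> = ?c * ((of_bool (?a < M \<and> ?b < M) * ?d (?a * M + ?b)) * (of_bool (?a' < M \<and> ?b' < M) * ?d (?a' * M + ?b')))"
      unfolding sum_div_mod ..
    also have "of_bool (?a < M \<and> ?b < M) * ?d (?a * M + ?b) = of_bool (?a = ?b \<and> ?a < M)"
      using mult_add_div_mod[of ?b M ?a] by (cases "?a < M \<and> ?b < M") auto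
    also have "of_bool (?a' < M \<and> ?b' < M) * ?d (?a' * M + ?b') = of_bool (?a' = ?b' \<and> ?a' < M)"
      using mult_add_div_mod[of ?b' M ?a'] by (cases "?a' < M \<and> ?b' < M") auto
    also have "same_env Alice Z Y \<and> same_env Bob Z Y \<longleftrightarrow> (\<forall>v\<in>wires. snd v \<notin> set out_roles \<longrightarrow> (v \<in> Z \<longleftrightarrow> v \<in> Y))"
      unfolding same_env_def wires_def by (auto simp: all_party)
    finally show "(\<Sum>k<M * M. \<Sum>l<M * M. ?d k * ?d l * out_kernel k l Z Y) = fidelity_kernel Z Y"
      by (simp add: fidelity_kernel_def flip: of_bool_conj)
  qed
  finally show ?thesis by simp
qed

lemma pairing_diag: "pairing (\<lambda>Z Y. of_bool (Z = Y \<and> P Z)) \<omega> = (\<Sum>Z\<in>Pow wires. of_bool (P Z) * \<omega> $$ (idx Z, idx Z))"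
  unfolding pairing_def
proof (intro sum.cong refl)
  fix Z assume Z: "Z \<in> Pow wires"
  have "(\<Sum>Y\<in>Pow wires. of_bool (Z = Y \<and> P Z) * \<omega> $$ (idx Z, idx Y)) =
    (\<Sum>Y\<in>Pow wires. if Z = Y then of_bool (P Z) * \<omega> $$ (idx Z, idx Y) else 0)"
    by (intro sum.cong refl) auto
  then show "(\<Sum>Y\<in>Pow wires. of_bool (Z = Y \<and> P Z) * \<omega> $$ (idx Z, idx Y)) = of_bool (P Z) * \<omega> $$ (idx Z, idx Z)"
    using Z by (subst (asm) sum.delta') auto
qed

lemma fail_out:
  "mat_trace (sandwich (local_op Alice (2 ^ width) (2 ^ width) (wire_proj width fail_pos True)) (final_state N K circuit \<rho>)) =
    pairing trace_kernel (final_state N K circuit \<rho>) - pairing pass_kernel (final_state N K circuit \<rho>)"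
proof -
  let ?\<omega> = "final_state N K circuit \<rho>"
  have \<omega>: "?\<omega> \<in> carrier_mat (2 ^ (width + width)) (2 ^ (width + width))"
    using final_state_states[of \<rho>] by (simp add: power_add)
  have "mat_trace (sandwich (local_op Alice (2 ^ width) (2 ^ width) (wire_proj width fail_pos True)) ?\<omega>) =
    (\<Sum>z<2 ^ (width + width). of_bool (bit (z div 2 ^ width) fail_pos) * ?\<omega> $$ (z, z))"
    by (rule trace_sandwich_pmat[OF _ \<omega>, where r = "2 ^ width * 2 ^ width"])
      (auto simp: local_op_def wire_proj_eq_pmat kron_effect pmat_True[symmetric] pmat_effect kron_pmat power_add
        intro!: kron_carrier)
  also have "\<dots> = (\<Sum>Z\<in>Pow wires. of_bool ((Alice, Chn (2 * t)) \<in> Z) * ?\<omega> $$ (idx Z, idx Z))"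
    unfolding sum.reindex_bij_betw[OF idx_bij, symmetric]
    by (intro sum.cong refl) (simp add: bit_fail[unfolded part_def party.case])
  also have "\<dots> = (\<Sum>Z\<in>Pow wires. of_bool True * ?\<omega> $$ (idx Z, idx Z)) - (\<Sum>Z\<in>Pow wires. of_bool ((Alice, Chn (2 * t)) \<notin> Z) * ?\<omega> $$ (idx Z, idx Z))"
    unfolding sum_subtractf[symmetric] by (intro sum.cong refl) auto
  also have "\<dots> = pairing trace_kernel ?\<omega> - pairing pass_kernel ?\<omega>"
    unfolding pairing_diag[symmetric] pass_kernel_def[abs_def, symmetric] trace_kernel_def[abs_def] by simp
  finally show ?thesis .
qed

subsection \<open>The protocol\<close>

lemma ceillog2_dims: "ceillog2 N = m + s" "ceillog2 K = len + 2 * t" "ceillog2 M = m + len"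
  using ceillog2_mult_power[OF K0, of m] ceillog2_mult_power[OF K0, of "2 * t"]
  by (simp_all add: N_def K_def M_def len_def mult.commute)

lemma valid_circuit: "valid_circuit N K M circuit"
proof -
  have pl: "pos (Dat i) < width" "pos (Eb j) < width" "pos (Key q) < width" "pos (Rnd j k) < width" "pos (Chn l) < width"
    if "i < m + s" "j < 2 * t" "q < len" "k < m" "l \<le> 2 * t" for i j q k l
    using that pos_less by auto
  have neq: "pos r \<noteq> pos r'" if "r \<in> roles" "r' \<in> roles" "r \<noteq> r'" for r r'
    using that pos_inj by auto
  have had: "valid_instruction width width (Gate p [pos r] hadamard)" if "r \<in> roles" for p r
    using that pos_less hadamard_unitary by (auto split: party.splits)
  have flip: "valid_instruction width width (Gate p (map pos [r, r', r'']) (controlled_flip f))"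
    if "{r, r', r''} \<subseteq> roles" "distinct [r, r', r'']" for p r r' r'' f
    using that pos_less neq controlled_flip_unitary by (auto split: party.splits)
  have send: "valid_instruction width width (Send p (pos r) (pos r'))" if "r \<in> roles" "r' \<in> roles" for p r r'
    using that pos_less by (auto split: party.splits)
  have "valid_instruction width width i" if "i \<in> set circuit_instructions" for i
    using that unfolding circuit_instructions_def hadamards_def parities_def rnd_wires_def dat_wires_def set_append set_map Un_iff
    by (auto simp del: valid_instruction.simps list.map intro!: had flip send)
  moreover have "distinct (map pos out_roles)"
  proof -
    have "distinct out_roles" by (auto simp: out_roles_def distinct_map inj_on_def)
    moreover have "inj_on pos (set out_roles)"
      using pos_bij set_out_roles by (meson bij_betw_def inj_on_subset)
    ultimately show ?thesis by (simp add: distinct_map)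
  qed
  moreover have "set (map pos out_roles) \<subseteq> {..<width}" using set_out_roles pos_less by auto
  moreover have "fail_pos < width" using pos_less by auto
  moreover have "length out_roles = m + len" by (simp add: out_roles_def)
  ultimately show ?thesis
    using fail_pos_out unfolding valid_circuit_def circuit_def out_roles_def[symmetric]
    by (auto simp: ceillog2_dims width_def)
qed

text \<open>The size is of order \<open>t * m\<close>, and both factors are bounded by the logarithm
  of the total dimension; hence the exponent 2. The constant 100 is generous.\<close>

lemma size_circuit:
  assumes t: "0 < t"
  shows "real (circuit_size circuit) \<le> 100 * (log 2 (real N) + log 2 (real K)) ^ 2"
proof -
  define x where "x = log 2 (real N) + log 2 (real K)"
  define k where "k = log 2 (real K\<^sub>0)"
  have k0: "0 \<le> k" using K0 by (simp add: k_def)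
  have lN: "log 2 (real N) = real m + real s"
    by (simp add: N_def log_nat_power)
  have lK: "log 2 (real K) = k + 2 * real t"
    using K0 by (simp add: K_def k_def log_mult log_nat_power)
  have x: "x = real m + real s + k + 2 * real t" by (simp add: x_def lN lK)
  have "real len \<le> k + 1"
    using ceillog2_less_log[OF K0] by (simp add: len_def k_def)
  \<comment> \<open>Of the leading term the registers account for 4 and the instructions for 8: two
    layers of \<open>2 * t * m\<close> Toffoli gates, and a Hadamard gate and a \<open>Send\<close>
    for each of the \<open>2 * t * m\<close> random bits.\<close>
  moreover have "real (circuit_size circuit) = 12 * (real t * real m) + 4 * real m + 2 * real s + 12 * real t + 2 * real len + 2"
    by (simp add: circuit_size_def circuit_def circuit_instructions_def hadamards_def parities_def
        rnd_wires_def dat_wires_def width_def length_product algebra_simps)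
  ultimately have "real (circuit_size circuit) \<le> 12 * (real t * real m) + 6 * x + 4"
    using x k0 by linarith
  \<comment> \<open>The summand \<open>2 * t\<close> in \<open>x\<close> makes it large enough to
    absorb the additive constants.\<close>
  moreover have x1: "1 \<le> x" using t k0 unfolding x by linarith
  moreover have "real t * real m \<le> x * x"
    using k0 by (intro mult_mono) (auto simp: x)
  moreover have "x \<le> x * x" using x1 by simp
  ultimately show ?thesis unfolding x_def[symmetric] power2_eq_square by linarith
qed

lemma implements_circuit: "implements N K M circuit (circuit_protocol N K M circuit)"
proof (rule implements_circuit_protocol[OF valid_circuit N_pos K_pos])
  fix \<rho> z
  assume "z < 2 ^ (alice_wires circuit + bob_wires circuit)" "final_state N K circuit \<rho> $$ (z, z) \<noteq> 0"
  then show "wires_val (alice_out circuit) (z div 2 ^ bob_wires circuit) < M \<and>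
      wires_val (bob_out circuit) (z mod 2 ^ bob_wires circuit) < M"
    using no_leak[of z \<rho>] by (simp add: circuit_def out_roles_def)
qed

text \<open>The value of the empty list of record wires is 0, so all other retained values have the
  zero matrix as output.\<close>

lemma circuit_result_eq:
  "circuit_result N K M circuit \<rho> = (Re (pairing trace_kernel (final_state N K circuit \<rho>) - pairing pass_kernel (final_state N K circuit \<rho>)),
    \<lambda>r. if r = 0 then apply_kraus (M * M) kraus_out (final_state N K circuit \<rho>) else 0\<^sub>m (M * M) (M * M))"
proof -
  have fl: "filter (\<lambda>e. \<not> bit e fail_pos \<and> wires_val [] e = r) es = (if r = 0 then filter (\<lambda>e. \<not> bit e fail_pos) es else [])" for r es
    by (auto simp: wires_val_def)
  show ?thesis
    unfolding circuit_result_def Let_def fail_out[symmetric]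
    by (auto simp: circuit_def out_roles_def[symmetric] fl kraus_out_def apply_kraus_def fun_eq_iff simp del: map_append)
qed

lemma prob_cond_successful:
  assumes t: "0 < t" and \<epsilon>: "0 \<le> \<epsilon>" "\<epsilon> < 1 / 2"
  shows "prob_cond_successful
    (N, K, M, \<epsilon>, \<epsilon> / 2 powi (int t - 3), 2 * \<epsilon> + sqrt (2 * \<epsilon> / 2 ^ t), 1 / 2 ^ t) (circuit_protocol N K M circuit)"
proof -
  have "fail \<le> 2 * \<epsilon> + sqrt (2 * \<epsilon> / 2 ^ t) \<and>
      (fail < 1 \<longrightarrow> prob_fidelity_ge M (1 - \<epsilon> / 2 powi (int t - 3)) \<sigma> / (1 - fail) \<ge> 1 - 1 / 2 ^ t)"
    if \<rho>: "density_operator (N * N) \<rho>" and F: "fidelity N \<rho> = 1 - \<epsilon>"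
      and res: "gepp_result N K M (circuit_protocol N K M circuit) \<rho> = (fail, \<sigma>)" for \<rho> fail \<sigma>
  proof -
    let ?\<omega> = "final_state N K circuit \<rho>"
    define T where "T = Re (pairing pass_kernel ?\<omega>)"
    define G where "G = (\<Sum>d\<in>sectors. of_bool (snd d = {}) * block_sum \<rho> d) / 2 ^ m"
    define \<delta> where "\<delta> = \<epsilon> / 2 powi (int t - 3)"
    note pb = pass_bounds[OF \<rho>, folded G_def T_def]
    have pT: "pairing pass_kernel ?\<omega> = complex_of_real T"
      unfolding T_def pass_value[OF \<rho>] by simp
    have "circuit_result N K M circuit \<rho> = (fail, \<sigma>)"
      using implements_circuit \<rho> res by (simp add: implements_def)
    then have fail: "fail = 1 - T" and \<sigma>: "\<sigma> = (\<lambda>r. if r = 0 then apply_kraus (M * M) kraus_out ?\<omega> else 0\<^sub>m (M * M) (M * M))"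
      unfolding circuit_result_eq pairing_trace density_trace[OF \<rho>] pT by auto
    have G: "1 - \<epsilon> \<le> G" using fidelity_le[OF \<rho>] F by (simp add: G_def)
    have T1: "1 - \<epsilon> \<le> T" using G pb(1) by simp
    have T0: "0 < T" using T1 \<epsilon> by simp
    have tr0: "mat_trace (\<sigma> 0) = complex_of_real T" using trace_out pT by (simp add: \<sigma>)
    have trr: "mat_trace (\<sigma> r) = 0" if "r \<noteq> 0" for r using that by (simp add: \<sigma> mat_trace_def)
    have fid: "fidelity M (inverse (mat_trace (\<sigma> 0)) \<cdot>\<^sub>m \<sigma> 0) = G / T"
    proof -
      have car: "\<sigma> 0 \<in> carrier_mat (M * M) (M * M)"
        unfolding \<sigma> using apply_kraus_carrier[OF kraus_out_carrier] by simp
      have v: "max_ent M \<in> carrier_vec (M * M)" by (simp add: max_ent_def)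
      have "((c \<cdot>\<^sub>m \<sigma> 0) *\<^sub>v max_ent M) \<bullet>c max_ent M = c * ((\<sigma> 0 *\<^sub>v max_ent M) \<bullet>c max_ent M)" for c
        unfolding form_mat[OF smult_carrier_mat[OF car] v] form_mat[OF car v] sum_distrib_left
        using car by (intro sum.cong refl) auto
      moreover have "(\<sigma> 0 *\<^sub>v max_ent M) \<bullet>c max_ent M = pairing fidelity_kernel ?\<omega> / of_nat M"
        using fidelity_out by (simp add: \<sigma>)
      ultimately have "fidelity M (inverse (mat_trace (\<sigma> 0)) \<cdot>\<^sub>m \<sigma> 0) = Re (pairing fidelity_kernel ?\<omega> / of_nat M) / T"
        unfolding fidelity_def tr0 by (simp add: divide_inverse mult.commute flip: of_real_inverse)
      also have "Re (pairing fidelity_kernel ?\<omega> / of_nat M) = G"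
        using K0 by (simp add: fidelity_value G_def M_def)
      finally show ?thesis .
    qed
    \<comment> \<open>The exponent t - 3 may be negative, hence the integer power.\<close>
    have \<delta>: "\<delta> = 8 * \<epsilon> / 2 ^ t" by (simp add: \<delta>_def power_int_diff)
    have "T - G \<le> \<delta> * T"
    proof -
      have "T - G \<le> 2 * (1 - G) / 2 ^ t" by (rule pb(2))
      also have "\<dots> \<le> 2 * \<epsilon> / 2 ^ t" using G by (simp add: divide_right_mono)
      also have "\<dots> \<le> 8 * \<epsilon> / 2 ^ t * T"
      proof -
        \<comment> \<open>The success probability \<open>T\<close> is at least 1 - \<epsilon> > 1/2,
          more than the 1/4 that is required here.\<close>
        have "2 * \<epsilon> \<le> 8 * \<epsilon> * T" using T1 \<epsilon> by (simp add: mult_left_mono[of "1 / 4" T "8 * \<epsilon>", simplified])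
        then show ?thesis by (simp add: divide_right_mono)
      qed
      finally show ?thesis by (simp add: \<delta>)
    qed
    then have "1 - \<delta> \<le> G / T" using T0 by (simp add: field_simps)
    \<comment> \<open>There is a single successful result and its fidelity is always high enough, so
      the conditional probability is 1.\<close>
    then have "mat_trace (\<sigma> r) \<noteq> 0 \<and> fidelity M (inverse (mat_trace (\<sigma> r)) \<cdot>\<^sub>m \<sigma> r) \<ge> 1 - \<delta> \<longleftrightarrow> r = 0" for r
      using fid tr0 trr T0 by (cases "r = 0") auto
    then have "prob_fidelity_ge M (1 - \<delta>) \<sigma> = T"
      by (simp add: prob_fidelity_ge_def tr0)
    then have "prob_fidelity_ge M (1 - \<delta>) \<sigma> / (1 - fail) = 1" using T0 by (simp add: fail)
    moreover have "fail \<le> 2 * \<epsilon> + sqrt (2 * \<epsilon> / 2 ^ t)"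
    proof -
      have "0 \<le> sqrt (2 * \<epsilon> / 2 ^ t)" using \<epsilon> by simp
      then show ?thesis using T1 \<epsilon> unfolding fail by linarith
    qed
    ultimately show ?thesis by (simp add: \<delta>_def)
  qed
  then show ?thesis by (auto split: prod.splits)
qed

end

section \<open>From a single circuit to the parameter families\<close>

lemma purification_protocol:
  fixes \<epsilon> :: real
  assumes "0 < K\<^sub>0" "0 < t" "0 \<le> \<epsilon>" "\<epsilon> < 1 / 2"
    and "N = 2 ^ (m + s)" "K = K\<^sub>0 * 2 ^ (2 * t)" "M = 2 ^ m * K\<^sub>0"
  shows "\<exists>P. (gepp N K M P \<and> prob_cond_successful
      (N, K, M, \<epsilon>, \<epsilon> / 2 powi (int t - 3), 2 * \<epsilon> + sqrt (2 * \<epsilon> / 2 ^ t), 1 / 2 ^ t) P) \<and>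
    (\<exists>C. implements N K M C P \<and> real (circuit_size C) \<le> 100 * (log 2 (real N) + log 2 (real K)) ^ 2)"
proof -
  interpret hashing m s t K\<^sub>0 by unfold_locales (rule assms)
  have dims: "N = hashing.N m s" "K = hashing.K t K\<^sub>0" "M = hashing.M m K\<^sub>0"
    using assms(5-7) by (simp_all add: N_def K_def M_def)
  show ?thesis
    unfolding dims
    using gepp_circuit_protocol[OF valid_circuit N_pos K_pos] prob_cond_successful[OF assms(2-4)]
      implements_circuit size_circuit[OF assms(2)] by blast
qed

text \<open>One pair of constants \<open>B\<close> and \<open>c\<close> serves all parameters; the
  protocols are then picked by choice.\<close>

lemma efficient_pcs_gepps_existI:
  assumes "\<And>i. i \<in> I \<Longrightarrow> case par i of (N, K, M, r) \<Rightarrow> \<exists>P. (gepp N K M P \<and> prob_cond_successful (N, K, M, r) P) \<and>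
    (\<exists>C. implements N K M C P \<and> real (circuit_size C) \<le> B * (log 2 (real N) + log 2 (real K)) ^ c)"
  shows "efficient_pcs_gepps_exist I par"
proof -
  have "\<forall>i\<in>I. \<exists>P. (case par i of (N, K, M, _) \<Rightarrow> gepp N K M P) \<and> prob_cond_successful (par i) P \<and>
    (case par i of (N, K, M, _) \<Rightarrow> \<exists>C. implements N K M C P \<and>
         real (circuit_size C) \<le> B * (log 2 (real N) + log 2 (real K)) ^ c)"
    using assms by (fastforce split: prod.splits)
  then obtain P where "\<forall>i\<in>I. (case par i of (N, K, M, _) \<Rightarrow> gepp N K M (P i)) \<and> prob_cond_successful (par i) (P i) \<and>
    (case par i of (N, K, M, _) \<Rightarrow> \<exists>C. implements N K M C (P i) \<and>
         real (circuit_size C) \<le> B * (log 2 (real N) + log 2 (real K)) ^ c)"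
    unfolding bchoice_iff by blast
  then show ?thesis
    unfolding efficient_pcs_gepps_exist_def efficient_family_def
    by (intro exI[of _ P] conjI exI[of _ c] exI[of _ B]) auto
qed

theorem theorem3:
  fixes I :: "(nat \<times> nat \<times> nat \<times> real) set"
  assumes "I = {(n, t, d, \<epsilon>). 0 < n \<and> 0 < t \<and> 0 < d \<and> t < n \<and> 0 \<le> \<epsilon> \<and> \<epsilon> < 1 / 2}"
  shows
    "efficient_pcs_gepps_exist I (\<lambda>(n, t, d, \<epsilon>).
       (2 ^ n,
        (2 ^ n - 1) * 2 ^ (2 * t),
        2 ^ (n - t) * (2 ^ n - 1),
        \<epsilon>, \<epsilon> / 2 powi (int t - 3), 2 * \<epsilon> + sqrt (2 * \<epsilon> / 2 ^ t), 1 / 2 ^ t)) \<and>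
     efficient_pcs_gepps_exist I (\<lambda>(n, t, d, \<epsilon>).
       (2 ^ (2 * n),
        (2 ^ n + 1) * 2 ^ (2 * t),
        2 ^ n * (2 ^ n + 1),
        \<epsilon>, \<epsilon> / 2 powi (int t - 3), 2 * \<epsilon> + sqrt (2 * \<epsilon> / 2 ^ t), 1 / 2 ^ t)) \<and>
     efficient_pcs_gepps_exist I (\<lambda>(n, t, d, \<epsilon>).
       (2 ^ (d * n),
        (2 ^ (d * n) - 1) div (2 ^ n - 1) * 2 ^ (2 * t),
        2 ^ ((d - 1) * n) * ((2 ^ (d * n) - 1) div (2 ^ n - 1)),
        \<epsilon>, \<epsilon> / 2 powi (int t - 3), 2 * \<epsilon> + sqrt (2 * \<epsilon> / 2 ^ t), 1 / 2 ^ t))"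
proof -
  have family: "efficient_pcs_gepps_exist I (\<lambda>(n, t, d, \<epsilon>). (N n t d, K n t d, M n t d,
      \<epsilon>, \<epsilon> / 2 powi (int t - 3), 2 * \<epsilon> + sqrt (2 * \<epsilon> / 2 ^ t), 1 / 2 ^ t))"
    \<comment> \<open>All three families have the dimensions of one hashing circuit and differ only
      in the numbers of kept and discarded qubits and in the untouched factor
      \<open>k\<close>.\<close>
    if dims: "\<And>n t d. 0 < n \<Longrightarrow> t < n \<Longrightarrow> 0 < d \<Longrightarrow>
      \<exists>m s k. 0 < k \<and> N n t d = 2 ^ (m + s) \<and> K n t d = k * 2 ^ (2 * t) \<and> M n t d = 2 ^ m * k" for N K M
  proof (rule efficient_pcs_gepps_existI[where B = 100 and c = 2])
    fix i assume i: "i \<in> I"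
    obtain n t d \<epsilon> where ntd: "i = (n, t, d, \<epsilon>)" by (metis prod_cases4)
    then have par: "0 < n" "t < n" "0 < d" "0 < t" "0 \<le> \<epsilon>" "\<epsilon> < 1 / 2" using i assms by auto
    obtain m s k where k: "0 < k" "N n t d = 2 ^ (m + s)" "K n t d = k * 2 ^ (2 * t)" "M n t d = 2 ^ m * k"
      using dims[OF par(1-3)] by blast
    show "case case i of (n, t, d, \<epsilon>) \<Rightarrow> (N n t d, K n t d, M n t d,
        \<epsilon>, \<epsilon> / 2 powi (int t - 3), 2 * \<epsilon> + sqrt (2 * \<epsilon> / 2 ^ t), 1 / 2 ^ t) of
      (N, K, M, r) \<Rightarrow> \<exists>P. (gepp N K M P \<and> prob_cond_successful (N, K, M, r) P) \<and>
        (\<exists>C. implements N K M C P \<and> real (circuit_size C) \<le> 100 * (log 2 (real N) + log 2 (real K)) ^ 2)"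
      using purification_protocol[OF k(1) par(4-6) k(2-4)] by (simp only: ntd prod.case)
  qed
  have pos: "(0 :: nat) < 2 ^ n - 1" if "0 < n" for n
    using one_less_power[of "2 :: nat" n] that by simp
  show ?thesis
  proof (intro conjI)
    show "efficient_pcs_gepps_exist I (\<lambda>(n, t, d, \<epsilon>).
       (2 ^ n, (2 ^ n - 1) * 2 ^ (2 * t), 2 ^ (n - t) * (2 ^ n - 1),
        \<epsilon>, \<epsilon> / 2 powi (int t - 3), 2 * \<epsilon> + sqrt (2 * \<epsilon> / 2 ^ t), 1 / 2 ^ t))"
    proof (rule family)
      fix n t d :: nat assume n: "0 < n" "t < n"
      show "\<exists>m s (k :: nat). 0 < k \<and> (2 :: nat) ^ n = 2 ^ (m + s) \<and> (2 ^ n - 1) * 2 ^ (2 * t) = k * 2 ^ (2 * t) \<and>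
          2 ^ (n - t) * (2 ^ n - 1) = 2 ^ m * k"
        \<comment> \<open>Of the n qubits, n - t are kept.\<close>
        by (rule exI[of _ "n - t"], rule exI[of _ t], rule exI[of _ "2 ^ n - 1"]) (use n pos[of n] in simp)
    qed
    show "efficient_pcs_gepps_exist I (\<lambda>(n, t, d, \<epsilon>).
       (2 ^ (2 * n), (2 ^ n + 1) * 2 ^ (2 * t), 2 ^ n * (2 ^ n + 1),
        \<epsilon>, \<epsilon> / 2 powi (int t - 3), 2 * \<epsilon> + sqrt (2 * \<epsilon> / 2 ^ t), 1 / 2 ^ t))"
    proof (rule family)
      fix n t d :: nat
      show "\<exists>m s (k :: nat). 0 < k \<and> (2 :: nat) ^ (2 * n) = 2 ^ (m + s) \<and> (2 ^ n + 1) * 2 ^ (2 * t) = k * 2 ^ (2 * t) \<and>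
          2 ^ n * (2 ^ n + 1) = 2 ^ m * k"
        \<comment> \<open>Half of the 2 n qubits are kept.\<close>
        by (rule exI[of _ n], rule exI[of _ n], rule exI[of _ "2 ^ n + 1"]) (simp add: mult_2)
    qed
    show "efficient_pcs_gepps_exist I (\<lambda>(n, t, d, \<epsilon>).
       (2 ^ (d * n), (2 ^ (d * n) - 1) div (2 ^ n - 1) * 2 ^ (2 * t),
        2 ^ ((d - 1) * n) * ((2 ^ (d * n) - 1) div (2 ^ n - 1)),
        \<epsilon>, \<epsilon> / 2 powi (int t - 3), 2 * \<epsilon> + sqrt (2 * \<epsilon> / 2 ^ t), 1 / 2 ^ t))"
    proof (rule family)
      fix n t d :: nat assume n: "0 < n" "0 < d"
      \<comment> \<open>The untouched factor must have positive dimension; the quotient is positive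
        since its numerator is at least its denominator.\<close>
      have "n \<le> d * n" using n by simp
      then have "(2 :: nat) ^ n - 1 \<le> 2 ^ (d * n) - 1" by (intro diff_le_mono power_increasing) auto
      then have "(0 :: nat) < (2 ^ (d * n) - 1) div (2 ^ n - 1)"
        using pos[OF n(1)] by (simp add: div_greater_zero_iff)
      \<comment> \<open>The last n qubits are discarded. For d = 1 no qubit is kept and the output
        has dimension 1.\<close>
      moreover have "d * n = (d - 1) * n + n" using n by (simp add: mult_eq_if)
      ultimately show "\<exists>m s (k :: nat). 0 < k \<and> (2 :: nat) ^ (d * n) = 2 ^ (m + s) \<and>
          (2 ^ (d * n) - 1) div (2 ^ n - 1) * 2 ^ (2 * t) = k * 2 ^ (2 * t) \<and>
          2 ^ ((d - 1) * n) * ((2 ^ (d * n) - 1) div (2 ^ n - 1)) = 2 ^ m * k"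
        by metis
    qed
  qed
qed

end
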